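(* Let $g(0)=0$ and $g(k)=\Delta+\gamma(k)$ for $k\ge1$ be an admissible gap penalty (as specified in the context), where $\gamma(1)=0$ and $\lim_{k\to\infty}\gamma(k)/\log k=\infty$. Then $\psi(\theta)=\lim_{\kappa\to\infty}\psi_\kappa(\theta)/\kappa$ is well defined, convex and finite for all $\theta>0$. Moreover, for all large $\Delta$ (i.e., for fixed $\gamma$ there is $\Delta_0$ such that for all $\Delta\ge\Delta_0$), $$\psi(\theta)=0\ \text{ has a unique positive root }\ \widetilde{\theta}.\qquad( * )$$ Whenever $( * )$ holds, the following also hold. (a) If $m=m(c)$ and $n=n(c)$ are positive integers with $\min\{m,n\}/c\to\infty$ and $\log(mn)=o(c)$ as $c\to\infty$, then $$\lim_{c\to\infty}-c^{-1}\log P\{H(\mathbf{x}_m,\mathbf{y}_n)\ge c\}=\widetilde{\theta}.$$ (b) $H(\mathbf{x}_n,\mathbf{y}_n)/\log n\to 2/\widetilde{\theta}$ almost surely as $n\to\infty$.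
   Context: Setting. $\mathcal{A}$ is a finite alphabet, $K:\mathcal{A}\times\mathcal{A}\to\mathbf{R}$ is a symmetric score matrix, $K(a,b)=K(b,a)$. The letters $x_1,x_2,\dots$ and $y_1,y_2,\dots$ are all independent and identically distributed with law $\mu$ on $\mathcal{A}$, $\mu(a)>0$ for all $a\in\mathcal{A}$. It is assumed that $E[K(x_1,y_1)]<0$ and $K_{\max}:=\max_{a,b\in\mathcal{A}}K(a,b)>0$. Write $\mathbf{x}_m=x_1\cdots x_m$, $\mathbf{y}_n=y_1\cdots y_n$. Gap penalty. $g:\{0,1,\dots\}\to[0,\infty)$ is nondecreasing with $g(0)=0$ and concave, i.e. $g(k+1)-g(k)\le g(k)-g(k-1)$ for all $k\ge1$. (For $g(k)=\Delta+\gamma(k)$, $k\geq 1$, with $\gamma(1)=0$, this means: $\gamma$ is nondecreasing and concave on $\{1,2,\dots\}$ and $\Delta\ge\gamma(2)$.) Alignments and scores. $\mathcal{Z}$ is the class of all nonempty candidate alignments $\mathbf{z}=\{(i(t),j(t)):1\le t\le u\}$, $u\ge1$, where $i(1)<\cdots<i(u)$ and $j(1)<\cdots<j(u)$ are positive integers; $|\mathbf{z}|=u$. If $i(u)\le m$ and $j(u)\le n$, $$S_{\mathbf{z}}(\mathbf{x}_m,\mathbf{y}_n)=\sum_{t=1}^{u}K(x_{i(t)},y_{j(t)})-\sum_{t=1}^{u-1}\bigl[g(i(t+1)-i(t)-1)+g(j(t+1)-j(t)-1)\bigr],$$ $$R_{\mathbf{z}}(\mathbf{x}_m,\mathbf{y}_n)=S_{\mathbf{z}}(\mathbf{x}_m,\mathbf{y}_n)-g(i(1)-1)-g(j(1)-1)-g(m-i(u))-g(n-j(u)),$$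 and both are $-\infty$ if $i(u)>m$ or $j(u)>n$. The local alignment score is $H(\mathbf{x}_m,\mathbf{y}_n)=\sup_{\mathbf{z}\in\mathcal{Z}}S_{\mathbf{z}}(\mathbf{x}_m,\mathbf{y}_n)$. The functions $\psi_\kappa$. For a positive integer $\kappa$ let $\mathcal{Z}_\kappa=\{\mathbf{z}\in\mathcal{Z}:(1,1)\in\mathbf{z},\ |\mathbf{z}|=\kappa\}$, and for $m,n\ge\kappa$ let $G_\kappa(\mathbf{x}_m,\mathbf{y}_n)=\max_{\zeta\in\mathcal{Z}_\kappa}R_\zeta(\mathbf{x}_m,\mathbf{y}_n)$. For $\theta>0$ let $$h_\kappa(\theta)=\sum_{m,n\ge\kappa}E\exp[\theta G_\kappa(\mathbf{x}_m,\mathbf{y}_n)],\qquad \psi_\kappa(\theta)=\log h_\kappa(\theta).$$ *)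

theory Defs
  imports "HOL-Probability.Probability" "HOL-Library.Landau_Symbols"
begin

(* The value at 0 is overridden, so only gamma restricted to {1,2,...} matters. *)
definition gap :: "real \<Rightarrow> (nat \<Rightarrow> real) \<Rightarrow> nat \<Rightarrow> real" where
  "gap \<Delta> \<gamma> k = (if k = 0 then 0 else \<Delta> + \<gamma> k)"

definition admissible_gap :: "(nat \<Rightarrow> real) \<Rightarrow> bool" where
  "admissible_gap g \<longleftrightarrow>
     g 0 = 0 \<and> (\<forall>k. 0 \<le> g k) \<and> mono g \<and> (\<forall>k\<ge>1. g (k + 1) - g k \<le> g k - g (k - 1))"

(* A candidate alignment {(i(1),j(1)),...,(i(u),j(u))} is encoded as the list of its pairs in
   increasing order; this encoding is one-to-one, and u is the length of the list. *)
definition alignments :: "(nat \<times> nat) list set" where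
  "alignments = {z. z \<noteq> [] \<and> (\<forall>p\<in>set z. 1 \<le> fst p \<and> 1 \<le> snd p) \<and>
     sorted_wrt (\<lambda>p q. fst p < fst q \<and> snd p < snd q) z}"

(* Letter sequences are functions on nat; only the letters with index 1,...,m of x and 1,...,n of y
   are used. The alignment z fits iff its last pair (i(u),j(u)) satisfies i(u) <= m and j(u) <= n. *)
definition align_score ::
  "('a \<Rightarrow> 'a \<Rightarrow> real) \<Rightarrow> (nat \<Rightarrow> real) \<Rightarrow> (nat \<Rightarrow> 'a) \<Rightarrow> (nat \<Rightarrow> 'a) \<Rightarrow> nat \<Rightarrow> nat \<Rightarrow>
   (nat \<times> nat) list \<Rightarrow> ereal" where
  "align_score K g x y m n z =
     (if fst (last z) \<le> m \<and> snd (last z) \<le> n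
      then ereal ((\<Sum>t<length z. K (x (fst (z ! t))) (y (snd (z ! t))))
        - (\<Sum>t<length z - 1. g (fst (z ! Suc t) - fst (z ! t) - 1)
                            + g (snd (z ! Suc t) - snd (z ! t) - 1)))
      else - \<infinity>)"

(* If z does not fit, the first summand is - infinity and hence so is the whole expression. *)
definition global_align_score ::
  "('a \<Rightarrow> 'a \<Rightarrow> real) \<Rightarrow> (nat \<Rightarrow> real) \<Rightarrow> (nat \<Rightarrow> 'a) \<Rightarrow> (nat \<Rightarrow> 'a) \<Rightarrow> nat \<Rightarrow> nat \<Rightarrow>
   (nat \<times> nat) list \<Rightarrow> ereal" where
  "global_align_score K g x y m n z =
     align_score K g x y m n z
     - ereal (g (fst (hd z) - 1)) - ereal (g (snd (hd z) - 1))
     - ereal (g (m - fst (last z))) - ereal (g (n - snd (last z)))"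

definition local_score ::
  "('a \<Rightarrow> 'a \<Rightarrow> real) \<Rightarrow> (nat \<Rightarrow> real) \<Rightarrow> (nat \<Rightarrow> 'a) \<Rightarrow> (nat \<Rightarrow> 'a) \<Rightarrow> nat \<Rightarrow> nat \<Rightarrow> ereal" where
  "local_score K g x y m n = (SUP z\<in>alignments. align_score K g x y m n z)"

definition anchored_alignments :: "nat \<Rightarrow> (nat \<times> nat) list set" where
  "anchored_alignments \<kappa> = {z \<in> alignments. (1, 1) \<in> set z \<and> length z = \<kappa>}"

(* Only finitely many alignments fit, and the others have score - infinity, so for m, n >= kappa >= 1
   the supremum is a maximum and is finite. *)
definition anchored_score ::
  "('a \<Rightarrow> 'a \<Rightarrow> real) \<Rightarrow> (nat \<Rightarrow> real) \<Rightarrow> nat \<Rightarrow> (nat \<Rightarrow> 'a) \<Rightarrow> (nat \<Rightarrow> 'a) \<Rightarrow> nat \<Rightarrow> nat \<Rightarrow> ereal" where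
  "anchored_score K g \<kappa> x y m n =
     (SUP z\<in>anchored_alignments \<kappa>. global_align_score K g x y m n z)"

(* Taken in ennreal, so that a divergent series has the value infinity. *)
definition h_kappa ::
  "'b measure \<Rightarrow> (nat \<Rightarrow> 'b \<Rightarrow> 'a) \<Rightarrow> (nat \<Rightarrow> 'b \<Rightarrow> 'a) \<Rightarrow> ('a \<Rightarrow> 'a \<Rightarrow> real) \<Rightarrow> (nat \<Rightarrow> real) \<Rightarrow>
   nat \<Rightarrow> real \<Rightarrow> ennreal" where
  "h_kappa M X Y K g \<kappa> \<theta> =
     (\<Sum>\<^sub>\<infinity>(m, n)\<in>{\<kappa>..} \<times> {\<kappa>..}.
        \<integral>\<^sup>+\<omega>. ennreal (exp (\<theta> * real_of_ereal
          (anchored_score K g \<kappa> (\<lambda>i. X i \<omega>) (\<lambda>j. Y j \<omega>) m n))) \<partial>M)"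

definition log_ennreal :: "ennreal \<Rightarrow> ereal" where
  "log_ennreal r = (if r = 0 then - \<infinity> else if r = top then \<infinity> else ereal (ln (enn2real r)))"

definition psi_kappa ::
  "'b measure \<Rightarrow> (nat \<Rightarrow> 'b \<Rightarrow> 'a) \<Rightarrow> (nat \<Rightarrow> 'b \<Rightarrow> 'a) \<Rightarrow> ('a \<Rightarrow> 'a \<Rightarrow> real) \<Rightarrow> (nat \<Rightarrow> real) \<Rightarrow>
   nat \<Rightarrow> real \<Rightarrow> ereal" where
  "psi_kappa M X Y K g \<kappa> \<theta> = log_ennreal (h_kappa M X Y K g \<kappa> \<theta>)"

definition psi ::
  "'b measure \<Rightarrow> (nat \<Rightarrow> 'b \<Rightarrow> 'a) \<Rightarrow> (nat \<Rightarrow> 'b \<Rightarrow> 'a) \<Rightarrow> ('a \<Rightarrow> 'a \<Rightarrow> real) \<Rightarrow> (nat \<Rightarrow> real) \<Rightarrow>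
   real \<Rightarrow> ereal" where
  "psi M X Y K g \<theta> = lim (\<lambda>\<kappa>. psi_kappa M X Y K g \<kappa> \<theta> / ereal (real \<kappa>))"

end

theory Submission
  imports Defs "HOL-Real_Asymp.Real_Asymp"
begin

text \<open>Every alignment that starts at the pair (1, 1) cuts its two words into blocks: an aligned pair opens
a block of each word, and the gap that follows the pair is the rest of the block. The score is
additive over blocks, because the gap at the end of a word is charged like an inner gap. Cutting an
alignment with \<open>k + l\<close> pairs behind its \<open>k\<close>-th pair therefore gives \<open>h (k + l) \<theta> \<le> h k \<theta> * h l \<theta>\<close>, and
\<open>ln (h k \<theta>) / k\<close> converges to its infimum \<open>Psi \<theta>\<close>. As a limit of logarithms of mixtures of exponentials,
\<open>Psi\<close> is convex. Concavity of \<open>g\<close> makes one long gap cheaper than many short ones, so an alignment with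
\<open>k\<close> pairs scores at most \<open>k * Kmax - g (m - k) - g (n - k)\<close>; since \<open>g\<close> outgrows the logarithm, the
exponentials of the two penalties are summable over \<open>m\<close> and \<open>n\<close>, for every \<open>\<theta> > 0\<close>.

This gives \<open>Psi \<theta> \<le> \<theta> * Kmax\<close>, and a single pair of words gives \<open>Psi \<theta> \<ge> \<theta> * Kmax - const\<close>. So \<open>Psi\<close> is at
most 0 near 0 and tends to infinity, and by convexity it has exactly one positive root as soon as it
is negative somewhere. For large \<open>\<Delta>\<close> this happens, because \<open>Psi\<close> is at most \<open>\<lambda>\<theta>. ln (h 1 \<theta>)\<close>, which is close
to the logarithm of the moment generating function of \<open>K\<close>, and \<open>K\<close> has negative mean. At a unique
root \<open>\<theta>'\<close> the function changes sign from negative to positive.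

Tail of the local score. For \<open>\<theta> < \<theta>'\<close> a union bound over the two segments that an optimal alignment
uses, and over its number \<open>k\<close> of pairs, bounds the probability of a score \<open>\<ge> c\<close> by
\<open>m * n * exp (- \<theta> * c)\<close> times the sum of the \<open>h k \<theta>\<close>, which is finite because \<open>Psi \<theta> < 0\<close>
(\<open>local_hit_upper\<close>). For \<open>\<theta> > \<theta>'\<close> there are a single block size and a level \<open>l \<ge> 1\<close> that is reached
with probability at least \<open>exp (- \<theta> * l)\<close> (\<open>exists_good_block_size\<close>). Concatenating independent blocks
of this size reaches \<open>r * l\<close> with probability at least \<open>exp (- \<theta> * r * l)\<close>, using only a number of
letters linear in \<open>r\<close>.

Almost sure growth. The upper bound is the tail bound along powers of 2, Borel-Cantelli and
monotonicity. For the lower bound each sequence is cut into \<open>N\<close> blocks, and the second moment of the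
number of pairs of blocks that reach the level has to be controlled. Pairs that share a block are
dependent: a few blocks of \<open>X\<close> that match far too many blocks of \<open>Y\<close> could ruin the estimate. So the
matching relation is first thinned to one of probability \<open>p\<close> whose maximal degrees on the two sides
have a product of order \<open>p\<close>; here and in the loss of probability, the factors are polynomial in the
logarithm of \<open>p\<close> (\<open>regular_subrelation\<close>). This is where symmetry enters: \<open>K\<close> is symmetric and all letters have
the same law, so two words followed by two words with exchanged roles form a block pair whose
relation has probability \<open>p\<^sup>2\<close> and degrees of order \<open>p\<close> on both sides (\<open>symmetric_regular_blocks\<close>). Degrees
of the order of the square root of the probability are harmless until \<open>N\<^sup>2 * p\<^sup>2\<close> is of order 1, which
is why scores up to \<open>2 / \<theta>'\<close> times the logarithm of the length occur.\<close>

section \<open>Words and their weights\<close>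

definition words :: "nat \<Rightarrow> 'a list set" where
  "words n = {w. length w = n}"

definition weight :: "'a pmf \<Rightarrow> 'a list \<Rightarrow> real" where
  "weight \<mu> w = prod_list (map (pmf \<mu>) w)"

lemma finite_words [simp, intro]: "finite (words n :: 'a::finite list set)"
  using finite_lists_length_eq[of "UNIV :: 'a set" n] by (simp add: words_def)

lemma length_words: "w \<in> words n \<Longrightarrow> length w = n"
  by (simp add: words_def)

lemma weight_append: "weight \<mu> (u @ v) = weight \<mu> u * weight \<mu> v"
  by (simp add: weight_def)

lemma weight_nonneg [simp]: "0 \<le> weight \<mu> w"
  unfolding weight_def by (induction w) auto

lemma weight_nth: "weight \<mu> w = (\<Prod>t<length w. pmf \<mu> (w ! t))"
  unfolding weight_def by (simp add: prod.list_conv_set_nth lessThan_atLeast0)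

lemma sum_words_append:
  fixes F :: "'a::finite list \<Rightarrow> real"
  shows "(\<Sum>w\<in>words (a + b). F w) = (\<Sum>u\<in>words a. \<Sum>v\<in>words b. F (u @ v))"
proof -
  have "bij_betw (\<lambda>(u, v). u @ v) (words a \<times> words b) (words (a + b))"
    by (rule bij_betw_byWitness[where f' = "\<lambda>w. (take a w, drop a w)"])
      (auto simp: words_def)
  from sum.reindex_bij_betw[OF this, of F] show ?thesis
    by (simp add: sum.cartesian_product case_prod_unfold)
qed

lemma sum_words_1: "(\<Sum>w\<in>words 1. F w) = (\<Sum>a\<in>UNIV. F [a])" for F :: "'a::finite list \<Rightarrow> real"
proof -
  have 1: "words 1 = (\<lambda>a. [a]) ` UNIV"
    by (auto simp: words_def length_Suc_conv)
  show ?thesis unfolding 1 by (subst sum.reindex) (auto simp: inj_on_def)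
qed

lemma sum_weight_words [simp]: "(\<Sum>w\<in>words n. weight \<mu> w) = (1::real)"
  for \<mu> :: "'a::finite pmf"
proof (induction n)
  case 0
  have "words 0 = {[] :: 'a list}" by (auto simp: words_def)
  then show ?case by (simp add: weight_def)
next
  case (Suc n)
  have "(\<Sum>u\<in>words 1. weight \<mu> u) = (\<Sum>a\<in>UNIV. pmf \<mu> a)"
    unfolding sum_words_1 by (simp add: weight_def)
  also have "\<dots> = 1" by (rule sum_pmf_eq_1) auto
  finally have s1: "(\<Sum>u\<in>words 1. weight \<mu> u) = 1" .
  have "(\<Sum>w\<in>words (1 + n). weight \<mu> w) = (\<Sum>u\<in>words 1. \<Sum>v\<in>words n. weight \<mu> (u @ v))"
    by (rule sum_words_append)
  also have "\<dots> = (\<Sum>u\<in>words 1. weight \<mu> u * (\<Sum>v\<in>words n. weight \<mu> v))"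
    by (simp add: weight_append sum_distrib_left)
  finally show ?case using Suc.IH s1 by simp
qed

text \<open>The letters outside of a segment integrate to 1.\<close>

lemma sum_words_segment:
  fixes f :: "'a::finite list \<Rightarrow> real"
  assumes "i + l \<le> n"
  shows "(\<Sum>w\<in>words n. weight \<mu> w * f (take l (drop i w))) = (\<Sum>w\<in>words l. weight \<mu> w * f w)"
proof -
  obtain j where n: "n = i + (l + j)" using assms by (metis add.assoc le_Suc_ex)
  have "(\<Sum>w\<in>words n. weight \<mu> w * f (take l (drop i w)))
    = (\<Sum>u\<in>words i. \<Sum>v\<in>words l. \<Sum>w\<in>words j. weight \<mu> u * (weight \<mu> v * weight \<mu> w * f v))"
    unfolding n sum_words_append
    by (intro sum.cong refl) (auto simp: words_def weight_append)
  also have "\<dots> = (\<Sum>u\<in>words i. weight \<mu> u * (\<Sum>v\<in>words l. weight \<mu> v * f v * (\<Sum>w\<in>words j. weight \<mu> w)))"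
    by (simp add: sum_distrib_left mult_ac del: sum_weight_words)
  also have "\<dots> = (\<Sum>v\<in>words l. weight \<mu> v * f v)"
    by (simp add: sum_distrib_right[symmetric])
  finally show ?thesis .
qed

section \<open>Alignments as sequences of blocks\<close>

text \<open>One step of the induction is one block of each word: the letters \<open>a\<close> and \<open>b\<close> are aligned, and the
letters \<open>us\<close> and \<open>vs\<close> that follow them are unaligned. Since the last block may end in unaligned
letters, end gaps are charged. The case of 0 pairs is allowed only for empty words; it makes
concatenation of aligned words additive without side conditions.\<close>

inductive aligned :: "('a \<Rightarrow> 'a \<Rightarrow> real) \<Rightarrow> (nat \<Rightarrow> real) \<Rightarrow> nat \<Rightarrow> 'a list \<Rightarrow> 'a list \<Rightarrow> real \<Rightarrow> bool"
  for K g where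
  Nil: "aligned K g 0 [] [] 0"
| Cons: "aligned K g k u v s \<Longrightarrow>
    aligned K g (Suc k) (a # us @ u) (b # vs @ v) (K a b - g (length us) - g (length vs) + s)"

inductive_cases aligned_0E: "aligned K g 0 u v s"
inductive_cases aligned_SucE: "aligned K g (Suc k) u v s"

lemma aligned_0_iff [simp]: "aligned K g 0 u v s \<longleftrightarrow> u = [] \<and> v = [] \<and> s = 0"
  by (auto elim: aligned_0E intro: aligned.Nil)

lemma aligned_append:
  assumes "aligned K g k u v s" "aligned K g l u' v' s'"
  shows "aligned K g (k + l) (u @ u') (v @ v') (s + s')"
  using assms
proof (induction rule: aligned.induct)
  case (Cons k u v s a us b vs)
  from aligned.Cons[OF Cons.IH[OF Cons.prems], of a us b vs] show ?case
    by (simp add: algebra_simps)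
qed simp

text \<open>Converse of \<open>aligned_append\<close>: the cut is placed directly in front of an aligned pair, so that no gap is
divided between the two parts. This is the reason for submultiplicativity of the generating
functions.\<close>

lemma aligned_split:
  assumes "aligned K g (k + l) u v s"
  shows "\<exists>u1 u2 v1 v2 s1 s2. u = u1 @ u2 \<and> v = v1 @ v2 \<and> s = s1 + s2 \<and>
     aligned K g k u1 v1 s1 \<and> aligned K g l u2 v2 s2"
  using assms
proof (induction k arbitrary: u v s)
  case 0
  then show ?case by auto
next
  case (Suc k)
  from Suc.prems have "aligned K g (Suc (k + l)) u v s" by simp
  then obtain u0 v0 s0 a us b vs where
    e: "u = a # us @ u0" "v = b # vs @ v0" "s = K a b - g (length us) - g (length vs) + s0"
    and 0: "aligned K g (k + l) u0 v0 s0"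
    by (elim aligned_SucE) blast
  from Suc.IH[OF 0] obtain u1 u2 v1 v2 s1 s2 where
    i: "u0 = u1 @ u2" "v0 = v1 @ v2" "s0 = s1 + s2" "aligned K g k u1 v1 s1" "aligned K g l u2 v2 s2"
    by blast
  have "aligned K g (Suc k) (a # us @ u1) (b # vs @ v1) (K a b - g (length us) - g (length vs) + s1)"
    by (rule aligned.Cons[OF i(4)])
  with i(5) e i show ?case
    by (intro exI[of _ "a # us @ u1"] exI[of _ u2] exI[of _ "b # vs @ v1"] exI[of _ v2]
        exI[of _ "K a b - g (length us) - g (length vs) + s1"] exI[of _ s2]) auto
qed

lemma aligned_length:
  "aligned K g k u v s \<Longrightarrow> k \<le> length u \<and> k \<le> length v"
  by (induction rule: aligned.induct) auto

lemma aligned_swap: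
  assumes "\<And>a b. K a b = K b a"
  shows "aligned K g k u v s \<Longrightarrow> aligned K g k v u s"
proof (induction rule: aligned.induct)
  case (Cons k u v s a us b vs)
  have "K b a - g (length vs) - g (length us) + s = K a b - g (length us) - g (length vs) + s"
    using assms[of a b] by simp
  then show ?case using aligned.Cons[OF Cons.IH, of b vs a us] by (simp only: append_Cons)
qed simp

lemma aligned_finite: "finite {s. aligned K g k u v s}"
proof (induction k arbitrary: u v)
  case 0
  show ?case by (rule finite_subset[of _ "{0}"]) auto
next
  case (Suc k)
  have "{s. aligned K g (Suc k) u v s} \<subseteq>
    (\<Union>i\<in>{..length u}. \<Union>j\<in>{..length v}.
      (\<lambda>s. K (hd u) (hd v) - g i - g j + s) ` {s. aligned K g k (drop (Suc i) u) (drop (Suc j) v) s})"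
  proof
    fix s assume "s \<in> {s. aligned K g (Suc k) u v s}"
    then obtain u0 v0 s0 a us b vs where
      "u = a # us @ u0" "v = b # vs @ v0" "s = K a b - g (length us) - g (length vs) + s0"
      "aligned K g k u0 v0 s0"
      by (auto elim: aligned_SucE)
    then show "s \<in> (\<Union>i\<in>{..length u}. \<Union>j\<in>{..length v}.
      (\<lambda>s. K (hd u) (hd v) - g i - g j + s) ` {s. aligned K g k (drop (Suc i) u) (drop (Suc j) v) s})"
      by (intro UN_I[of "length us"] UN_I[of "length vs"]) auto
  qed
  then show ?case by (rule finite_subset) (auto intro: Suc.IH)
qed

lemma aligned_exists:
  assumes "k \<ge> 1" "k \<le> length u" "k \<le> length v"
  shows "\<exists>s. aligned K g k u v s"
  using assms
proof (induction k arbitrary: u v rule: dec_induct)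
  case base
  then obtain a us b vs where "u = a # us @ []" "v = b # vs @ []"
    by (cases u; cases v) auto
  with aligned.Cons[OF aligned.Nil, of K g a us b vs] show ?case by auto
next
  case (step k)
  then obtain a us b vs where e: "u = a # [] @ us" "v = b # [] @ vs"
    by (cases u; cases v) auto
  with step obtain s where "aligned K g k us vs s" by fastforce
  from aligned.Cons[OF this, of a "[]" b "[]"] e show ?case by auto
qed

text \<open>The score called \<open>G\<close> in the literature on this model, as a function of the two words.\<close>

definition best :: "('a \<Rightarrow> 'a \<Rightarrow> real) \<Rightarrow> (nat \<Rightarrow> real) \<Rightarrow> nat \<Rightarrow> 'a list \<Rightarrow> 'a list \<Rightarrow> real" where
  "best K g k u v = Max {s. aligned K g k u v s}"

lemma best_ge: "aligned K g k u v s \<Longrightarrow> s \<le> best K g k u v"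
  unfolding best_def by (rule Max_ge[OF aligned_finite]) simp

lemma best_aligned:
  assumes "k \<ge> 1" "k \<le> length u" "k \<le> length v"
  shows "aligned K g k u v (best K g k u v)"
  using Max_in[OF aligned_finite] aligned_exists[OF assms] unfolding best_def by fastforce

section \<open>Candidate alignments and blocks\<close>

definition segment :: "(nat \<Rightarrow> 'a) \<Rightarrow> nat \<Rightarrow> nat \<Rightarrow> 'a list" where
  "segment x i m = map x [i..<Suc m]"

lemma length_segment [simp]: "length (segment x i m) = Suc m - i"
  by (simp add: segment_def del: upt_Suc)

lemma segment_Cons: "i \<le> m \<Longrightarrow> segment x i m = x i # segment x (Suc i) m"
  unfolding segment_def by (subst upt_conv_Cons) auto

lemma segment_append:
  assumes "i \<le> Suc j" "j \<le> m"
  shows "segment x i m = segment x i j @ segment x (Suc j) m"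
proof -
  have "[i..<Suc j + (m - j)] = [i..<Suc j] @ [Suc j..<Suc j + (m - j)]"
    using assms by (intro upt_add_eq_append) simp
  then show ?thesis using assms by (simp add: segment_def del: upt_Suc)
qed

lemma take_drop_segment:
  "i + l \<le> m \<Longrightarrow> take l (drop i (segment x 1 m)) = segment x (Suc i) (i + l)"
  by (simp add: segment_def take_map drop_map drop_upt take_upt del: upt_Suc)

definition pair_score ::
  "('a \<Rightarrow> 'a \<Rightarrow> real) \<Rightarrow> (nat \<Rightarrow> real) \<Rightarrow> (nat \<Rightarrow> 'a) \<Rightarrow> (nat \<Rightarrow> 'a) \<Rightarrow> (nat \<times> nat) list \<Rightarrow> real" where
  "pair_score K g x y z = (\<Sum>t<length z. K (x (fst (z ! t))) (y (snd (z ! t))))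
        - (\<Sum>t<length z - 1. g (fst (z ! Suc t) - fst (z ! t) - 1)
                            + g (snd (z ! Suc t) - snd (z ! t) - 1))"

lemma pair_score_single: "pair_score K g x y [p] = K (x (fst p)) (y (snd p))"
  by (simp add: pair_score_def)

lemma pair_score_Cons:
  "pair_score K g x y (p # q # z) = K (x (fst p)) (y (snd p))
     - g (fst q - fst p - 1) - g (snd q - snd p - 1) + pair_score K g x y (q # z)"
  unfolding pair_score_def
  by (simp add: sum.lessThan_Suc_shift algebra_simps del: sum.lessThan_Suc)

lemma alignments_single: "[p] \<in> alignments \<longleftrightarrow> 1 \<le> fst p \<and> 1 \<le> snd p"
  by (simp add: alignments_def)

lemma alignments_Cons:
  "p # q # z \<in> alignments \<longleftrightarrow>
     1 \<le> fst p \<and> 1 \<le> snd p \<and> fst p < fst q \<and> snd p < snd q \<and> q # z \<in> alignments"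
  by (auto simp: alignments_def)

lemma alignment_hd_le:
  assumes "z \<in> alignments" "p \<in> set z"
  shows "fst (hd z) \<le> fst p \<and> snd (hd z) \<le> snd p"
  using assms by (cases z) (auto simp: alignments_def)

lemma alignment_le_last:
  assumes "z \<in> alignments" "p \<in> set z"
  shows "fst p \<le> fst (last z) \<and> snd p \<le> snd (last z)"
  using assms
proof (induction z arbitrary: p rule: induct_list012)
  case (3 q r z)
  have rz: "r # z \<in> alignments" and qr: "fst q < fst r" "snd q < snd r"
    using "3.prems"(1) by (auto simp: alignments_Cons)
  have l: "last (q # r # z) = last (r # z)" by simp
  show ?case
  proof (cases "p = q")
    case True
    with qr "3.IH"(2)[OF rz, of r] show ?thesis unfolding l by auto
  next
    case False
    with "3.prems"(2) "3.IH"(2)[OF rz, of p] show ?thesis unfolding l by auto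
  qed
qed (auto simp: alignments_def)

text \<open>The start of the segments is the first pair of the alignment and moves with it in the induction,
which is why it is not fixed at 1.\<close>

lemma aligned_of_alignment:
  assumes "z \<in> alignments" "fst (last z) \<le> m" "snd (last z) \<le> n"
  shows "aligned K g (length z) (segment x (fst (hd z)) m) (segment y (snd (hd z)) n)
     (pair_score K g x y z - g (m - fst (last z)) - g (n - snd (last z)))"
  using assms
proof (induction z rule: induct_list012)
  case 1
  then show ?case by (simp add: alignments_def)
next
  case (2 p)
  then have "segment x (fst p) m = x (fst p) # segment x (Suc (fst p)) m @ []"
    "segment y (snd p) n = y (snd p) # segment y (Suc (snd p)) n @ []"
    by (auto simp: segment_Cons)
  with aligned.Cons[OF aligned.Nil, of K g "x (fst p)" "segment x (Suc (fst p)) m" "y (snd p)"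
      "segment y (Suc (snd p)) n"]
  show ?case by (simp add: pair_score_single)
next
  case (3 p q z)
  have pq: "fst p < fst q" "snd p < snd q" and qz: "q # z \<in> alignments"
    using 3(3) by (auto simp: alignments_Cons)
  have lq: "fst q \<le> m" "snd q \<le> n"
    using alignment_hd_le[OF qz last_in_set] 3(4,5) by (simp_all del: last.simps add: last_ConsR)
  have e: "segment x (fst p) m = x (fst p) # segment x (Suc (fst p)) (fst q - 1) @ segment x (fst q) m"
    "segment y (snd p) n = y (snd p) # segment y (Suc (snd p)) (snd q - 1) @ segment y (snd q) n"
    using pq lq segment_append[of "Suc (fst p)" "fst q - 1" m x]
      segment_append[of "Suc (snd p)" "snd q - 1" n y]
    by (auto simp: segment_Cons[of "fst p"] segment_Cons[of "snd p"])
  have l: "length (segment x (Suc (fst p)) (fst q - 1)) = fst q - fst p - 1"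
    "length (segment y (Suc (snd p)) (snd q - 1)) = snd q - snd p - 1"
    using pq by auto
  have IH: "aligned K g (length (q # z)) (segment x (fst q) m) (segment y (snd q) n)
     (pair_score K g x y (q # z) - g (m - fst (last (q # z))) - g (n - snd (last (q # z))))"
    using 3(2)[OF qz] 3(4,5) by simp
  from aligned.Cons[OF IH, of "x (fst p)" "segment x (Suc (fst p)) (fst q - 1)" "y (snd p)"
      "segment y (Suc (snd p)) (snd q - 1)"]
  show ?case unfolding l e[symmetric]
    by (simp add: pair_score_Cons algebra_simps)
qed

lemma alignment_of_aligned:
  assumes "aligned K g k u v s" "k \<ge> 1" "u = segment x i m" "v = segment y j n" "i \<ge> 1" "j \<ge> 1"
  shows "\<exists>z\<in>alignments. length z = k \<and> hd z = (i, j) \<and> fst (last z) \<le> m \<and> snd (last z) \<le> n \<and>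
     s = pair_score K g x y z - g (m - fst (last z)) - g (n - snd (last z))"
  using assms
proof (induction arbitrary: i j rule: aligned.induct)
  case (Cons k u v s a us b vs)
  have lu: "Suc (length us + length u) = Suc m - i" and lv: "Suc (length vs + length v) = Suc n - j"
    using arg_cong[OF Cons.prems(2), of length] arg_cong[OF Cons.prems(3), of length] by auto
  then have im: "i \<le> m" "j \<le> n" by auto
  have ab: "a = x i" "us @ u = segment x (Suc i) m" "b = y j" "vs @ v = segment y (Suc j) n"
    using Cons.prems(2,3) by (auto simp: segment_Cons[OF im(1)] segment_Cons[OF im(2)])
  have "segment x (Suc i) m = segment x (Suc i) (i + length us) @ segment x (Suc i + length us) m"
    using lu segment_append[of "Suc i" "i + length us" m x] by simp
  then have "us @ u = segment x (Suc i) (i + length us) @ segment x (Suc i + length us) m"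
    using ab(2) by simp
  then have u: "u = segment x (Suc i + length us) m"
    by (subst (asm) append_eq_append_conv) auto
  have "segment y (Suc j) n = segment y (Suc j) (j + length vs) @ segment y (Suc j + length vs) n"
    using lv segment_append[of "Suc j" "j + length vs" n y] by simp
  then have "vs @ v = segment y (Suc j) (j + length vs) @ segment y (Suc j + length vs) n"
    using ab(4) by simp
  then have v: "v = segment y (Suc j + length vs) n"
    by (subst (asm) append_eq_append_conv) auto
  show ?case
  proof (cases "k = 0")
    case True
    with Cons.hyps have "u = []" "v = []" "s = 0" by auto
    with lu lv have "length us = m - i" "length vs = n - j" by auto
    with \<open>s = 0\<close> True Cons.prems im ab show ?thesis
      by (intro bexI[of _ "[(i, j)]"]) (auto simp: pair_score_single alignments_single)
  next
    case False
    then have "1 \<le> k" by simp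
    from Cons.IH[OF this u v] obtain z where z: "z \<in> alignments" "length z = k"
      "hd z = (Suc i + length us, Suc j + length vs)" "fst (last z) \<le> m" "snd (last z) \<le> n"
      "s = pair_score K g x y z - g (m - fst (last z)) - g (n - snd (last z))"
      by auto
    then obtain q z' where q: "z = q # z'" using \<open>1 \<le> k\<close> by (cases z) auto
    from z q ab Cons.prems show ?thesis
      by (intro bexI[of _ "(i, j) # z"]) (auto simp: pair_score_Cons alignments_Cons)
  qed
qed simp

lemma align_score_pair_score:
  "align_score K g x y m n z =
     (if fst (last z) \<le> m \<and> snd (last z) \<le> n then ereal (pair_score K g x y z) else - \<infinity>)"
  by (simp add: align_score_def pair_score_def)

text \<open>Both coordinates increase strictly along an alignment and are at least 1.\<close>

lemma anchored_hd:
  assumes "z \<in> anchored_alignments k"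
  shows "hd z = (1, 1)"
proof -
  have z: "z \<in> alignments" "(1, 1) \<in> set z" "z \<noteq> []"
    using assms by (auto simp: anchored_alignments_def)
  then have "1 \<le> fst (hd z)" "1 \<le> snd (hd z)" by (auto simp: alignments_def)
  with alignment_hd_le[OF z(1,2)] show ?thesis by (auto simp: prod_eq_iff)
qed

lemma anchored_score_eq_best:
  assumes "g 0 = 0" "k \<ge> 1" "k \<le> m" "k \<le> n"
  shows "anchored_score K g k x y m n = ereal (best K g k (segment x 1 m) (segment y 1 n))"
  unfolding anchored_score_def
proof (rule antisym)
  show "(SUP z\<in>anchored_alignments k. global_align_score K g x y m n z)
     \<le> ereal (best K g k (segment x 1 m) (segment y 1 n))"
  proof (rule SUP_least)
    fix z assume z: "z \<in> anchored_alignments k"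
    have "z \<in> alignments" "length z = k" using z by (auto simp: anchored_alignments_def)
    with best_ge[OF aligned_of_alignment[of z m n K g x y]] anchored_hd[OF z] assms
    show "global_align_score K g x y m n z \<le> ereal (best K g k (segment x 1 m) (segment y 1 n))"
      by (auto simp: global_align_score_def align_score_pair_score)
  qed
  have "aligned K g k (segment x 1 m) (segment y 1 n) (best K g k (segment x 1 m) (segment y 1 n))"
    using assms by (intro best_aligned) auto
  from alignment_of_aligned[OF this _ refl refl] assms obtain z where
    z: "z \<in> alignments" "length z = k" "hd z = (1, 1)" "fst (last z) \<le> m" "snd (last z) \<le> n"
    "best K g k (segment x 1 m) (segment y 1 n)
      = pair_score K g x y z - g (m - fst (last z)) - g (n - snd (last z))"
    by auto
  then have "z \<in> anchored_alignments k"
    by (cases z) (auto simp: anchored_alignments_def alignments_def)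
  then show "ereal (best K g k (segment x 1 m) (segment y 1 n))
     \<le> (SUP z\<in>anchored_alignments k. global_align_score K g x y m n z)"
    using z assms by (intro SUP_upper2) (auto simp: global_align_score_def align_score_pair_score)
qed

text \<open>The alignment may use any two segments, and its own end gaps inside these segments are charged. This
describes local alignments, for which end gaps are free: the optimal choice ends the segments at the
last aligned pair, and any other choice only loses score.\<close>

definition local_hit ::
  "('a \<Rightarrow> 'a \<Rightarrow> real) \<Rightarrow> (nat \<Rightarrow> real) \<Rightarrow> real \<Rightarrow> 'a list \<Rightarrow> 'a list \<Rightarrow> bool" where
  "local_hit K g c u v \<longleftrightarrow> (\<exists>k\<ge>1. \<exists>i l j l' s. i + l \<le> length u \<and> j + l' \<le> length v \<and>
     aligned K g k (take l (drop i u)) (take l' (drop j v)) s \<and> c \<le> s)"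

lemma finite_fitting_alignments:
  "finite {z \<in> alignments. fst (last z) \<le> m \<and> snd (last z) \<le> n}"
proof (rule finite_subset)
  show "finite {z. set z \<subseteq> {..m} \<times> {..n} \<and> distinct z}"
    by (rule finite_subset_distinct) simp
  show "{z \<in> alignments. fst (last z) \<le> m \<and> snd (last z) \<le> n}
     \<subseteq> {z. set z \<subseteq> {..m} \<times> {..n} \<and> distinct z}"
  proof
    fix z :: "(nat \<times> nat) list"
    assume "z \<in> {z \<in> alignments. fst (last z) \<le> m \<and> snd (last z) \<le> n}"
    then have z: "z \<in> alignments" "fst (last z) \<le> m" "snd (last z) \<le> n" by auto
    have "distinct z"
      using z(1)
    proof (induction z)
      case (Cons p z)
      then show ?case by (cases z) (auto simp: alignments_def)
    qed simp
    moreover have "set z \<subseteq> {..m} \<times> {..n}"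
    proof
      fix p assume "p \<in> set z"
      from alignment_le_last[OF z(1) this] z(2,3) show "p \<in> {..m} \<times> {..n}"
        by (auto simp: mem_Times_iff)
    qed
    ultimately show "z \<in> {z. set z \<subseteq> {..m} \<times> {..n} \<and> distinct z}" by simp
  qed
qed

text \<open>From left to right the supremum has to be attained: only finitely many alignments fit, and the
others have score \<open>- \<infinity>\<close>.\<close>

lemma local_score_ge_iff:
  assumes "g 0 = 0" "\<And>k. 0 \<le> g k"
  shows "ereal c \<le> local_score K g x y m n \<longleftrightarrow> local_hit K g c (segment x 1 m) (segment y 1 n)"
proof
  assume c: "ereal c \<le> local_score K g x y m n"
  let ?S = "align_score K g x y m n ` alignments"
  have "?S \<subseteq> insert (- \<infinity>) (align_score K g x y m n ` {z \<in> alignments. fst (last z) \<le> m \<and> snd (last z) \<le> n})"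
    by (auto simp: align_score_pair_score)
  then have fin: "finite ?S"
    by (rule finite_subset) (simp add: finite_fitting_alignments)
  have ne: "?S \<noteq> {}" using alignments_single[of "(1,1)"] by auto
  have "Sup ?S \<in> ?S" using Max_in[OF fin ne] by (simp add: Max_Sup[OF fin ne])
  then obtain z where z: "z \<in> alignments" "local_score K g x y m n = align_score K g x y m n z"
    by (auto simp: local_score_def)
  with c have fit: "fst (last z) \<le> m" "snd (last z) \<le> n" "c \<le> pair_score K g x y z"
    by (auto simp: align_score_pair_score split: if_splits)
  let ?i = "fst (hd z)" and ?j = "snd (hd z)" and ?m = "fst (last z)" and ?n = "snd (last z)"
  have z0: "z \<noteq> []" using z(1) by (simp add: alignments_def)
  have h: "1 \<le> ?i" "1 \<le> ?j" "?i \<le> ?m" "?j \<le> ?n"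
    using z(1) z0 alignment_hd_le[OF z(1), of "last z"] by (auto simp: alignments_def)
  have "aligned K g (length z) (segment x ?i ?m) (segment y ?j ?n) (pair_score K g x y z)"
    using aligned_of_alignment[OF z(1), of ?m ?n K g x y] assms by simp
  moreover have "segment x ?i ?m = take (Suc ?m - ?i) (drop (?i - 1) (segment x 1 m))"
    using h fit by (subst take_drop_segment) auto
  moreover have "segment y ?j ?n = take (Suc ?n - ?j) (drop (?j - 1) (segment y 1 n))"
    using h fit by (subst take_drop_segment) auto
  ultimately have "aligned K g (length z) (take (Suc ?m - ?i) (drop (?i - 1) (segment x 1 m)))
     (take (Suc ?n - ?j) (drop (?j - 1) (segment y 1 n))) (pair_score K g x y z)"
    by (simp only:)
  moreover have "?i - 1 + (Suc ?m - ?i) \<le> length (segment x 1 m)"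
    "?j - 1 + (Suc ?n - ?j) \<le> length (segment y 1 n)" "1 \<le> length z"
    using h fit z0 by (auto simp: Suc_le_eq)
  ultimately show "local_hit K g c (segment x 1 m) (segment y 1 n)"
    unfolding local_hit_def using fit(3) by blast
next
  assume "local_hit K g c (segment x 1 m) (segment y 1 n)"
  then obtain k i l j l' s where h: "k \<ge> 1" "i + l \<le> m" "j + l' \<le> n" "c \<le> s"
    "aligned K g k (take l (drop i (segment x 1 m))) (take l' (drop j (segment y 1 n))) s"
    unfolding local_hit_def by auto
  then have "aligned K g k (segment x (Suc i) (i + l)) (segment y (Suc j) (j + l')) s"
    by (simp only: take_drop_segment)
  from alignment_of_aligned[OF this h(1) refl refl] obtain z where z: "z \<in> alignments"
    "fst (last z) \<le> i + l" "snd (last z) \<le> j + l'"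
    "s = pair_score K g x y z - g (i + l - fst (last z)) - g (j + l' - snd (last z))"
    by auto
  have "c \<le> pair_score K g x y z"
    using h(4) z(4) assms(2)[of "i + l - fst (last z)"] assms(2)[of "j + l' - snd (last z)"] by linarith
  then have "ereal c \<le> align_score K g x y m n z"
    using z h by (auto simp: align_score_pair_score)
  then show "ereal c \<le> local_score K g x y m n"
    unfolding local_score_def using z(1) by (rule SUP_upper2[rotated])
qed

section \<open>The generating functions\<close>

locale scoring =
  fixes \<mu> :: "'a::finite pmf" and K :: "'a \<Rightarrow> 'a \<Rightarrow> real" and g :: "nat \<Rightarrow> real"
  assumes \<mu>_pos: "pmf \<mu> a > 0"
    and K_sym: "K a b = K b a"
    and K_positive: "\<exists>a b. K a b > 0"
    and admissible: "admissible_gap g"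
    and growth: "filterlim (\<lambda>k. g k / ln (real k)) at_top sequentially"
begin

lemma g_0: "g 0 = 0" and g_nonneg: "0 \<le> g k"
  using admissible by (auto simp: admissible_gap_def)

text \<open>The increments of \<open>g\<close> decrease, so the increments over a window behind \<open>a\<close> are at most those behind 0.\<close>

lemma g_subadd: "g (a + b) \<le> g a + g b"
proof -
  have step: "g (Suc k + 1) - g (Suc k) \<le> g (k + 1) - g k" for k
    using admissible unfolding admissible_gap_def by (metis Suc_eq_plus1 diff_Suc_1 le_add2)
  have incr: "g (a + b + 1) - g (a + b) \<le> g (b + 1) - g b" for a b
  proof (induction a)
    case (Suc a)
    then show ?case using step[of "a + b"] by simp
  qed simp
  show ?thesis
  proof (induction b)
    case (Suc b)
    then show ?case using incr[of a b] by simp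
  qed (simp add: g_0)
qed

definition Kmax :: real where
  "Kmax = Max (range (\<lambda>(a, b). K a b))"

lemma K_le_Kmax: "K a b \<le> Kmax"
  unfolding Kmax_def by (rule Max_ge) auto

lemma Kmax_attained: "\<exists>a b. K a b = Kmax"
  using Max_in[of "range (\<lambda>(a, b). K a b)"] unfolding Kmax_def by fastforce

lemma Kmax_pos: "Kmax > 0"
  using K_positive K_le_Kmax by (meson less_le_trans)

text \<open>By subadditivity all unaligned letters of a word cost at least as much as one gap of their total
length. There are \<open>length u - k\<close> of them in \<open>u\<close>.\<close>

lemma aligned_upper:
  "aligned K g k u v s \<Longrightarrow> s \<le> real k * Kmax - g (length u - k) - g (length v - k)"
proof (induction rule: aligned.induct)
  case (Cons k u v s a us b vs)
  have l: "k \<le> length u" "k \<le> length v" using aligned_length[OF Cons.hyps] by auto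
  have "length (a # us @ u) - Suc k = length us + (length u - k)"
    "length (b # vs @ v) - Suc k = length vs + (length v - k)"
    using l by auto
  then show ?case
    using Cons.IH g_subadd[of "length us" "length u - k"] g_subadd[of "length vs" "length v - k"]
      K_le_Kmax[of a b] by (simp add: algebra_simps)
qed (simp add: g_0)

abbreviation "opt \<equiv> best K g"

lemma opt_upper:
  assumes "k \<ge> 1" "k \<le> length u" "k \<le> length v"
  shows "opt k u v \<le> real k * Kmax - g (length u - k) - g (length v - k)"
  by (rule aligned_upper[OF best_aligned[OF assms]])

definition gap_sum :: "real \<Rightarrow> real" where
  "gap_sum \<theta> = (\<Sum>k. exp (- \<theta> * g k))"

text \<open>This is what the growth of the penalty is for: eventually \<open>\<theta> * g k\<close> exceeds \<open>2 * ln k\<close>.\<close>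

lemma summable_exp_gap:
  assumes "\<theta> > 0"
  shows "summable (\<lambda>k. exp (- \<theta> * g k))"
proof (rule summable_comparison_test_ev)
  have "eventually (\<lambda>k. g k / ln (real k) \<ge> 2 / \<theta>) sequentially"
    using growth by (simp add: filterlim_at_top)
  moreover have "eventually (\<lambda>k::nat. k \<ge> 2) sequentially" by (rule eventually_ge_at_top)
  ultimately show "eventually (\<lambda>k. norm (exp (- \<theta> * g k)) \<le> 1 / real k ^ 2) sequentially"
  proof eventually_elim
    case (elim k)
    then have "ln (real k) > 0" by simp
    with elim assms have "\<theta> * g k \<ge> 2 * ln (real k)" by (simp add: field_simps)
    then have "exp (- \<theta> * g k) \<le> exp (- (2 * ln (real k)))" by simp
    also have "\<dots> = 1 / real k ^ 2"
      using elim by (simp add: exp_minus exp_of_nat_mult[of 2, simplified] inverse_eq_divide)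
    finally show ?case by simp
  qed
  show "summable (\<lambda>k. 1 / real k ^ 2)"
    using inverse_power_summable[of 2, where 'a = real] by (simp add: inverse_eq_divide)
qed

lemma gap_sum_ge_1: "\<theta> > 0 \<Longrightarrow> 1 \<le> gap_sum \<theta>"
  using sum_le_suminf[OF summable_exp_gap, of \<theta> "{0}"] by (simp add: gap_sum_def g_0)

definition long_pairs :: "nat \<Rightarrow> ('a list \<times> 'a list) set" where
  "long_pairs k = {(u, v). k \<le> length u \<and> k \<le> length v}"

text \<open>All generating functions below are sums over pairs of words of arbitrary length. This is the common
way to bound them: the total over words of fixed lengths \<open>m\<close> and \<open>n\<close> decays like a product of
functions of the numbers of unaligned letters.\<close>

lemma long_pairs_sum_bound:
  fixes f :: "'a list \<times> 'a list \<Rightarrow> real" and \<phi> :: "nat \<Rightarrow> real"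
  assumes f: "\<And>p. p \<in> long_pairs k \<Longrightarrow> 0 \<le> f p"
    and \<phi>: "\<And>j. 0 \<le> \<phi> j" "summable \<phi>" and A: "0 \<le> A"
    and le: "\<And>m n. k \<le> m \<Longrightarrow> k \<le> n \<Longrightarrow>
      (\<Sum>u\<in>words m. \<Sum>v\<in>words n. f (u, v)) \<le> A * \<phi> (m - k) * \<phi> (n - k)"
  shows "f summable_on long_pairs k" "infsum f (long_pairs k) \<le> A * (suminf \<phi>)\<^sup>2"
proof -
  have bound: "sum f F \<le> A * (suminf \<phi>)\<^sup>2" if F: "finite F" "F \<subseteq> long_pairs k" for F
  proof -
    obtain N where N: "\<And>u v. (u, v) \<in> F \<Longrightarrow> length u \<le> N \<and> length v \<le> N"
    proof -
      let ?N = "Max ((\<lambda>(u, v). length u + length v) ` F)"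
      have "length u + length v \<le> ?N" if "(u, v) \<in> F" for u v
        using that F(1) by (intro Max_ge) force+
      then show thesis using that[of ?N] by (meson add_leD1 add_leD2)
    qed
    have "sum f F \<le> (\<Sum>(m, n)\<in>{k..N} \<times> {k..N}. \<Sum>p\<in>words m \<times> words n. f p)"
    proof -
      have "F \<subseteq> (\<Union>(m, n)\<in>{k..N} \<times> {k..N}. words m \<times> words n)"
        using F(2) N by (force simp: long_pairs_def words_def)
      then have "sum f F \<le> sum f (\<Union>(m, n)\<in>{k..N} \<times> {k..N}. words m \<times> words n)"
      proof (intro sum_mono2)
        show "finite (\<Union>(m, n)\<in>{k..N} \<times> {k..N}. words m \<times> words n :: ('a list \<times> 'a list) set)"
          by auto
      qed (auto intro!: f simp: long_pairs_def words_def)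
      also have "\<dots> = (\<Sum>q\<in>{k..N} \<times> {k..N}. sum f (case q of (m, n) \<Rightarrow> words m \<times> words n))"
        by (rule sum.UNION_disjoint) (auto dest: length_words)
      finally show ?thesis by (simp add: case_prod_unfold)
    qed
    also have "\<dots> = (\<Sum>m\<in>{k..N}. \<Sum>n\<in>{k..N}. \<Sum>u\<in>words m. \<Sum>v\<in>words n. f (u, v))"
      by (simp add: sum.cartesian_product case_prod_unfold)
    also have "\<dots> \<le> (\<Sum>m\<in>{k..N}. \<Sum>n\<in>{k..N}. A * \<phi> (m - k) * \<phi> (n - k))"
      by (intro sum_mono le) auto
    also have "\<dots> = A * ((\<Sum>m\<in>{k..N}. \<phi> (m - k)) * (\<Sum>n\<in>{k..N}. \<phi> (n - k)))"
      unfolding sum_product by (simp add: sum_distrib_left mult.assoc)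
    also have "(\<Sum>m\<in>{k..N}. \<phi> (m - k)) \<le> suminf \<phi>"
    proof -
      have "(\<Sum>m\<in>{k..N}. \<phi> (m - k)) = (\<Sum>j\<in>(\<lambda>m. m - k) ` {k..N}. \<phi> j)"
        by (subst sum.reindex) (auto simp: inj_on_def)
      also have "\<dots> \<le> suminf \<phi>" by (rule sum_le_suminf) (use \<phi> in auto)
      finally show ?thesis .
    qed
    then have "A * ((\<Sum>m\<in>{k..N}. \<phi> (m - k)) * (\<Sum>n\<in>{k..N}. \<phi> (n - k))) \<le> A * (suminf \<phi> * suminf \<phi>)"
      using A \<phi> by (intro mult_left_mono mult_mono suminf_nonneg sum_nonneg) auto
    finally show ?thesis by (simp add: power2_eq_square)
  qed
  show s: "f summable_on long_pairs k"
  proof (rule nonneg_bdd_above_summable_on[OF f])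
    show "bdd_above (sum f ` {F. F \<subseteq> long_pairs k \<and> finite F})"
      by (rule bdd_aboveI2[where M = "A * (suminf \<phi>)\<^sup>2"]) (use bound in auto)
  qed
  show "infsum f (long_pairs k) \<le> A * (suminf \<phi>)\<^sup>2"
    by (rule infsum_le_finite_sums[OF s]) (use bound in auto)
qed

definition pair_term :: "nat \<Rightarrow> real \<Rightarrow> 'a list \<times> 'a list \<Rightarrow> real" where
  "pair_term k \<theta> = (\<lambda>(u, v). weight \<mu> u * weight \<mu> v * exp (\<theta> * opt k u v))"

text \<open>Since the weights are probabilities, a sum over all words of length \<open>m\<close> is an expectation over
random words, so this is the generating function \<open>h_kappa\<close> written as one sum over pairs of words.\<close>

definition h :: "nat \<Rightarrow> real \<Rightarrow> real" where
  "h k \<theta> = infsum (pair_term k \<theta>) (long_pairs k)"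

lemma pair_term_nonneg [simp]: "0 \<le> pair_term k \<theta> p"
  by (cases p) (simp add: pair_term_def)

lemma weight_sum_const:
  "(\<Sum>u\<in>words m. \<Sum>v\<in>words n. weight \<mu> u * weight \<mu> v * c) = c"
  by (simp add: sum_distrib_left[symmetric] sum_distrib_right[symmetric] mult.assoc)

lemma h_bound:
  assumes "\<theta> > 0" "k \<ge> 1"
  shows "pair_term k \<theta> summable_on long_pairs k"
    and "h k \<theta> \<le> exp (\<theta> * (real k * Kmax)) * (gap_sum \<theta>)\<^sup>2"
proof -
  have le: "(\<Sum>u\<in>words m. \<Sum>v\<in>words n. pair_term k \<theta> (u, v))
     \<le> exp (\<theta> * (real k * Kmax)) * exp (- \<theta> * g (m - k)) * exp (- \<theta> * g (n - k))"
    if "k \<le> m" "k \<le> n" for m n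
  proof -
    have "(\<Sum>u\<in>words m. \<Sum>v\<in>words n. pair_term k \<theta> (u, v))
      \<le> (\<Sum>u\<in>words m. \<Sum>v\<in>words n. weight \<mu> u * weight \<mu> v *
           exp (\<theta> * (real k * Kmax - g (m - k) - g (n - k))))"
      unfolding pair_term_def using that assms opt_upper[of k]
      by (intro sum_mono) (auto simp: words_def intro!: mult_left_mono)
    also have "\<dots> = exp (\<theta> * (real k * Kmax - g (m - k) - g (n - k)))"
      by (rule weight_sum_const)
    also have "\<dots> = exp (\<theta> * (real k * Kmax)) * exp (- \<theta> * g (m - k)) * exp (- \<theta> * g (n - k))"
      by (simp add: exp_add[symmetric] algebra_simps)
    finally show ?thesis .
  qed
  show "pair_term k \<theta> summable_on long_pairs k"
    by (rule long_pairs_sum_bound(1)[OF _ _ summable_exp_gap[OF assms(1)] _ le]) auto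
  show "h k \<theta> \<le> exp (\<theta> * (real k * Kmax)) * (gap_sum \<theta>)\<^sup>2"
    unfolding h_def gap_sum_def
    by (rule long_pairs_sum_bound(2)[OF _ _ summable_exp_gap[OF assms(1)] _ le]) auto
qed

text \<open>One pair of words is enough: a constant word of one optimal letter against a constant word of its
partner.\<close>

lemma h_lower:
  assumes "\<theta> > 0" "k \<ge> 1" "K a b = Kmax"
  shows "(pmf \<mu> a * pmf \<mu> b * exp (\<theta> * Kmax)) ^ k \<le> h k \<theta>"
proof -
  have "aligned K g k (replicate k a) (replicate k b) (real k * Kmax)"
  proof (induction k)
    case (Suc k)
    from aligned.Cons[OF this, of a "[]" b "[]"] show ?case
      by (simp add: assms(3) g_0 algebra_simps)
  qed simp
  then have opt: "real k * Kmax \<le> opt k (replicate k a) (replicate k b)" by (rule best_ge)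
  have w: "weight \<mu> (replicate k c) = pmf \<mu> c ^ k" for c
    by (induction k) (auto simp: weight_def)
  have "(pmf \<mu> a * pmf \<mu> b * exp (\<theta> * Kmax)) ^ k
     = weight \<mu> (replicate k a) * weight \<mu> (replicate k b) * exp (\<theta> * (real k * Kmax))"
    by (simp add: w power_mult_distrib exp_of_nat_mult[symmetric] mult_ac)
  also have "\<dots> \<le> pair_term k \<theta> (replicate k a, replicate k b)"
    unfolding pair_term_def using opt assms(1) by (auto intro!: mult_left_mono)
  also have "\<dots> = sum (pair_term k \<theta>) {(replicate k a, replicate k b)}" by simp
  also have "\<dots> \<le> h k \<theta>"
    unfolding h_def by (rule finite_sum_le_infsum[OF h_bound(1)[OF assms(1,2)]])
      (auto simp: long_pairs_def)
  finally show ?thesis .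
qed

lemma h_pos: "\<theta> > 0 \<Longrightarrow> k \<ge> 1 \<Longrightarrow> h k \<theta> > 0"
  using h_lower Kmax_attained \<mu>_pos
  by (metis exp_gt_zero less_le_trans mult_pos_pos zero_less_power)

text \<open>Choosing for each pair of words one optimal cut of an optimal alignment defines an injection into
pairs of pairs of words, because concatenation recovers the words. Weights multiply and scores add
along it.\<close>

lemma h_submult:
  assumes "\<theta> > 0" "k \<ge> 1" "l \<ge> 1"
  shows "h (k + l) \<theta> \<le> h k \<theta> * h l \<theta>"
proof -
  define ok where "ok p q \<longleftrightarrow> (case p of (u, v) \<Rightarrow> case q of ((u1, v1), (u2, v2)) \<Rightarrow>
     u = u1 @ u2 \<and> v = v1 @ v2 \<and> (u1, v1) \<in> long_pairs k \<and> (u2, v2) \<in> long_pairs l \<and>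
     opt (k + l) u v \<le> opt k u1 v1 + opt l u2 v2)" for p q
  have "\<exists>q. ok p q" if "p \<in> long_pairs (k + l)" for p
  proof -
    obtain u v where p: "p = (u, v)" by (cases p)
    have "aligned K g (k + l) u v (opt (k + l) u v)"
      using that assms by (intro best_aligned) (auto simp: p long_pairs_def)
    from aligned_split[OF this] obtain u1 u2 v1 v2 s1 s2 where *:
      "u = u1 @ u2" "v = v1 @ v2" "opt (k + l) u v = s1 + s2" "aligned K g k u1 v1 s1"
      "aligned K g l u2 v2 s2" by blast
    then have "ok p ((u1, v1), (u2, v2))"
      using best_ge[OF *(4)] best_ge[OF *(5)] aligned_length[OF *(4)] aligned_length[OF *(5)]
      by (auto simp: ok_def p long_pairs_def)
    then show ?thesis by blast
  qed
  then obtain split where split: "\<And>p. p \<in> long_pairs (k + l) \<Longrightarrow> ok p (split p)" by metis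
  let ?P = "\<lambda>(p, q). pair_term k \<theta> p * pair_term l \<theta> q"
  have P: "?P summable_on long_pairs k \<times> long_pairs l"
    by (rule summable_on_SigmaI[where g = "\<lambda>p. pair_term k \<theta> p * h l \<theta>"])
      (use h_bound(1)[OF assms(1)] assms in \<open>auto simp: h_def
        intro!: has_sum_cmult_right has_sum_infsum summable_on_cmult_left\<close>)
  have inj: "inj_on split (long_pairs (k + l))"
  proof (rule inj_onI)
    fix p q assume "p \<in> long_pairs (k + l)" "q \<in> long_pairs (k + l)" "split p = split q"
    with split[of p] split[of q] show "p = q" by (auto simp: ok_def split: prod.splits)
  qed
  have sub: "split ` long_pairs (k + l) \<subseteq> long_pairs k \<times> long_pairs l"
    using split by (fastforce simp: ok_def split: prod.splits)
  have le: "pair_term (k + l) \<theta> p \<le> ?P (split p)" if "p \<in> long_pairs (k + l)" for p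
  proof -
    obtain u v u1 v1 u2 v2 where e: "p = (u, v)" "split p = ((u1, v1), (u2, v2))"
      by (metis surj_pair)
    with split[OF that] have *: "u = u1 @ u2" "v = v1 @ v2" "opt (k + l) u v \<le> opt k u1 v1 + opt l u2 v2"
      by (auto simp: ok_def)
    have "exp (\<theta> * opt (k + l) u v) \<le> exp (\<theta> * opt k u1 v1) * exp (\<theta> * opt l u2 v2)"
      using *(3) assms(1) by (simp add: exp_add[symmetric] distrib_left[symmetric])
    then have "(weight \<mu> u1 * weight \<mu> u2 * (weight \<mu> v1 * weight \<mu> v2)) * exp (\<theta> * opt (k + l) u v)
       \<le> (weight \<mu> u1 * weight \<mu> u2 * (weight \<mu> v1 * weight \<mu> v2)) * (exp (\<theta> * opt k u1 v1) * exp (\<theta> * opt l u2 v2))"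
      by (intro mult_left_mono) auto
    then have "pair_term (k + l) \<theta> (u, v) \<le> pair_term k \<theta> (u1, v1) * pair_term l \<theta> (u2, v2)"
      by (simp add: pair_term_def *(1,2) weight_append mult_ac)
    then show ?thesis by (simp add: e(2)) (simp add: e(1))
  qed
  have S: "?P summable_on split ` long_pairs (k + l)"
    by (rule summable_on_subset_banach[OF P sub])
  have "h (k + l) \<theta> \<le> infsum (\<lambda>p. ?P (split p)) (long_pairs (k + l))"
    unfolding h_def using h_bound(1)[OF assms(1), of "k + l"] S assms le
    by (intro infsum_mono) (auto simp: summable_on_reindex[OF inj] o_def)
  also have "\<dots> = infsum ?P (split ` long_pairs (k + l))"
    by (simp add: infsum_reindex[OF inj] o_def)
  also have "\<dots> \<le> infsum ?P (long_pairs k \<times> long_pairs l)"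
    by (rule infsum_mono2[OF S P sub]) auto
  also have "\<dots> = h k \<theta> * h l \<theta>"
    unfolding infsum_Sigma_banach[OF P, symmetric] h_def
    by (simp add: infsum_cmult_right' infsum_cmult_left')
  finally show ?thesis .
qed

text \<open>Hoelder's inequality in the normalised form: after division by the two generating functions, it is
convexity of the exponential function in every summand.\<close>

lemma h_log_convex:
  assumes "\<theta>1 > 0" "\<theta>2 > 0" "0 \<le> t" "t \<le> 1" "k \<ge> 1"
  shows "ln (h k ((1 - t) * \<theta>1 + t * \<theta>2)) \<le> (1 - t) * ln (h k \<theta>1) + t * ln (h k \<theta>2)"
proof -
  let ?\<theta> = "(1 - t) * \<theta>1 + t * \<theta>2"
  define a b where "a = ln (h k \<theta>1)" and "b = ln (h k \<theta>2)"
  define D where "D = (1 - t) * a + t * b"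
  have \<theta>: "?\<theta> > 0" using assms by (cases "t = 1") (auto intro: add_pos_nonneg)
  have h1: "h k \<theta>1 = exp a" "h k \<theta>2 = exp b" using h_pos assms by (auto simp: a_def b_def)
  note sm = h_bound(1)[OF assms(1,5)] h_bound(1)[OF assms(2,5)] h_bound(1)[OF \<theta> assms(5)]
  have "h k ?\<theta> \<le> infsum (\<lambda>p. exp D * ((1 - t) * exp (- a) * pair_term k \<theta>1 p + t * exp (- b) * pair_term k \<theta>2 p))
      (long_pairs k)"
    unfolding h_def
  proof (intro infsum_mono sm summable_on_cmult_right summable_on_add)
    fix p assume "p \<in> long_pairs k"
    obtain u v where p: "p = (u, v)" by (cases p)
    let ?G = "opt k u v"
    have "convex_on UNIV (exp :: real \<Rightarrow> real)"
      by (rule exp_convex)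
    from convex_onD[OF this assms(3,4), of "\<theta>1 * ?G - a" "\<theta>2 * ?G - b"]
    have "exp (?\<theta> * ?G - D) \<le> (1 - t) * exp (\<theta>1 * ?G - a) + t * exp (\<theta>2 * ?G - b)"
      by (simp add: D_def algebra_simps)
    then have "exp D * exp (?\<theta> * ?G - D) \<le> exp D * ((1 - t) * exp (\<theta>1 * ?G - a) + t * exp (\<theta>2 * ?G - b))"
      by (intro mult_left_mono) auto
    then have "exp (?\<theta> * ?G) \<le> exp D * ((1 - t) * (exp (- a) * exp (\<theta>1 * ?G)) + t * (exp (- b) * exp (\<theta>2 * ?G)))"
      by (simp add: exp_add[symmetric])
    then have "weight \<mu> u * weight \<mu> v * exp (?\<theta> * ?G) \<le> weight \<mu> u * weight \<mu> v *
       (exp D * ((1 - t) * (exp (- a) * exp (\<theta>1 * ?G)) + t * (exp (- b) * exp (\<theta>2 * ?G))))"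
      by (intro mult_left_mono) auto
    then show "pair_term k ?\<theta> p \<le> exp D * ((1 - t) * exp (- a) * pair_term k \<theta>1 p + t * exp (- b) * pair_term k \<theta>2 p)"
      unfolding p pair_term_def by (simp add: algebra_simps)
  qed
  also have "\<dots> = exp D * ((1 - t) * exp (- a) * h k \<theta>1 + t * exp (- b) * h k \<theta>2)"
    unfolding h_def using sm
    by (simp add: infsum_cmult_right infsum_add summable_on_cmult_right summable_on_add)
  also have "\<dots> = exp D" unfolding h1 by (simp add: mult.assoc exp_add[symmetric])
  finally have "ln (h k ?\<theta>) \<le> ln (exp D)"
    using h_pos[OF \<theta> assms(5)] by (subst ln_le_cancel_iff) auto
  then show ?thesis by (simp add: D_def a_def b_def)
qed

end

section \<open>The limiting exponent\<close>

text \<open>Fekete's lemma. Writing \<open>n = q * N + r\<close> with \<open>1 \<le> r \<le> N\<close> avoids the value of the sequence at 0, about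
which nothing is known.\<close>

lemma subadditive_limit:
  fixes a :: "nat \<Rightarrow> real"
  assumes sub: "\<And>m n. m \<ge> 1 \<Longrightarrow> n \<ge> 1 \<Longrightarrow> a (m + n) \<le> a m + a n"
    and low: "\<And>n. n \<ge> 1 \<Longrightarrow> c * real n \<le> a n"
  shows "\<exists>L. (\<lambda>n. a n / real n) \<longlonglongrightarrow> L \<and> (\<forall>n\<ge>1. L \<le> a n / real n)"
proof -
  define S where "S = (\<lambda>n. a n / real n) ` {1..}"
  define L where "L = Inf S"
  have bdd: "bdd_below S" unfolding S_def
    by (rule bdd_belowI2[where m = c]) (use low in \<open>auto simp: field_simps\<close>)
  have L_le: "L \<le> a n / real n" if "n \<ge> 1" for n
    unfolding L_def by (rule cInf_lower[OF _ bdd]) (use that in \<open>auto simp: S_def\<close>)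
  have iter: "a (q * N + r) \<le> real q * a N + a r" if "N \<ge> 1" "r \<ge> 1" for q N r
  proof (induction q)
    case (Suc q)
    have "a (N + (q * N + r)) \<le> a N + a (q * N + r)" using that by (intro sub) auto
    with Suc show ?case by (simp add: algebra_simps)
  qed simp
  have "(\<lambda>n. a n / real n) \<longlonglongrightarrow> L"
  proof (rule order_tendstoI)
    fix y assume "y < L"
    show "eventually (\<lambda>n. y < a n / real n) sequentially"
      using eventually_ge_at_top[of 1]
    proof eventually_elim
      case (elim n)
      with L_le[of n] \<open>y < L\<close> show ?case by linarith
    qed
  next
    fix y assume y: "L < y"
    obtain N where N: "N \<ge> 1" "a N / real N < y"
      using cInf_lessD[of S y] y by (auto simp: S_def L_def)
    define A where "A = a N / real N"
    define B where "B = real N * \<bar>A\<bar> + (\<Sum>r\<in>{1..N}. \<bar>a r\<bar>)"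
    have bound: "a n / real n \<le> A + B / real n" if n: "n \<ge> 1" for n
    proof -
      define q r where "q = (n - 1) div N" and "r = Suc ((n - 1) mod N)"
      have nqr: "n = q * N + r" using n div_mult_mod_eq[of "n - 1" N] by (simp add: q_def r_def)
      have r: "1 \<le> r" "r \<le> N" using N(1) by (auto simp: r_def Suc_le_eq)
      have "a n \<le> real q * a N + a r" unfolding nqr by (rule iter[OF N(1) r(1)])
      also have "real q * a N = real n * A - real r * A"
        using N(1) by (simp add: A_def nqr field_simps)
      also have "a r \<le> (\<Sum>r\<in>{1..N}. \<bar>a r\<bar>)"
        using member_le_sum[of r "{1..N}" "\<lambda>r. \<bar>a r\<bar>"] r by auto
      also have "- (real r * A) \<le> real r * \<bar>A\<bar>" by (metis abs_ge_minus_self abs_mult abs_of_nat)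
      then have "real n * A - real r * A + (\<Sum>r\<in>{1..N}. \<bar>a r\<bar>) \<le> real n * A + B"
        using r mult_right_mono[of "real r" "real N" "\<bar>A\<bar>"] by (simp add: B_def)
      finally have "a n \<le> real n * A + B" by simp
      with n show ?thesis by (simp add: field_simps)
    qed
    have "(\<lambda>n. A + B / real n) \<longlonglongrightarrow> A + 0"
      by (intro tendsto_intros lim_const_over_n)
    then have "eventually (\<lambda>n. A + B / real n < y) sequentially"
      using N(2) by (intro order_tendstoD(2)[where y = "A + 0"]) (auto simp: A_def)
    then show "eventually (\<lambda>n. a n / real n < y) sequentially"
      using eventually_ge_at_top[of 1]
    proof eventually_elim
      case (elim n)
      with bound[of n] show ?case by linarith
    qed
  qed
  with L_le show ?thesis by blast
qed

lemma linear_less_exp_eventually: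
  fixes C D e :: real
  assumes "C > 0" "D > 0" "e > 0"
  shows "eventually (\<lambda>k::nat. C * (1 + real k * D) < exp (real k * (e / 2))) sequentially"
  using assms by real_asymp

context scoring
begin

definition Psi :: "real \<Rightarrow> real" where
  "Psi \<theta> = lim (\<lambda>k. ln (h k \<theta>) / real k)"

lemma ln_h_lower:
  assumes "\<theta> > 0" "k \<ge> 1" "K a b = Kmax"
  shows "(ln (pmf \<mu> a * pmf \<mu> b) + \<theta> * Kmax) * real k \<le> ln (h k \<theta>)"
proof -
  have p: "pmf \<mu> a * pmf \<mu> b > 0" by (simp add: \<mu>_pos)
  have "ln ((pmf \<mu> a * pmf \<mu> b * exp (\<theta> * Kmax)) ^ k) \<le> ln (h k \<theta>)"
    using h_lower[OF assms] h_pos[OF assms(1,2)] p by (subst ln_le_cancel_iff) auto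
  moreover have "ln ((p * exp (\<theta> * Kmax)) ^ k) = (ln p + \<theta> * Kmax) * real k" if "p > 0" for p
    using that by (simp add: ln_realpow ln_mult mult.commute)
  ultimately show ?thesis using p by metis
qed

lemma Psi_LIMSEQ_and_le:
  assumes "\<theta> > 0"
  shows "(\<lambda>k. ln (h k \<theta>) / real k) \<longlonglongrightarrow> Psi \<theta>"
    and "k \<ge> 1 \<Longrightarrow> Psi \<theta> \<le> ln (h k \<theta>) / real k"
proof -
  obtain a b where ab: "K a b = Kmax" using Kmax_attained by blast
  have "ln (h (m + n) \<theta>) \<le> ln (h m \<theta>) + ln (h n \<theta>)" if "m \<ge> 1" "n \<ge> 1" for m n
  proof -
    have "ln (h (m + n) \<theta>) \<le> ln (h m \<theta> * h n \<theta>)"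
      using h_submult[OF assms that] h_pos[OF assms] that by (subst ln_le_cancel_iff) auto
    then show ?thesis using h_pos[OF assms that(1)] h_pos[OF assms that(2)] by (simp add: ln_mult)
  qed
  from subadditive_limit[of "\<lambda>k. ln (h k \<theta>)", OF this ln_h_lower[OF assms _ ab]]
  obtain L where L: "(\<lambda>k. ln (h k \<theta>) / real k) \<longlonglongrightarrow> L" "\<forall>k\<ge>1. L \<le> ln (h k \<theta>) / real k"
    by blast
  moreover have "Psi \<theta> = L" unfolding Psi_def using L(1) by (rule limI)
  ultimately show "(\<lambda>k. ln (h k \<theta>) / real k) \<longlonglongrightarrow> Psi \<theta>"
    "k \<ge> 1 \<Longrightarrow> Psi \<theta> \<le> ln (h k \<theta>) / real k" by auto
qed

lemma Psi_lower:
  assumes "\<theta> > 0" "K a b = Kmax"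
  shows "ln (pmf \<mu> a * pmf \<mu> b) + \<theta> * Kmax \<le> Psi \<theta>"
proof (rule tendsto_lowerbound[OF Psi_LIMSEQ_and_le(1)[OF assms(1)]])
  show "eventually (\<lambda>k. ln (pmf \<mu> a * pmf \<mu> b) + \<theta> * Kmax \<le> ln (h k \<theta>) / real k) sequentially"
    using eventually_ge_at_top[of 1]
    by eventually_elim (use ln_h_lower[OF assms(1) _ assms(2)] in \<open>auto simp: field_simps\<close>)
qed simp

text \<open>The factor \<open>(gap_sum \<theta>)\<^sup>2\<close> in the bound for the generating functions does not depend on \<open>k\<close> and
disappears in the limit, although it blows up as \<open>\<theta>\<close> tends to 0.\<close>

lemma Psi_upper:
  assumes "\<theta> > 0"
  shows "Psi \<theta> \<le> \<theta> * Kmax"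
proof (rule LIMSEQ_le[OF Psi_LIMSEQ_and_le(1)[OF assms]])
  show "(\<lambda>k. \<theta> * Kmax + ln ((gap_sum \<theta>)\<^sup>2) / real k) \<longlonglongrightarrow> \<theta> * Kmax"
    by (rule tendsto_eq_intros lim_const_over_n | simp)+
  have "ln (h k \<theta>) / real k \<le> \<theta> * Kmax + ln ((gap_sum \<theta>)\<^sup>2) / real k" if k: "k \<ge> 1" for k
  proof -
    have g: "gap_sum \<theta> > 0" using gap_sum_ge_1[OF assms] by simp
    have "ln (h k \<theta>) \<le> ln (exp (\<theta> * (real k * Kmax)) * (gap_sum \<theta>)\<^sup>2)"
      using h_bound(2)[OF assms k] h_pos[OF assms k] g by (subst ln_le_cancel_iff) auto
    also have "\<dots> = \<theta> * (real k * Kmax) + ln ((gap_sum \<theta>)\<^sup>2)"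
      using g by (subst ln_mult) auto
    finally show ?thesis using k by (simp add: field_simps)
  qed
  then show "\<exists>N. \<forall>k\<ge>N. ln (h k \<theta>) / real k \<le> \<theta> * Kmax + ln ((gap_sum \<theta>)\<^sup>2) / real k"
    by blast
qed

lemma Psi_convex: "convex_on {0<..} Psi"
proof (rule convex_onI)
  fix t x y :: real assume t: "0 < t" "t < 1" and xy: "x \<in> {0<..}" "y \<in> {0<..}"
  have z: "(1 - t) * x + t * y > 0" using t xy by (auto intro: add_pos_pos)
  have "Psi ((1 - t) * x + t * y) \<le> (1 - t) * Psi x + t * Psi y"
  proof (rule LIMSEQ_le[OF Psi_LIMSEQ_and_le(1)[OF z]])
    show "(\<lambda>k. (1 - t) * (ln (h k x) / real k) + t * (ln (h k y) / real k))
        \<longlonglongrightarrow> (1 - t) * Psi x + t * Psi y"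
      using xy by (intro tendsto_intros Psi_LIMSEQ_and_le(1)) auto
    have "ln (h k ((1 - t) * x + t * y)) / real k
       \<le> (1 - t) * (ln (h k x) / real k) + t * (ln (h k y) / real k)" if "k \<ge> 1" for k
      using h_log_convex[of x y t k] t xy that
      by (simp add: add_divide_distrib[symmetric] divide_right_mono)
    then show "\<exists>N. \<forall>k\<ge>N. ln (h k ((1 - t) * x + t * y)) / real k
       \<le> (1 - t) * (ln (h k x) / real k) + t * (ln (h k y) / real k)" by blast
  qed
  then show "Psi ((1 - t) *\<^sub>R x + t *\<^sub>R y) \<le> (1 - t) * Psi x + t * Psi y" by simp
qed simp

lemma convex_combination_shift: "(1 - T) * e + T * x = e + T * (x - e)" for T e x :: real
  by (simp add: algebra_simps)

text \<open>A convex function that is at most 0 in the limit at 0 lies below its chords from the origin. This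
is applied to propagate the sign of \<open>Psi\<close> to the left.\<close>

lemma Psi_scale:
  assumes "0 < y" "y \<le> x"
  shows "Psi y \<le> (y / x) * Psi x"
proof (cases "y = x")
  case False
  then have yx: "0 < y" "y < x" using assms by auto
  \<comment> \<open>\<open>y\<close> is a convex combination of \<open>e\<close> and \<open>x\<close>; then \<open>e\<close> tends to 0\<close>
  let ?t = "\<lambda>e. (y - e) / (x - e)"
  show ?thesis
  proof (rule tendsto_lowerbound)
    show "((\<lambda>e. (1 - ?t e) * (e * Kmax) + ?t e * Psi x) \<longlongrightarrow> (y / x) * Psi x) (at_right 0)"
      using yx by (auto intro!: tendsto_eq_intros)
    show "eventually (\<lambda>e. Psi y \<le> (1 - ?t e) * (e * Kmax) + ?t e * Psi x) (at_right 0)"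
      using eventually_at_right_less[of 0] eventually_at_right_real[OF yx(1)]
    proof eventually_elim
      case (elim e)
      then have e: "0 < e" "e < y" by auto
      then have t: "0 \<le> ?t e" "?t e \<le> 1" using yx by (auto simp: field_simps)
      have "(1 - ?t e) * e + ?t e * x = e + ?t e * (x - e)" by (rule convex_combination_shift)
      also have "\<dots> = y" using e yx by simp
      finally have y: "(1 - ?t e) * e + ?t e * x = y" .
      have "Psi y \<le> (1 - ?t e) * Psi e + ?t e * Psi x"
        using convex_onD[OF Psi_convex t, of e x] y e yx by simp
      also have "\<dots> \<le> (1 - ?t e) * (e * Kmax) + ?t e * Psi x"
        using Psi_upper[OF e(1)] t by (intro add_right_mono mult_left_mono) auto
      finally show ?case .
    qed
  qed simp
qed (use assms in simp)

text \<open>To the left of \<open>\<theta>0\<close> the function stays negative by \<open>Psi_scale\<close>; to the right of it, a convex function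
that starts negative is positive behind its first zero.\<close>

lemma Psi_unique_root:
  assumes "\<theta>0 > 0" "Psi \<theta>0 < 0"
  shows "\<exists>!\<theta>. \<theta> > 0 \<and> Psi \<theta> = 0"
proof -
  obtain a b where ab: "K a b = Kmax" using Kmax_attained by blast
  \<comment> \<open>beyond this point \<open>Psi_lower\<close> forces a value of at least 1\<close>
  define X where "X = max \<theta>0 ((1 - ln (pmf \<mu> a * pmf \<mu> b)) / Kmax)"
  have X: "\<theta>0 \<le> X" "X > 0" using assms by (auto simp: X_def)
  have "(1 - ln (pmf \<mu> a * pmf \<mu> b)) / Kmax \<le> X" by (simp add: X_def)
  then have "1 \<le> ln (pmf \<mu> a * pmf \<mu> b) + X * Kmax"
    using Kmax_pos by (simp add: field_simps)
  with Psi_lower[OF X(2) ab] have PX: "Psi X > 0" by linarith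
  have "continuous_on {0<..} Psi"
    by (rule convex_on_continuous[OF _ Psi_convex]) simp
  then have "continuous_on {\<theta>0..X} Psi"
    by (rule continuous_on_subset) (use assms in auto)
  from IVT'[of Psi \<theta>0 0 X, OF _ _ X(1) this] PX assms(2)
  obtain r where r: "\<theta>0 \<le> r" "r \<le> X" "Psi r = 0" by auto
  have root: "\<theta>0 < x" if "x > 0" "Psi x = 0" for x
  proof (rule ccontr)
    assume "\<not> \<theta>0 < x"
    with Psi_scale[of x \<theta>0] that have "0 \<le> (x / \<theta>0) * Psi \<theta>0" by simp
    moreover have "(x / \<theta>0) * Psi \<theta>0 < 0" using that assms by (intro mult_pos_neg) auto
    ultimately show False by linarith
  qed
  have no: False if xy: "x > 0" "Psi x = 0" "x < y" "Psi y = 0" for x y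
  proof -
    let ?t = "(x - \<theta>0) / (y - \<theta>0)"
    have x0: "\<theta>0 < x" using root xy by blast
    then have t: "0 \<le> ?t" "?t < 1" using xy by (auto simp: field_simps)
    have "(1 - ?t) * \<theta>0 + ?t * y = \<theta>0 + ?t * (y - \<theta>0)" by (rule convex_combination_shift)
    also have "\<dots> = x" using x0 xy by simp
    finally have x: "(1 - ?t) * \<theta>0 + ?t * y = x" .
    have "Psi x \<le> (1 - ?t) * Psi \<theta>0 + ?t * Psi y"
      using convex_onD[OF Psi_convex, of ?t \<theta>0 y] t x xy assms by simp
    moreover have "(1 - ?t) * Psi \<theta>0 < 0" using t assms by (intro mult_pos_neg) auto
    ultimately show False using xy by simp
  qed
  show ?thesis
  proof (rule ex1I[of _ r])
    show "r > 0 \<and> Psi r = 0" using r assms by auto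
    fix x assume "x > 0 \<and> Psi x = 0"
    with no[of x r] no[of r x] r assms show "x = r" by (metis linorder_neqE_linordered_idom less_le_trans)
  qed
qed

lemma Psi_sign:
  assumes "\<exists>!\<theta>. \<theta> > 0 \<and> Psi \<theta> = 0" "r > 0" "Psi r = 0"
  shows "0 < \<theta> \<Longrightarrow> \<theta> < r \<Longrightarrow> Psi \<theta> < 0" and "r < \<theta> \<Longrightarrow> Psi \<theta> > 0"
proof -
  have uniq: "x = r" if "x > 0" "Psi x = 0" for x
    using assms that by blast
  {
  assume t: "0 < \<theta>" "\<theta> < r"
  then have "Psi \<theta> \<le> 0" using Psi_scale[of \<theta> r] assms(3) by simp
  moreover have "Psi \<theta> \<noteq> 0" using t uniq[of \<theta>] by auto
  ultimately show "Psi \<theta> < 0" by simp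
  }
  assume t: "r < \<theta>"
  then have "0 \<le> r / \<theta> * Psi \<theta>" using Psi_scale[of r \<theta>] assms by simp
  then have "0 \<le> Psi \<theta>" using t assms by (simp add: zero_le_mult_iff zero_le_divide_iff)
  moreover have "Psi \<theta> \<noteq> 0" using t assms(2) uniq[of \<theta>] by auto
  ultimately show "Psi \<theta> > 0" by simp
qed

definition pair_prob :: "nat \<Rightarrow> nat \<Rightarrow> ('a list \<Rightarrow> 'a list \<Rightarrow> bool) \<Rightarrow> real" where
  "pair_prob m n Q = (\<Sum>u\<in>words m. \<Sum>v\<in>words n. weight \<mu> u * weight \<mu> v * of_bool (Q u v))"

lemma pair_prob_nonneg [simp]: "0 \<le> pair_prob m n Q"
  unfolding pair_prob_def by (intro sum_nonneg) auto

text \<open>Suppose that all levels are reached with smaller probability. Then for each \<open>m\<close> and \<open>n\<close> the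
expectation of \<open>exp (\<theta> * G)\<close> is at most linear in \<open>k\<close>, which is not yet summable over \<open>m\<close> and \<open>n\<close>. Giving away
a small power \<open>t\<close> of the exponential to the deterministic bound \<open>opt_upper\<close> makes the sum converge and
costs only a factor \<open>exp (t * \<theta> * Kmax * k)\<close>. For small \<open>t\<close> this contradicts the growth of \<open>h k \<theta>\<close>, which
is at least \<open>exp (k * Psi \<theta>)\<close>.\<close>

lemma exists_good_block_size:
  assumes \<theta>: "\<theta> > 0" and pos: "Psi \<theta> > 0"
  shows "\<exists>k\<ge>1. \<exists>m\<ge>k. \<exists>n\<ge>k. \<exists>l\<ge>1. exp (- \<theta> * real l) \<le> pair_prob m n (\<lambda>u v. real l \<le> opt k u v)"
proof (rule ccontr)
  assume contr: "\<not> ?thesis"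
  have small: "pair_prob m n (\<lambda>u v. real l \<le> opt k u v) \<le> exp (- \<theta> * real l)"
    if "k \<ge> 1" "m \<ge> k" "n \<ge> k" "l \<ge> 1" for k m n l
    using contr that by (meson linear)
  define \<eta> where "\<eta> = Psi \<theta>"
  \<comment> \<open>small enough for the factor \<open>exp (t * \<theta> * Kmax * k)\<close> to cost at most half of the growth rate\<close>
  define t where "t = min (1/2) (\<eta> / (2 * \<theta> * Kmax))"
  have t: "0 < t" "t < 1" "t * \<theta> * Kmax \<le> \<eta> / 2"
  proof -
    show "0 < t" using pos \<theta> Kmax_pos by (simp add: t_def \<eta>_def)
    show "t < 1" by (simp add: t_def)
    have "t \<le> \<eta> / (2 * \<theta> * Kmax)" by (simp add: t_def)
    then show "t * \<theta> * Kmax \<le> \<eta> / 2" using \<theta> Kmax_pos by (simp add: field_simps)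
  qed
  have t\<theta>: "t * \<theta> > 0" using t \<theta> by simp
  have hk: "h k \<theta> \<le> exp \<theta> * (1 + real k * Kmax) * exp (real k * (\<eta> / 2)) * (gap_sum (t * \<theta>))\<^sup>2"
    if k: "k \<ge> 1" for k
    unfolding h_def gap_sum_def
  proof (rule long_pairs_sum_bound(2)[OF _ _ summable_exp_gap[OF t\<theta>]])
    fix m n assume mn: "k \<le> m" "k \<le> n"
    define N where "N = nat \<lfloor>real k * Kmax\<rfloor>"
    define e where "e = exp (t * \<theta> * (real k * Kmax - g (m - k) - g (n - k)))"
    have pt: "exp (\<theta> * opt k u v) \<le> e * (exp \<theta> + (\<Sum>l\<in>{1..N}. exp (\<theta> * (real l + 1)) * of_bool (real l \<le> opt k u v)))"
      if uv: "u \<in> words m" "v \<in> words n" for u v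
    proof -
      let ?G = "opt k u v"
      have up: "?G \<le> real k * Kmax - g (m - k) - g (n - k)"
        using opt_upper[OF k, of u v] mn uv by (simp add: words_def)
      have "exp (\<theta> * ?G) = exp (t * \<theta> * ?G) * exp ((1 - t) * \<theta> * ?G)"
        by (simp add: exp_add[symmetric] algebra_simps)
      also have "exp (t * \<theta> * ?G) \<le> e" unfolding e_def using mult_left_mono[OF up, of "t * \<theta>"] t\<theta> by simp
      also have "exp ((1 - t) * \<theta> * ?G)
         \<le> exp \<theta> + (\<Sum>l\<in>{1..N}. exp (\<theta> * (real l + 1)) * of_bool (real l \<le> ?G))"
      proof (cases "?G < 1")
        case True
        have "(1 - t) * \<theta> * ?G \<le> \<theta>"
        proof (cases "?G \<le> 0")
          case True
          then have "(1 - t) * \<theta> * ?G \<le> 0" using t \<theta> by (intro mult_nonneg_nonpos) auto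
          with \<theta> show ?thesis by linarith
        next
          case False
          then have "(1 - t) * \<theta> * ?G \<le> 1 * \<theta> * 1"
            using \<open>?G < 1\<close> t \<theta> by (intro mult_mono) auto
          then show ?thesis by simp
        qed
        then have "exp ((1 - t) * \<theta> * ?G) \<le> exp \<theta> + 0" by simp
        also have "\<dots> \<le> exp \<theta> + (\<Sum>l\<in>{1..N}. exp (\<theta> * (real l + 1)) * of_bool (real l \<le> ?G))"
          by (intro add_left_mono sum_nonneg) auto
        finally show ?thesis .
      next
        case False
        define l where "l = nat \<lfloor>?G\<rfloor>"
        have "?G \<le> real k * Kmax" using up g_nonneg[of "m - k"] g_nonneg[of "n - k"] by linarith
        then have "\<lfloor>?G\<rfloor> \<le> \<lfloor>real k * Kmax\<rfloor>" by (rule floor_mono)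
        then have lN: "l \<in> {1..N}" using False by (auto simp: l_def N_def le_nat_iff)
        have lG: "real l \<le> ?G" "?G \<le> real l + 1" using False by (auto simp: l_def)
        have "(1 - t) * \<theta> * ?G \<le> 1 * \<theta> * (real l + 1)"
          using False t \<theta> lG by (intro mult_mono) auto
        then have "exp ((1 - t) * \<theta> * ?G) \<le> exp (\<theta> * (real l + 1)) * of_bool (real l \<le> ?G)"
          using lG by simp
        also have "\<dots> \<le> (\<Sum>l\<in>{1..N}. exp (\<theta> * (real l + 1)) * of_bool (real l \<le> ?G))"
          by (rule member_le_sum[OF lN]) auto
        finally show ?thesis by (simp add: add_increasing)
      qed
      finally show ?thesis by (simp add: e_def)
    qed
    have e0: "0 \<le> e" by (simp add: e_def)
    have "(\<Sum>u\<in>words m. \<Sum>v\<in>words n. pair_term k \<theta> (u, v)) \<le>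
       (\<Sum>u\<in>words m. \<Sum>v\<in>words n. weight \<mu> u * weight \<mu> v *
         (e * (exp \<theta> + (\<Sum>l\<in>{1..N}. exp (\<theta> * (real l + 1)) * of_bool (real l \<le> opt k u v)))))"
      unfolding pair_term_def prod.case
      by (intro sum_mono mult_left_mono pt mult_nonneg_nonneg weight_nonneg)
    also have "\<dots> = (\<Sum>u\<in>words m. \<Sum>v\<in>words n. weight \<mu> u * weight \<mu> v * (e * exp \<theta>))
       + e * (\<Sum>l\<in>{1..N}. exp (\<theta> * (real l + 1)) * pair_prob m n (\<lambda>u v. real l \<le> opt k u v))"
    proof -
      have "(\<Sum>l\<in>{1..N}. exp (\<theta> * (real l + 1)) * pair_prob m n (\<lambda>u v. real l \<le> opt k u v))
        = (\<Sum>u\<in>words m. \<Sum>v\<in>words n. \<Sum>l\<in>{1..N}. exp (\<theta> * (real l + 1)) *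
            (weight \<mu> u * weight \<mu> v * of_bool (real l \<le> opt k u v)))"
        unfolding pair_prob_def sum_distrib_left
        by (subst sum.swap, rule sum.cong[OF refl], rule sum.swap)
      then show ?thesis
        by (simp add: sum_distrib_left distrib_left sum.distrib mult_ac
            del: sum_mult_of_bool_eq sum_of_bool_mult_eq)
    qed
    also have "\<dots> \<le> e * exp \<theta> + e * (\<Sum>l\<in>{1..N}. exp \<theta>)"
    proof -
      have "exp (\<theta> * (real l + 1)) * pair_prob m n (\<lambda>u v. real l \<le> opt k u v) \<le> exp \<theta>"
        if "l \<in> {1..N}" for l
      proof -
        have "exp (\<theta> * (real l + 1)) * pair_prob m n (\<lambda>u v. real l \<le> opt k u v)
          \<le> exp (\<theta> * (real l + 1)) * exp (- \<theta> * real l)"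
          using small[OF k mn, of l] that by (intro mult_left_mono) auto
        then show ?thesis by (simp add: exp_add[symmetric] algebra_simps)
      qed
      then show ?thesis unfolding weight_sum_const
        by (intro add_left_mono mult_left_mono sum_mono e0) auto
    qed
    also have "\<dots> = e * exp \<theta> * (1 + real N)" by (simp add: algebra_simps)
    also have "real N \<le> real k * Kmax" using Kmax_pos by (simp add: N_def)
    then have "e * exp \<theta> * (1 + real N) \<le> e * exp \<theta> * (1 + real k * Kmax)"
      by (intro mult_left_mono) (auto simp: e_def)
    also have "e = exp (real k * (t * \<theta> * Kmax)) * exp (- (t * \<theta>) * g (m - k)) * exp (- (t * \<theta>) * g (n - k))"
      unfolding e_def by (simp add: exp_add[symmetric] algebra_simps)
    also have "\<dots> \<le> exp (real k * (\<eta> / 2)) * exp (- (t * \<theta>) * g (m - k)) * exp (- (t * \<theta>) * g (n - k))"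
    proof -
      have "real k * (t * \<theta> * Kmax) \<le> real k * (\<eta> / 2)" using t(3) by (intro mult_left_mono) auto
      then show ?thesis by (intro mult_right_mono) auto
    qed
    finally show "(\<Sum>u\<in>words m. \<Sum>v\<in>words n. pair_term k \<theta> (u, v))
      \<le> exp \<theta> * (1 + real k * Kmax) * exp (real k * (\<eta> / 2)) * exp (- (t * \<theta>) * g (m - k)) * exp (- (t * \<theta>) * g (n - k))"
      using Kmax_pos by (simp add: mult_ac mult_right_mono mult_left_mono add_nonneg_nonneg)
  qed (use Kmax_pos in auto)
  define C where "C = exp \<theta> * (gap_sum (t * \<theta>))\<^sup>2"
  have C: "C > 0" using gap_sum_ge_1[OF t\<theta>] by (simp add: C_def)
  have "exp (real k * (\<eta> / 2)) \<le> C * (1 + real k * Kmax)" if k: "k \<ge> 1" for k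
  proof -
    have "\<eta> * real k \<le> ln (h k \<theta>)" using Psi_LIMSEQ_and_le(2)[OF \<theta> k] k by (simp add: \<eta>_def field_simps)
    then have "exp (\<eta> * real k) \<le> h k \<theta>" using h_pos[OF \<theta> k] by (metis exp_le_cancel_iff exp_ln)
    also have "\<dots> \<le> C * (1 + real k * Kmax) * exp (real k * (\<eta> / 2))"
      using hk[OF k] by (simp add: C_def mult_ac)
    also have "exp (\<eta> * real k) = exp (real k * (\<eta> / 2)) * exp (real k * (\<eta> / 2))"
      by (simp add: exp_add[symmetric])
    finally show ?thesis by simp
  qed
  moreover have "eventually (\<lambda>k::nat. C * (1 + real k * Kmax) < exp (real k * (\<eta> / 2))) sequentially"
    using C Kmax_pos pos by (intro linear_less_exp_eventually) (auto simp: \<eta>_def)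
  ultimately show False
    unfolding eventually_sequentially by (metis linorder_not_le nle_le)
qed

definition letter_mgf :: "real \<Rightarrow> real" where
  "letter_mgf \<theta> = (\<Sum>a\<in>UNIV. \<Sum>b\<in>UNIV. pmf \<mu> a * pmf \<mu> b * exp (\<theta> * K a b))"

text \<open>With one pair there is no choice: the first letters are aligned, and everything else is gap.\<close>

lemma h_1_le:
  assumes "\<theta> > 0"
  shows "h 1 \<theta> \<le> letter_mgf \<theta> * (gap_sum \<theta>)\<^sup>2"
  unfolding h_def gap_sum_def
proof (rule long_pairs_sum_bound(2)[OF _ _ summable_exp_gap[OF assms]])
  show "0 \<le> letter_mgf \<theta>" unfolding letter_mgf_def by (intro sum_nonneg) auto
  fix m n :: nat assume mn: "1 \<le> m" "1 \<le> n"
  let ?c = "exp (- \<theta> * g (m - 1)) * exp (- \<theta> * g (n - 1))"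
  have opt: "opt 1 u v = K (hd (take 1 u)) (hd (take 1 v)) - g (m - 1) - g (n - 1)"
    if "u \<in> words m" "v \<in> words n" for u v
  proof -
    have "aligned K g (Suc 0) u v (opt 1 u v)"
      using best_aligned[of 1 u v K g] that mn by (simp add: words_def)
    then show ?thesis using that by (auto elim!: aligned_SucE simp: words_def)
  qed
  have "(\<Sum>u\<in>words m. \<Sum>v\<in>words n. pair_term 1 \<theta> (u, v))
    = (\<Sum>u\<in>words m. weight \<mu> u * (\<Sum>v\<in>words n. weight \<mu> v *
        (exp (\<theta> * K (hd (take 1 u)) (hd (take 1 v))) * ?c)))"
  proof -
    have "pair_term 1 \<theta> (u, v) = weight \<mu> u * (weight \<mu> v *
        (exp (\<theta> * K (hd (take 1 u)) (hd (take 1 v))) * ?c))" if "u \<in> words m" "v \<in> words n" for u v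
      unfolding pair_term_def prod.case opt[OF that] by (simp add: exp_add[symmetric] algebra_simps)
    then show ?thesis unfolding sum_distrib_left by (intro sum.cong refl) auto
  qed
  also have "\<dots> = (\<Sum>u\<in>words m. weight \<mu> u * (\<Sum>v\<in>words 1. weight \<mu> v *
        (exp (\<theta> * K (hd (take 1 u)) (hd v)) * ?c)))"
    using sum_words_segment[of 0 1 n \<mu> "\<lambda>v. exp (\<theta> * K (hd (take 1 _)) (hd v)) * ?c"] mn by simp
  also have "\<dots> = (\<Sum>u\<in>words 1. weight \<mu> u * (\<Sum>v\<in>words 1. weight \<mu> v *
        (exp (\<theta> * K (hd u) (hd v)) * ?c)))"
    using sum_words_segment[of 0 1 m \<mu> "\<lambda>u. \<Sum>v\<in>words 1. weight \<mu> v * (exp (\<theta> * K (hd u) (hd v)) * ?c)"] mn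
    by simp
  also have "\<dots> = letter_mgf \<theta> * ?c"
    unfolding sum_words_1 letter_mgf_def
    by (simp add: weight_def sum_distrib_left sum_distrib_right mult_ac)
  finally show "(\<Sum>u\<in>words m. \<Sum>v\<in>words n. pair_term 1 \<theta> (u, v))
      \<le> letter_mgf \<theta> * exp (- \<theta> * g (m - 1)) * exp (- \<theta> * g (n - 1))"
    by (simp add: mult_ac)
qed auto

text \<open>The derivative of the moment generating function at 0 is the mean score.\<close>

lemma letter_mgf_less_1:
  assumes "(\<Sum>a\<in>UNIV. \<Sum>b\<in>UNIV. pmf \<mu> a * pmf \<mu> b * K a b) < 0"
  shows "\<exists>\<theta>>0. letter_mgf \<theta> < 1"
proof -
  let ?D = "\<Sum>a\<in>UNIV. \<Sum>b\<in>UNIV. pmf \<mu> a * pmf \<mu> b * K a b"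
  have "DERIV letter_mgf 0 :> ?D"
    unfolding letter_mgf_def
    by (intro DERIV_sum) (auto intro!: derivative_eq_intros)
  from DERIV_neg_dec_right[OF this assms] obtain d where d: "d > 0"
    "\<And>e. 0 < e \<Longrightarrow> e < d \<Longrightarrow> letter_mgf (0 + e) < letter_mgf 0" by blast
  have s: "(\<Sum>a\<in>UNIV. pmf \<mu> a) = 1" by (rule sum_pmf_eq_1) auto
  have "letter_mgf 0 = 1"
    unfolding letter_mgf_def by (simp add: sum_distrib_left[symmetric] s)
  with d(2)[of "d / 2"] d(1) show ?thesis by (intro exI[of _ "d / 2"]) auto
qed

lemma Psi_neg_if_h_1:
  assumes "\<theta> > 0" "letter_mgf \<theta> * (gap_sum \<theta>)\<^sup>2 < 1"
  shows "Psi \<theta> < 0"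
proof -
  have "h 1 \<theta> < 1" using h_1_le[OF assms(1)] assms(2) by linarith
  then have "ln (h 1 \<theta>) < 0" using h_pos[OF assms(1), of 1] by simp
  with Psi_LIMSEQ_and_le(2)[OF assms(1), of 1] show ?thesis by simp
qed

end

section \<open>Regular subrelations\<close>

text \<open>Sort both sides by the dyadic size of their degrees. Vertices of degree below \<open>p / 4\<close>, where \<open>p\<close> is the
probability of the relation, carry at most half of it, so at most \<open>T + 1\<close> classes remain on each
side and one pair of classes, with degrees of order \<open>a\<close> and \<open>b\<close>, keeps a fraction of order
\<open>1 / (T + 1)\<^sup>2\<close>. By double counting these classes have mass at most \<open>2 * p / a\<close> and \<open>2 * p / b\<close>. The
probability of the restricted relation is at most the product of the two masses, which turns into an
upper bound for \<open>a * b\<close>.\<close>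

lemma regular_subrelation:
  fixes p1 :: "'u \<Rightarrow> real" and p2 :: "'v \<Rightarrow> real" and M :: "'u \<Rightarrow> 'v \<Rightarrow> bool"
  assumes fin: "finite U" "finite V"
    and nonneg: "\<And>u. 0 \<le> p1 u" "\<And>v. 0 \<le> p2 v"
    and mass: "sum p1 U \<le> 1" "sum p2 V \<le> 1"
  defines "prb \<equiv> \<lambda>R. \<Sum>u\<in>U. \<Sum>v\<in>V. p1 u * p2 v * of_bool (R u v)"
  assumes T: "(1/2) ^ (T + 1) \<le> prb M / 4" and pos: "prb M > 0"
  shows "\<exists>R a b. (\<forall>u v. R u v \<longrightarrow> M u v) \<and> 0 \<le> a \<and> 0 \<le> b \<and>
    (\<forall>u\<in>U. (\<Sum>v\<in>V. p2 v * of_bool (R u v)) \<le> a) \<and> (\<forall>v\<in>V. (\<Sum>u\<in>U. p1 u * of_bool (R u v)) \<le> b) \<and>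
    prb M \<le> 2 * (real T + 1)\<^sup>2 * prb R \<and> a * b \<le> 16 * (real T + 1) ^ 4 * prb R"
proof -
  define p where "p = prb M"
  define q1 where "q1 u = (\<Sum>v\<in>V. p2 v * of_bool (M u v))" for u
  define q2 where "q2 v = (\<Sum>u\<in>U. p1 u * of_bool (M u v))" for v
  \<comment> \<open>dyadic size: \<open>q\<close> lies between consecutive powers of 1/2, the upper one having exponent \<open>lev q\<close>\<close>
  define lev where "lev q = (LEAST s. (1/2) ^ (s + 1) < q)" for q :: real
  have lev: "lev q \<le> T" "(1/2) ^ (lev q + 1) < q" "q \<le> (1/2) ^ lev q" if q: "p / 4 < q" "q \<le> 1" for q
  proof -
    have "(1/2) ^ (T + 1) < q" using T q by (simp add: p_def)
    then show "lev q \<le> T" "(1/2) ^ (lev q + 1) < q"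
      unfolding lev_def by (rule Least_le, rule LeastI)
    show "q \<le> (1/2) ^ lev q"
    proof (cases "lev q")
      case (Suc s)
      then have "\<not> (1/2) ^ (s + 1) < q" using not_less_Least[of s "\<lambda>s. (1/2) ^ (s + 1) < q"]
        by (simp add: lev_def)
      with Suc show ?thesis by simp
    qed (use q in simp)
  qed
  have q1_le: "q1 u \<le> 1" for u
  proof -
    have "q1 u \<le> sum p2 V" unfolding q1_def by (intro sum_mono) (auto simp: nonneg)
    with mass show ?thesis by simp
  qed
  have q2_le: "q2 v \<le> 1" for v
  proof -
    have "q2 v \<le> sum p1 U" unfolding q2_def by (intro sum_mono) (auto simp: nonneg)
    with mass show ?thesis by simp
  qed
  have prb1: "prb R = (\<Sum>u\<in>U. p1 u * (\<Sum>v\<in>V. p2 v * of_bool (R u v)))" for R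
    unfolding prb_def by (simp add: sum_distrib_left mult.assoc del: sum_mult_of_bool_eq sum_of_bool_mult_eq)
  have prb2: "prb R = (\<Sum>v\<in>V. p2 v * (\<Sum>u\<in>U. p1 u * of_bool (R u v)))" for R
    unfolding prb_def by (subst sum.swap)
      (simp add: sum_distrib_left mult_ac del: sum_mult_of_bool_eq sum_of_bool_mult_eq)
  have prb_mono: "prb R \<le> prb R'" if "\<And>u v. R u v \<Longrightarrow> R' u v" for R R'
    unfolding prb_def using that by (intro sum_mono mult_left_mono) (auto simp: nonneg)
  define G where "G u v \<longleftrightarrow> M u v \<and> p / 4 < q1 u \<and> p / 4 < q2 v" for u v
  have "p \<le> prb G + prb (\<lambda>u v. M u v \<and> q1 u \<le> p / 4) + prb (\<lambda>u v. M u v \<and> q2 v \<le> p / 4)"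
  proof -
    have "of_bool (M u v) \<le> (of_bool (G u v) + of_bool (M u v \<and> q1 u \<le> p / 4) + of_bool (M u v \<and> q2 v \<le> p / 4) :: real)" for u v
      by (auto simp: G_def not_less)
    then have "prb M \<le> prb G + prb (\<lambda>u v. M u v \<and> q1 u \<le> p / 4) + prb (\<lambda>u v. M u v \<and> q2 v \<le> p / 4)"
      unfolding prb_def sum.distrib[symmetric] distrib_left[symmetric]
      by (intro sum_mono mult_left_mono mult_nonneg_nonneg nonneg)
    then show ?thesis by (simp add: p_def)
  qed
  moreover have "prb (\<lambda>u v. M u v \<and> q1 u \<le> p / 4) \<le> p / 4"
  proof -
    have "prb (\<lambda>u v. M u v \<and> q1 u \<le> p / 4) \<le> (\<Sum>u\<in>U. p1 u * (p / 4))"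
      unfolding prb1
    proof (intro sum_mono mult_left_mono nonneg)
      fix u show "(\<Sum>v\<in>V. p2 v * of_bool (M u v \<and> q1 u \<le> p / 4)) \<le> p / 4"
        using pos by (cases "q1 u \<le> p / 4") (auto simp: q1_def[symmetric] p_def)
    qed
    also have "\<dots> = sum p1 U * (p / 4)" by (simp add: sum_distrib_right)
    also have "\<dots> \<le> 1 * (p / 4)" using mass pos by (intro mult_right_mono) (auto simp: p_def)
    finally show ?thesis by simp
  qed
  moreover have "prb (\<lambda>u v. M u v \<and> q2 v \<le> p / 4) \<le> p / 4"
  proof -
    have "prb (\<lambda>u v. M u v \<and> q2 v \<le> p / 4) \<le> (\<Sum>v\<in>V. p2 v * (p / 4))"
      unfolding prb2
    proof (intro sum_mono mult_left_mono nonneg)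
      fix v show "(\<Sum>u\<in>U. p1 u * of_bool (M u v \<and> q2 v \<le> p / 4)) \<le> p / 4"
        using pos by (cases "q2 v \<le> p / 4") (auto simp: q2_def[symmetric] p_def)
    qed
    also have "\<dots> = sum p2 V * (p / 4)" by (simp add: sum_distrib_right)
    also have "\<dots> \<le> 1 * (p / 4)" using mass pos by (intro mult_right_mono) (auto simp: p_def)
    finally show ?thesis by simp
  qed
  ultimately have Gp: "p / 2 \<le> prb G" by simp
  define Gs where "Gs s t u v \<longleftrightarrow> G u v \<and> lev (q1 u) = s \<and> lev (q2 v) = t" for s t u v
  have "prb G \<le> (\<Sum>s\<in>{..T}. \<Sum>t\<in>{..T}. prb (Gs s t))"
  proof -
    have "of_bool (G u v) \<le> (\<Sum>s\<in>{..T}. \<Sum>t\<in>{..T}. of_bool (Gs s t u v) :: real)" for u v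
    proof (cases "G u v")
      case True
      then have l: "lev (q1 u) \<in> {..T}" "lev (q2 v) \<in> {..T}"
        using lev(1) q1_le q2_le by (auto simp: G_def)
      have "of_bool (G u v) \<le> (of_bool (Gs (lev (q1 u)) (lev (q2 v)) u v) :: real)"
        by (simp add: Gs_def)
      also have "\<dots> \<le> (\<Sum>t\<in>{..T}. of_bool (Gs (lev (q1 u)) t u v))"
        by (rule member_le_sum[OF l(2)]) auto
      also have "\<dots> \<le> (\<Sum>s\<in>{..T}. \<Sum>t\<in>{..T}. of_bool (Gs s t u v))"
        by (rule member_le_sum[OF l(1), of "\<lambda>s. \<Sum>t\<in>{..T}. of_bool (Gs s t u v)"]) (auto intro: sum_nonneg)
      finally show ?thesis .
    qed (auto intro!: sum_nonneg)
    then have "prb G \<le> (\<Sum>u\<in>U. \<Sum>v\<in>V. p1 u * p2 v * (\<Sum>s\<in>{..T}. \<Sum>t\<in>{..T}. of_bool (Gs s t u v)))"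
      unfolding prb_def by (intro sum_mono mult_left_mono mult_nonneg_nonneg nonneg)
    also have "\<dots> = (\<Sum>u\<in>U. \<Sum>v\<in>V. \<Sum>s\<in>{..T}. \<Sum>t\<in>{..T}. p1 u * p2 v * of_bool (Gs s t u v))"
      unfolding sum_distrib_left ..
    also have "\<dots> = (\<Sum>u\<in>U. \<Sum>s\<in>{..T}. \<Sum>v\<in>V. \<Sum>t\<in>{..T}. p1 u * p2 v * of_bool (Gs s t u v))"
      by (rule sum.cong[OF refl], rule sum.swap)
    also have "\<dots> = (\<Sum>s\<in>{..T}. \<Sum>u\<in>U. \<Sum>v\<in>V. \<Sum>t\<in>{..T}. p1 u * p2 v * of_bool (Gs s t u v))"
      by (rule sum.swap)
    also have "\<dots> = (\<Sum>s\<in>{..T}. \<Sum>u\<in>U. \<Sum>t\<in>{..T}. \<Sum>v\<in>V. p1 u * p2 v * of_bool (Gs s t u v))"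
      by (rule sum.cong[OF refl], rule sum.cong[OF refl], rule sum.swap)
    also have "\<dots> = (\<Sum>s\<in>{..T}. \<Sum>t\<in>{..T}. prb (Gs s t))"
      unfolding prb_def by (rule sum.cong[OF refl], rule sum.swap)
    finally show ?thesis .
  qed
  have "\<exists>s\<le>T. \<exists>t\<le>T. p \<le> 2 * (real T + 1)\<^sup>2 * prb (Gs s t)"
  proof (rule ccontr)
    assume "\<not> ?thesis"
    then have less: "2 * (real T + 1)\<^sup>2 * prb (Gs s t) < p" if "s \<le> T" "t \<le> T" for s t
      using that by (meson not_le)
    have "(real T + 1)\<^sup>2 * (2 * (\<Sum>s\<in>{..T}. \<Sum>t\<in>{..T}. prb (Gs s t)))
       = (\<Sum>s\<in>{..T}. \<Sum>t\<in>{..T}. 2 * (real T + 1)\<^sup>2 * prb (Gs s t))"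
      by (simp add: sum_distrib_left mult_ac)
    also have "\<dots> < (\<Sum>s\<in>{..T}. \<Sum>t\<in>{..T}. p)"
      by (intro sum_strict_mono less) auto
    also have "\<dots> = (real T + 1)\<^sup>2 * p" by (simp add: power2_eq_square algebra_simps)
    finally have "2 * (\<Sum>s\<in>{..T}. \<Sum>t\<in>{..T}. prb (Gs s t)) < p"
      by (subst (asm) mult_less_cancel_left_pos) auto
    with Gp \<open>prb G \<le> _\<close> show False by linarith
  qed
  then obtain s t where st: "p \<le> 2 * (real T + 1)\<^sup>2 * prb (Gs s t)" by blast
  define R where "R = Gs s t"
  define a b :: real where "a = (1/2) ^ s" and "b = (1/2) ^ t"
  have ab: "a > 0" "b > 0" by (auto simp: a_def b_def)
  define A where "A = (\<Sum>u\<in>U. p1 u * of_bool (p / 4 < q1 u \<and> lev (q1 u) = s))"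
  define B where "B = (\<Sum>v\<in>V. p2 v * of_bool (p / 4 < q2 v \<and> lev (q2 v) = t))"
  have deg1: "(\<Sum>v\<in>V. p2 v * of_bool (R u v)) \<le> a" for u
  proof (cases "p / 4 < q1 u \<and> lev (q1 u) = s")
    case True
    have "(\<Sum>v\<in>V. p2 v * of_bool (R u v)) \<le> q1 u"
      unfolding q1_def by (intro sum_mono mult_left_mono nonneg) (auto simp: R_def Gs_def G_def)
    also have "\<dots> \<le> a" using lev(3)[of "q1 u"] True q1_le by (auto simp: a_def)
    finally show ?thesis .
  next
    case False
    then have "R u v \<longleftrightarrow> False" for v by (auto simp: R_def Gs_def G_def)
    then show ?thesis using ab by simp
  qed
  have deg2: "(\<Sum>u\<in>U. p1 u * of_bool (R u v)) \<le> b" for v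
  proof (cases "p / 4 < q2 v \<and> lev (q2 v) = t")
    case True
    have "(\<Sum>u\<in>U. p1 u * of_bool (R u v)) \<le> q2 v"
      unfolding q2_def by (intro sum_mono mult_left_mono nonneg) (auto simp: R_def Gs_def G_def)
    also have "\<dots> \<le> b" using lev(3)[of "q2 v"] True q2_le by (auto simp: b_def)
    finally show ?thesis .
  next
    case False
    then have "R u v \<longleftrightarrow> False" for u by (auto simp: R_def Gs_def G_def)
    then show ?thesis using ab by simp
  qed
  have "A * (a / 2) \<le> p"
  proof -
    have "of_bool (p / 4 < q1 u \<and> lev (q1 u) = s) * (a / 2) \<le> q1 u" for u
    proof (cases "p / 4 < q1 u \<and> lev (q1 u) = s")
      case True
      with lev(2)[of "q1 u"] q1_le[of u] show ?thesis by (simp add: a_def)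
    next
      case False
      then show ?thesis by (auto simp: q1_def nonneg intro!: sum_nonneg)
    qed
    then have "A * (a / 2) \<le> (\<Sum>u\<in>U. p1 u * q1 u)"
      unfolding A_def sum_distrib_right mult.assoc by (intro sum_mono mult_left_mono nonneg)
    then show ?thesis by (simp add: p_def prb1 q1_def)
  qed
  moreover have "B * (b / 2) \<le> p"
  proof -
    have "of_bool (p / 4 < q2 v \<and> lev (q2 v) = t) * (b / 2) \<le> q2 v" for v
    proof (cases "p / 4 < q2 v \<and> lev (q2 v) = t")
      case True
      with lev(2)[of "q2 v"] q2_le[of v] show ?thesis by (simp add: b_def)
    next
      case False
      then show ?thesis by (auto simp: q2_def nonneg intro!: sum_nonneg)
    qed
    then have "B * (b / 2) \<le> (\<Sum>v\<in>V. p2 v * q2 v)"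
      unfolding B_def sum_distrib_right mult.assoc by (intro sum_mono mult_left_mono nonneg)
    then show ?thesis by (simp add: p_def prb2 q2_def)
  qed
  moreover have "0 \<le> A" "0 \<le> B" by (auto simp: A_def B_def nonneg intro!: sum_nonneg)
  ultimately have "(A * (a / 2)) * (B * (b / 2)) \<le> p * p"
    using ab pos by (intro mult_mono) (auto simp: p_def)
  moreover have "prb R \<le> A * B"
  proof -
    have "prb R \<le> (\<Sum>u\<in>U. \<Sum>v\<in>V. (p1 u * of_bool (p / 4 < q1 u \<and> lev (q1 u) = s)) *
        (p2 v * of_bool (p / 4 < q2 v \<and> lev (q2 v) = t)))"
      unfolding prb_def by (intro sum_mono) (auto simp: R_def Gs_def G_def nonneg)
    also have "\<dots> = A * B"
      unfolding A_def B_def sum_product ..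
    finally show ?thesis .
  qed
  ultimately have "prb R * (a * b) \<le> A * B * (a * b)" "A * B * (a * b) \<le> 4 * (p * p)"
    using ab by (auto intro!: mult_right_mono) (simp add: mult_ac)
  have prbR: "prb R > 0"
  proof -
    have "0 < 2 * (real T + 1)\<^sup>2 * prb R" using st pos unfolding R_def p_def by linarith
    then show ?thesis by (simp add: zero_less_mult_iff)
  qed
  from \<open>prb R * (a * b) \<le> A * B * (a * b)\<close> \<open>A * B * (a * b) \<le> 4 * (p * p)\<close>
  have "prb R * (a * b) \<le> 4 * (p * p)" by linarith
  also have "p * p \<le> (2 * (real T + 1)\<^sup>2 * prb R) * (2 * (real T + 1)\<^sup>2 * prb R)"
    using st pos prbR by (intro mult_mono) (auto simp: R_def p_def)
  finally have "prb R * (a * b) \<le> prb R * (16 * (real T + 1) ^ 4 * prb R)"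
    by (simp add: power2_eq_square power4_eq_xxxx algebra_simps)
  moreover note prbR
  ultimately have "a * b \<le> 16 * (real T + 1) ^ 4 * prb R" by simp
  then show ?thesis
    using deg1 deg2 ab st
    by (intro exI[of _ R] exI[of _ a] exI[of _ b]) (auto simp: R_def Gs_def G_def p_def)
qed

section \<open>Hit probabilities of word pairs\<close>

definition global_hit :: "('a \<Rightarrow> 'a \<Rightarrow> real) \<Rightarrow> (nat \<Rightarrow> real) \<Rightarrow> real \<Rightarrow> 'a list \<Rightarrow> 'a list \<Rightarrow> bool" where
  "global_hit K g c u v \<longleftrightarrow> (\<exists>k\<ge>1. \<exists>s\<ge>c. aligned K g k u v s)"

lemma global_hit_append:
  assumes "global_hit K g c u v" "global_hit K g d u' v'"
  shows "global_hit K g (c + d) (u @ u') (v @ v')"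
  using assms aligned_append[of K g] unfolding global_hit_def
  by (metis add_mono trans_le_add1)

lemma global_hit_swap:
  "(\<And>a b. K a b = K b a) \<Longrightarrow> global_hit K g c u v \<Longrightarrow> global_hit K g c v u"
  unfolding global_hit_def using aligned_swap by metis

lemma local_hit_if_global_hit:
  assumes "global_hit K g c (take l (drop i u)) (take l' (drop j v))" "i + l \<le> length u" "j + l' \<le> length v"
  shows "local_hit K g c u v"
  using assms unfolding global_hit_def local_hit_def by blast

context scoring
begin

lemma pair_prob_mono:
  assumes "\<And>u v. u \<in> words m \<Longrightarrow> v \<in> words n \<Longrightarrow> Q u v \<Longrightarrow> Q' u v"
  shows "pair_prob m n Q \<le> pair_prob m n Q'"
  unfolding pair_prob_def using assms by (intro sum_mono mult_left_mono) auto

lemma pair_prob_append: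
  "pair_prob (m1 + m2) (n1 + n2) Q = (\<Sum>u\<in>words m1. \<Sum>u'\<in>words m2. \<Sum>v\<in>words n1. \<Sum>v'\<in>words n2.
     weight \<mu> u * weight \<mu> u' * weight \<mu> v * weight \<mu> v' * of_bool (Q (u @ u') (v @ v')))"
  unfolding pair_prob_def sum_words_append weight_append mult.assoc ..

lemma pair_prob_product:
  assumes "\<And>u u' v v'. u \<in> words m1 \<Longrightarrow> u' \<in> words m2 \<Longrightarrow> v \<in> words n1 \<Longrightarrow> v' \<in> words n2 \<Longrightarrow>
     Q (u @ u') (v @ v') \<longleftrightarrow> Q1 u v \<and> Q2 u' v'"
  shows "pair_prob (m1 + m2) (n1 + n2) Q = pair_prob m1 n1 Q1 * pair_prob m2 n2 Q2"
proof -
  have "pair_prob (m1 + m2) (n1 + n2) Q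
    = (\<Sum>u\<in>words m1. \<Sum>u'\<in>words m2. \<Sum>v\<in>words n1. \<Sum>v'\<in>words n2.
     (weight \<mu> u * weight \<mu> v * of_bool (Q1 u v)) * (weight \<mu> u' * weight \<mu> v' * of_bool (Q2 u' v')))"
    unfolding pair_prob_append by (intro sum.cong refl) (simp add: assms)
  also have "\<dots> = pair_prob m1 n1 Q1 * pair_prob m2 n2 Q2"
    unfolding pair_prob_def sum_product ..
  finally show ?thesis .
qed

lemma pair_prob_segments:
  assumes "i + l \<le> m" "j + l' \<le> n"
  shows "pair_prob m n (\<lambda>u v. Q (take l (drop i u)) (take l' (drop j v))) = pair_prob l l' Q"
proof -
  have "pair_prob m n (\<lambda>u v. Q (take l (drop i u)) (take l' (drop j v)))
    = (\<Sum>u\<in>words m. weight \<mu> u * (\<Sum>v\<in>words n. weight \<mu> v * of_bool (Q (take l (drop i u)) (take l' (drop j v)))))"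
    unfolding pair_prob_def
    by (simp add: sum_distrib_left mult.assoc del: sum_mult_of_bool_eq sum_of_bool_mult_eq)
  also have "\<dots> = (\<Sum>u\<in>words m. weight \<mu> u * (\<Sum>v\<in>words l'. weight \<mu> v * of_bool (Q (take l (drop i u)) v)))"
    by (intro sum.cong refl arg_cong2[of _ _ _ _ "(*)"] sum_words_segment[OF assms(2)])
  also have "\<dots> = (\<Sum>u\<in>words l. weight \<mu> u * (\<Sum>v\<in>words l'. weight \<mu> v * of_bool (Q u v)))"
    by (rule sum_words_segment[OF assms(1), of \<mu> "\<lambda>u. \<Sum>v\<in>words l'. weight \<mu> v * of_bool (Q u v)"])
  also have "\<dots> = pair_prob l l' Q"
    unfolding pair_prob_def
    by (simp add: sum_distrib_left mult.assoc del: sum_mult_of_bool_eq sum_of_bool_mult_eq)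
  finally show ?thesis .
qed

lemma global_hit_power:
  assumes base: "q \<le> pair_prob m n (global_hit K g c)" "0 \<le> q" and "r \<ge> 1"
  shows "q ^ r \<le> pair_prob (r * m) (r * n) (global_hit K g (real r * c))"
  using assms(3)
proof (induction r rule: dec_induct)
  case (step r)
  have "q ^ Suc r \<le> pair_prob m n (global_hit K g c) * pair_prob (r * m) (r * n) (global_hit K g (real r * c))"
    using base step by (auto intro!: mult_mono)
  also have "\<dots> = pair_prob (m + r * m) (n + r * n) (\<lambda>u v. global_hit K g c (take m u) (take n v) \<and>
      global_hit K g (real r * c) (drop m u) (drop n v))"
    by (rule pair_prob_product[symmetric]) (auto simp: words_def)
  also have "\<dots> \<le> pair_prob (m + r * m) (n + r * n) (global_hit K g (c + real r * c))"
  proof (rule pair_prob_mono)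
    fix u v assume "global_hit K g c (take m u) (take n v) \<and>
      global_hit K g (real r * c) (drop m u) (drop n v)"
    with global_hit_append[of K g c "take m u" "take n v" "real r * c" "drop m u" "drop n v"]
    show "global_hit K g (c + real r * c) u v" by simp
  qed
  finally show ?case by (simp add: algebra_simps)
qed (use base in simp)

lemma global_hit_blocks:
  assumes "\<theta> > 0" "Psi \<theta> > 0"
  shows "\<exists>m n l. m \<ge> 1 \<and> n \<ge> 1 \<and> l \<ge> 1 \<and> (\<forall>r\<ge>1.
    exp (- \<theta> * (real r * real l)) \<le> pair_prob (r * m) (r * n) (global_hit K g (real r * real l)))"
proof -
  obtain k m n l where k: "k \<ge> 1" "m \<ge> k" "n \<ge> k" "l \<ge> 1"
    and p: "exp (- \<theta> * real l) \<le> pair_prob m n (\<lambda>u v. real l \<le> opt k u v)"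
    using exists_good_block_size[OF assms] by (metis (no_types))
  have "pair_prob m n (\<lambda>u v. real l \<le> opt k u v) \<le> pair_prob m n (global_hit K g (real l))"
    using best_aligned[of k _ _ K g] k
    by (intro pair_prob_mono) (auto simp: global_hit_def words_def)
  with p have q: "exp (- \<theta> * real l) \<le> pair_prob m n (global_hit K g (real l))" by linarith
  have "exp (- \<theta> * (real r * real l)) \<le> pair_prob (r * m) (r * n) (global_hit K g (real r * real l))"
    if "r \<ge> 1" for r
    using global_hit_power[OF q _ that]
    by (simp add: exp_of_nat_mult[symmetric] mult_ac)
  then show ?thesis using k by (intro exI[of _ m] exI[of _ n] exI[of _ l]) auto
qed

lemma local_hit_ge_global_hit:
  assumes "m \<le> M" "n \<le> N"
  shows "pair_prob m n (global_hit K g c) \<le> pair_prob M N (local_hit K g c)"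
proof -
  have "pair_prob m n (global_hit K g c)
    = pair_prob M N (\<lambda>u v. global_hit K g c (take m (drop 0 u)) (take n (drop 0 v)))"
    by (rule pair_prob_segments[symmetric]) (use assms in auto)
  also have "\<dots> \<le> pair_prob M N (local_hit K g c)"
    by (rule pair_prob_mono) (use assms in \<open>auto simp: words_def intro!: local_hit_if_global_hit[of K g c m 0 _ n 0]\<close>)
  finally show ?thesis .
qed

lemma summable_h:
  assumes "\<theta> > 0" "Psi \<theta> < 0"
  shows "summable (\<lambda>k. h (Suc k) \<theta>)"
proof -
  define \<delta> where "\<delta> = - Psi \<theta> / 2"
  have \<delta>: "\<delta> > 0" "Psi \<theta> < - \<delta>" using assms by (auto simp: \<delta>_def)
  have "summable (\<lambda>k. h k \<theta>)"
  proof (rule summable_comparison_test_ev)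
    show "eventually (\<lambda>k. norm (h k \<theta>) \<le> exp (- \<delta>) ^ k) sequentially"
      using order_tendstoD(2)[OF Psi_LIMSEQ_and_le(1)[OF assms(1)] \<delta>(2)] eventually_ge_at_top[of 1]
    proof eventually_elim
      case (elim k)
      then have "ln (h k \<theta>) \<le> - \<delta> * real k" by (simp add: field_simps)
      then have "h k \<theta> \<le> exp (- \<delta> * real k)"
        using h_pos[OF assms(1), of k] elim by (metis exp_le_cancel_iff exp_ln)
      with h_pos[OF assms(1), of k] elim show ?case
        by (simp add: exp_of_nat_mult[symmetric] mult_ac)
    qed
    show "summable (\<lambda>k. exp (- \<delta>) ^ k)" using \<delta> by (intro summable_geometric) simp
  qed
  then show ?thesis by (subst summable_Suc_iff)
qed

text \<open>Markov's inequality for the exponential of the optimal score, summed over the sizes of the words.\<close>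

lemma hit_prob_sum_le:
  assumes "\<theta> > 0" "k \<ge> 1"
  shows "(\<Sum>l\<in>{k..m}. \<Sum>l'\<in>{k..n}. pair_prob l l' (\<lambda>u v. \<exists>s\<ge>c. aligned K g k u v s))
     \<le> exp (- \<theta> * c) * h k \<theta>"
proof -
  have "pair_prob l l' (\<lambda>u v. \<exists>s\<ge>c. aligned K g k u v s)
     \<le> exp (- \<theta> * c) * (\<Sum>p\<in>words l \<times> words l'. pair_term k \<theta> p)" for l l'
  proof -
    have "of_bool (\<exists>s\<ge>c. aligned K g k u v s) \<le> exp (- \<theta> * c) * exp (\<theta> * opt k u v)" for u v
    proof (cases "\<exists>s\<ge>c. aligned K g k u v s")
      case True
      then have "c \<le> opt k u v" using best_ge[of K g k u v] by force
      then have "0 \<le> - \<theta> * c + \<theta> * opt k u v"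
        using mult_left_mono[of c "opt k u v" \<theta>] assms(1) by simp
      then show ?thesis using True by (simp add: exp_add[symmetric])
    next
      case False
      then have "(\<exists>s\<ge>c. aligned K g k u v s) \<longleftrightarrow> False" by blast
      then show ?thesis by (simp only: of_bool_eq) simp
    qed
    then have "pair_prob l l' (\<lambda>u v. \<exists>s\<ge>c. aligned K g k u v s)
      \<le> (\<Sum>u\<in>words l. \<Sum>v\<in>words l'. weight \<mu> u * weight \<mu> v * (exp (- \<theta> * c) * exp (\<theta> * opt k u v)))"
      unfolding pair_prob_def by (intro sum_mono mult_left_mono mult_nonneg_nonneg weight_nonneg)
    also have "\<dots> = exp (- \<theta> * c) * (\<Sum>p\<in>words l \<times> words l'. pair_term k \<theta> p)"
      unfolding pair_term_def by (simp add: sum.cartesian_product[symmetric] sum_distrib_left mult_ac)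
    finally show ?thesis .
  qed
  then have "(\<Sum>l\<in>{k..m}. \<Sum>l'\<in>{k..n}. pair_prob l l' (\<lambda>u v. \<exists>s\<ge>c. aligned K g k u v s))
    \<le> (\<Sum>l\<in>{k..m}. \<Sum>l'\<in>{k..n}. exp (- \<theta> * c) * (\<Sum>p\<in>words l \<times> words l'. pair_term k \<theta> p))"
    by (intro sum_mono)
  also have "\<dots> = exp (- \<theta> * c) * (\<Sum>q\<in>{k..m} \<times> {k..n}. sum (pair_term k \<theta>) (case q of (l, l') \<Rightarrow> words l \<times> words l'))"
    by (simp add: sum.cartesian_product sum_distrib_left case_prod_unfold)
  also have "(\<Sum>q\<in>{k..m} \<times> {k..n}. sum (pair_term k \<theta>) (case q of (l, l') \<Rightarrow> words l \<times> words l'))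
    = sum (pair_term k \<theta>) (\<Union>(l, l')\<in>{k..m} \<times> {k..n}. words l \<times> words l')"
    by (rule sum.UNION_disjoint[symmetric]) (auto dest: length_words)
  also have "\<dots> \<le> h k \<theta>"
    unfolding h_def
    by (rule finite_sum_le_infsum[OF h_bound(1)[OF assms]]) (auto simp: long_pairs_def dest: length_words)
  finally show ?thesis by (simp add: mult_left_mono)
qed

text \<open>Union bound over the starts and the lengths of the two segments and over the number of pairs. The
sums over the lengths are part of the generating functions, so only the starts contribute a
factor \<open>m * n\<close>.\<close>

lemma local_hit_upper:
  assumes "\<theta> > 0" "Psi \<theta> < 0"
  shows "\<exists>C>0. \<forall>m n c. pair_prob m n (local_hit K g c) \<le> C * real m * real n * exp (- \<theta> * c)"
proof -
  define C where "C = (\<Sum>k. h (Suc k) \<theta>) + 1"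
  note sm = summable_h[OF assms]
  have hn: "0 \<le> h (Suc k) \<theta>" for k using h_pos[OF assms(1), of "Suc k"] by simp
  have C: "C > 0" unfolding C_def using suminf_nonneg[OF sm hn] by linarith
  have "pair_prob m n (local_hit K g c) \<le> C * real m * real n * exp (- \<theta> * c)" for m n c
  proof -
    define H where "H k u v \<longleftrightarrow> (\<exists>s\<ge>c. aligned K g k u v s)" for k u v
    define I where "I = {..<m} \<times> {..<n} \<times> (SIGMA k:{1..m}. {k..m} \<times> {k..n})"
    define Q where "Q = (\<lambda>(i, j, k, l, l') u v. i + l \<le> m \<and> j + l' \<le> n \<and> H k (take l (drop i u)) (take l' (drop j v)))"
    have finI: "finite I" by (auto simp: I_def)
    have "of_bool (local_hit K g c u v) \<le> (\<Sum>q\<in>I. of_bool (Q q u v) :: real)"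
      if uv: "u \<in> words m" "v \<in> words n" for u v
    proof (cases "local_hit K g c u v")
      case True
      then obtain k i l j l' s where *: "k \<ge> 1" "i + l \<le> m" "j + l' \<le> n" "c \<le> s"
        "aligned K g k (take l (drop i u)) (take l' (drop j v)) s"
        using uv by (auto simp: local_hit_def words_def)
      have "k \<le> l" "k \<le> l'" using aligned_length[OF *(5)] by auto
      then have "(i, j, k, l, l') \<in> I" using * by (auto simp: I_def)
      moreover have "Q (i, j, k, l, l') u v" using * by (auto simp: Q_def H_def)
      ultimately show ?thesis
        using member_le_sum[of "(i, j, k, l, l')" I "\<lambda>q. of_bool (Q q u v) :: real"] finI by simp
    qed (auto intro: sum_nonneg)
    then have "pair_prob m n (local_hit K g c) \<le> (\<Sum>u\<in>words m. \<Sum>v\<in>words n. weight \<mu> u * weight \<mu> v * (\<Sum>q\<in>I. of_bool (Q q u v)))"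
      unfolding pair_prob_def by (intro sum_mono mult_left_mono mult_nonneg_nonneg weight_nonneg)
    also have "\<dots> = (\<Sum>u\<in>words m. \<Sum>q\<in>I. \<Sum>v\<in>words n. weight \<mu> u * weight \<mu> v * of_bool (Q q u v))"
      unfolding sum_distrib_left by (rule sum.cong[OF refl], rule sum.swap)
    also have "\<dots> = (\<Sum>q\<in>I. pair_prob m n (Q q))"
      unfolding pair_prob_def by (rule sum.swap)
    also have "\<dots> \<le> (\<Sum>(i, j, k, l, l')\<in>I. pair_prob l l' (H k))"
    proof (rule sum_mono)
      fix q assume "q \<in> I"
      obtain i j k l l' where q: "q = (i, j, k, l, l')" by (metis prod_cases5)
      have "pair_prob m n (Q q) \<le> pair_prob l l' (H k)"
      proof (cases "i + l \<le> m \<and> j + l' \<le> n")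
        case True
        then show ?thesis
          using pair_prob_segments[of i l m j l' n "H k"] by (simp add: Q_def q)
      next
        case False
        then have "Q q u v \<longleftrightarrow> False" for u v by (auto simp: Q_def q)
        then show ?thesis by (simp add: pair_prob_def[of m n])
      qed
      then show "pair_prob m n (Q q) \<le> (case q of (i, j, k, l, l') \<Rightarrow> pair_prob l l' (H k))"
        by (simp add: q)
    qed
    also have "\<dots> = (\<Sum>i<m. \<Sum>j<n. \<Sum>k\<in>{1..m}. \<Sum>l\<in>{k..m}. \<Sum>l'\<in>{k..n}. pair_prob l l' (H k))"
      unfolding I_def by (simp add: sum.cartesian_product[symmetric] sum.Sigma[symmetric])
    also have "\<dots> \<le> (\<Sum>i<m. \<Sum>j<n. \<Sum>k\<in>{1..m}. exp (- \<theta> * c) * h k \<theta>)"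
      unfolding H_def by (intro sum_mono hit_prob_sum_le assms) auto
    also have "\<dots> = real m * real n * exp (- \<theta> * c) * (\<Sum>k\<in>{1..m}. h k \<theta>)"
      by (simp add: sum_distrib_left mult.assoc)
    also have "(\<Sum>k\<in>{1..m}. h k \<theta>) = (\<Sum>k<m. h (Suc k) \<theta>)"
      by (rule sum.reindex_bij_witness[of _ Suc "\<lambda>k. k - 1"]) auto
    also have "real m * real n * exp (- \<theta> * c) * (\<Sum>k<m. h (Suc k) \<theta>) \<le> real m * real n * exp (- \<theta> * c) * C"
      using sum_le_suminf[OF sm, of "{..<m}"] hn by (intro mult_left_mono) (auto simp: C_def)
    finally show ?thesis by (simp add: mult_ac)
  qed
  with C show ?thesis by blast
qed

text \<open>The probability is recorded as a square, as for the relations below, which consist of two independent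
copies of a relation of probability \<open>\<pi>\<close>.\<close>

definition balanced :: "nat \<Rightarrow> ('a list \<Rightarrow> 'a list \<Rightarrow> bool) \<Rightarrow> real \<Rightarrow> real \<Rightarrow> bool" where
  "balanced L R \<pi> d \<longleftrightarrow> \<pi> > 0 \<and> pair_prob L L R = \<pi>\<^sup>2 \<and>
    (\<forall>x\<in>words L. (\<Sum>y\<in>words L. weight \<mu> y * of_bool (R x y)) \<le> d) \<and>
    (\<forall>y\<in>words L. (\<Sum>x\<in>words L. weight \<mu> x * of_bool (R x y)) \<le> d)"

text \<open>The good block size need not be square. So each block consists of a word of one and a word of the
other length, in one order for \<open>x\<close> and in the opposite order for \<open>y\<close>. Both halves are related by the same regular relation, in the second
half with exchanged roles, so the degrees on both sides are products of one degree of each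
kind.\<close>

lemma symmetric_regular_blocks:
  assumes "\<theta> > 0" "Psi \<theta> > 0"
  shows "\<exists>L l N. L \<ge> 1 \<and> l \<ge> 1 \<and> (\<forall>r\<ge>1. \<exists>R \<pi> d.
    (\<forall>x y. R x y \<longrightarrow> global_hit K g (2 * real r * real l) x y) \<and> balanced (r * L) R \<pi> d \<and>
    exp (- \<theta> * (real r * real l)) \<le> 16 * (real r * real N + 2) ^ 4 * \<pi> \<and>
    d \<le> 16 * (real r * real N + 2) ^ 4 * \<pi>)"
proof -
  obtain m n l where mnl: "m \<ge> 1" "n \<ge> 1" "l \<ge> 1" and blocks: "\<And>r. r \<ge> 1 \<Longrightarrow>
    exp (- \<theta> * (real r * real l)) \<le> pair_prob (r * m) (r * n) (global_hit K g (real r * real l))"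
    using global_hit_blocks[OF assms] by blast
  define N where "N = nat \<lceil>\<theta> * real l / ln 2\<rceil>"
  have N: "\<theta> * real l \<le> real N * ln 2"
  proof -
    have "\<theta> * real l / ln 2 \<le> real N" unfolding N_def by linarith
    then show ?thesis by (simp add: field_simps)
  qed
  have "\<exists>R \<pi> d.
    (\<forall>x y. R x y \<longrightarrow> global_hit K g (2 * real r * real l) x y) \<and> balanced (r * (m + n)) R \<pi> d \<and>
    exp (- \<theta> * (real r * real l)) \<le> 16 * (real r * real N + 2) ^ 4 * \<pi> \<and>
    d \<le> 16 * (real r * real N + 2) ^ 4 * \<pi>" if r: "r \<ge> 1" for r
  proof -
    define m' n' where "m' = r * m" and "n' = r * n"
    define M where "M = global_hit K g (real r * real l)"
    define p where "p = pair_prob m' n' M"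
    have p: "exp (- \<theta> * (real r * real l)) \<le> p" using blocks[OF r] by (simp add: p_def m'_def n'_def M_def)
    then have p0: "p > 0" by (meson exp_gt_zero less_le_trans)
    \<comment> \<open>\<open>T + 1 = r * N + 2\<close>, and \<open>p\<close> is at least the \<open>r * N\<close>-th power of 1/2\<close>
    define T where "T = r * N + 1"
    have "(1/2) ^ (T + 1) = exp (- (real r * (real N * ln 2))) / (4::real)"
      by (simp add: T_def power_divide exp_minus exp_of_nat_mult field_simps power_mult[symmetric] mult.commute)
    also have "\<dots> \<le> exp (- \<theta> * (real r * real l)) / 4"
      using mult_left_mono[OF N, of "real r"] by (simp add: mult_ac)
    finally have T: "(1/2) ^ (T + 1) \<le> p / 4" using p by simp
    have "\<exists>S a b. (\<forall>u v. S u v \<longrightarrow> M u v) \<and> 0 \<le> a \<and> 0 \<le> b \<and>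
      (\<forall>u\<in>words m'. (\<Sum>v\<in>words n'. weight \<mu> v * of_bool (S u v)) \<le> a) \<and>
      (\<forall>v\<in>words n'. (\<Sum>u\<in>words m'. weight \<mu> u * of_bool (S u v)) \<le> b) \<and>
      p \<le> 2 * (real T + 1)\<^sup>2 * pair_prob m' n' S \<and> a * b \<le> 16 * (real T + 1) ^ 4 * pair_prob m' n' S"
      unfolding p_def pair_prob_def
      by (rule regular_subrelation[OF finite_words finite_words weight_nonneg weight_nonneg
        eq_refl[OF sum_weight_words] eq_refl[OF sum_weight_words]
        T[unfolded p_def pair_prob_def] p0[unfolded p_def pair_prob_def]])
    then obtain S a b where S: "\<forall>u v. S u v \<longrightarrow> M u v" "0 \<le> a" "0 \<le> b"
      "\<forall>u\<in>words m'. (\<Sum>v\<in>words n'. weight \<mu> v * of_bool (S u v)) \<le> a"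
      "\<forall>v\<in>words n'. (\<Sum>u\<in>words m'. weight \<mu> u * of_bool (S u v)) \<le> b"
      "p \<le> 2 * (real T + 1)\<^sup>2 * pair_prob m' n' S" "a * b \<le> 16 * (real T + 1) ^ 4 * pair_prob m' n' S"
      by blast
    define \<pi> where "\<pi> = pair_prob m' n' S"
    define R where "R x y \<longleftrightarrow> S (take m' x) (take n' y) \<and> S (drop n' y) (drop m' x)" for x y
    have len: "r * (m + n) = m' + n'" "r * (m + n) = n' + m'" by (auto simp: m'_def n'_def algebra_simps)
    have hit: "global_hit K g (2 * real r * real l) x y" if "R x y" for x y
    proof -
      have "M (take m' x) (take n' y)" "M (drop n' y) (drop m' x)"
        using that S(1) by (auto simp: R_def)
      from global_hit_append[OF this(1)[unfolded M_def] global_hit_swap[OF K_sym this(2)[unfolded M_def]]]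
      show ?thesis by (simp add: mult_ac)
    qed
    have prob: "pair_prob (m' + n') (n' + m') R = \<pi>\<^sup>2"
    proof -
      have "pair_prob (m' + n') (n' + m') R = pair_prob m' n' S * pair_prob n' m' (\<lambda>u v. S v u)"
        by (rule pair_prob_product) (auto simp: R_def words_def)
      also have "pair_prob n' m' (\<lambda>u v. S v u) = \<pi>"
        unfolding pair_prob_def \<pi>_def by (subst sum.swap) (simp add: mult_ac)
      finally show ?thesis by (simp add: \<pi>_def power2_eq_square)
    qed
    have deg1: "(\<Sum>y\<in>words (n' + m'). weight \<mu> y * of_bool (R x y)) \<le> a * b" if "x \<in> words (m' + n')" for x
    proof -
      have tx: "take m' x \<in> words m'" "drop m' x \<in> words n'" using that by (auto simp: words_def)
      have "(\<Sum>y\<in>words (n' + m'). weight \<mu> y * of_bool (R x y))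
        = (\<Sum>v\<in>words n'. \<Sum>v'\<in>words m'. (weight \<mu> v * of_bool (S (take m' x) v)) * (weight \<mu> v' * of_bool (S v' (drop m' x))))"
        unfolding sum_words_append by (intro sum.cong refl) (auto simp: R_def words_def weight_append)
      also have "\<dots> = (\<Sum>v\<in>words n'. weight \<mu> v * of_bool (S (take m' x) v)) * (\<Sum>v'\<in>words m'. weight \<mu> v' * of_bool (S v' (drop m' x)))"
        unfolding sum_product ..
      also have "\<dots> \<le> a * b" by (intro mult_mono S(2,3) S(4,5)[rule_format] tx sum_nonneg) auto
      finally show ?thesis .
    qed
    have deg2: "(\<Sum>x\<in>words (m' + n'). weight \<mu> x * of_bool (R x y)) \<le> a * b" if "y \<in> words (n' + m')" for y
    proof -
      have ty: "take n' y \<in> words n'" "drop n' y \<in> words m'" using that by (auto simp: words_def)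
      have "(\<Sum>x\<in>words (m' + n'). weight \<mu> x * of_bool (R x y))
        = (\<Sum>u\<in>words m'. \<Sum>u'\<in>words n'. (weight \<mu> u * of_bool (S u (take n' y))) * (weight \<mu> u' * of_bool (S (drop n' y) u')))"
        unfolding sum_words_append by (intro sum.cong refl) (auto simp: R_def words_def weight_append)
      also have "\<dots> = (\<Sum>u\<in>words m'. weight \<mu> u * of_bool (S u (take n' y))) * (\<Sum>u'\<in>words n'. weight \<mu> u' * of_bool (S (drop n' y) u'))"
        unfolding sum_product ..
      also have "\<dots> \<le> b * a" by (intro mult_mono S(2,3) S(4,5)[rule_format] ty sum_nonneg) auto
      finally show ?thesis by (simp add: mult.commute)
    qed
    have Q: "real T + 1 = real r * real N + 2" by (simp add: T_def)
    have \<pi>0: "\<pi> > 0"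
    proof -
      have "0 < 2 * (real T + 1)\<^sup>2 * \<pi>" using S(6) p0 unfolding \<pi>_def by linarith
      then show ?thesis by (simp add: zero_less_mult_iff)
    qed
    have "exp (- \<theta> * (real r * real l)) \<le> 2 * (real T + 1)\<^sup>2 * \<pi>" using p S(6) by (simp add: \<pi>_def)
    also have "\<dots> \<le> 16 * (real T + 1) ^ 4 * \<pi>"
    proof (rule mult_right_mono)
      have "(real T + 1)\<^sup>2 \<le> (real T + 1) ^ 4" by (rule power_increasing) auto
      then show "2 * (real T + 1)\<^sup>2 \<le> 16 * (real T + 1) ^ 4" using zero_le_power2[of "real T + 1"] by linarith
    qed (use \<pi>0 in simp)
    finally have e1: "exp (- \<theta> * (real r * real l)) \<le> 16 * (real r * real N + 2) ^ 4 * \<pi>" unfolding Q .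
    have e2: "a * b \<le> 16 * (real r * real N + 2) ^ 4 * \<pi>" using S(7) unfolding Q \<pi>_def .
    have nm: "n' + m' = m' + n'" by simp
    show ?thesis
      unfolding len(1) balanced_def
      by (intro exI[of _ R] exI[of _ \<pi>] exI[of _ "a * b"] conjI allI impI ballI hit \<pi>0
          prob[unfolded nm] deg1[unfolded nm] deg2[unfolded nm] e1 e2)
  qed
  note main = this
  show ?thesis
  proof (rule exI[of _ "m + n"], rule exI[of _ l], rule exI[of _ N], intro conjI)
    show "1 \<le> m + n" "1 \<le> l" using mnl by auto
  qed (intro allI impI, rule main)
qed

end

section \<open>Laws of random words\<close>

lemma (in prob_space) finite_range_prob:
  assumes S: "finite S" "\<And>\<omega>. \<omega> \<in> space M \<Longrightarrow> Z \<omega> \<in> S"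
    and Z: "\<And>z. z \<in> S \<Longrightarrow> {\<omega> \<in> space M. Z \<omega> = z} \<in> events"
  shows "{\<omega> \<in> space M. Q (Z \<omega>)} \<in> events"
    and "prob {\<omega> \<in> space M. Q (Z \<omega>)} = (\<Sum>z\<in>S. prob {\<omega> \<in> space M. Z \<omega> = z} * of_bool (Q z))"
proof -
  have e: "{\<omega> \<in> space M. Q (Z \<omega>)} = (\<Union>z\<in>{z \<in> S. Q z}. {\<omega> \<in> space M. Z \<omega> = z})"
    using S by auto
  show "{\<omega> \<in> space M. Q (Z \<omega>)} \<in> events"
    unfolding e using S Z by (intro sets.finite_UN) auto
  have "prob {\<omega> \<in> space M. Q (Z \<omega>)} = (\<Sum>z\<in>{z \<in> S. Q z}. prob {\<omega> \<in> space M. Z \<omega> = z})"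
    unfolding e using S Z by (intro finite_measure_finite_Union) (auto simp: disjoint_family_on_def)
  also have "\<dots> = (\<Sum>z\<in>S. prob {\<omega> \<in> space M. Z \<omega> = z} * of_bool (Q z))"
    using S by (simp add: Int_def)
  finally show "prob {\<omega> \<in> space M. Q (Z \<omega>)} = (\<Sum>z\<in>S. prob {\<omega> \<in> space M. Z \<omega> = z} * of_bool (Q z))" .
qed

lemma (in prob_space) finite_range_integral:
  fixes F :: "'c \<Rightarrow> real"
  assumes S: "finite S" "\<And>\<omega>. \<omega> \<in> space M \<Longrightarrow> Z \<omega> \<in> S"
    and Z: "\<And>z. z \<in> S \<Longrightarrow> {\<omega> \<in> space M. Z \<omega> = z} \<in> events"
  shows "integrable M (\<lambda>\<omega>. F (Z \<omega>))"
    and "(\<integral>\<omega>. F (Z \<omega>) \<partial>M) = (\<Sum>z\<in>S. prob {\<omega> \<in> space M. Z \<omega> = z} * F z)"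
proof -
  have e: "F (Z \<omega>) = (\<Sum>z\<in>S. indicator {\<omega> \<in> space M. Z \<omega> = z} \<omega> * F z)" if "\<omega> \<in> space M" for \<omega>
  proof -
    have "(\<Sum>z\<in>S. indicator {\<omega> \<in> space M. Z \<omega> = z} \<omega> * F z) = (\<Sum>z\<in>S. if z = Z \<omega> then F z else 0)"
      using that by (intro sum.cong) auto
    also have "\<dots> = F (Z \<omega>)" using S that by (subst sum.delta) auto
    finally show ?thesis by simp
  qed
  have i: "integrable M (\<lambda>\<omega>. \<Sum>z\<in>S. indicator {\<omega> \<in> space M. Z \<omega> = z} \<omega> * F z)"
    using Z by (intro Bochner_Integration.integrable_sum) (auto intro!: integrable_mult_left simp: emeasure_eq_measure)
  show "integrable M (\<lambda>\<omega>. F (Z \<omega>))"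
    using i by (subst Bochner_Integration.integrable_cong[OF refl e]) auto
  have "(\<integral>\<omega>. F (Z \<omega>) \<partial>M) = (\<integral>\<omega>. (\<Sum>z\<in>S. indicator {\<omega> \<in> space M. Z \<omega> = z} \<omega> * F z) \<partial>M)"
    by (rule Bochner_Integration.integral_cong[OF refl e])
  also have "\<dots> = (\<Sum>z\<in>S. (\<integral>\<omega>. indicator {\<omega> \<in> space M. Z \<omega> = z} \<omega> * F z \<partial>M))"
    using Z by (intro Bochner_Integration.integral_sum) (auto intro!: integrable_mult_left simp: emeasure_eq_measure)
  also have "\<dots> = (\<Sum>z\<in>S. prob {\<omega> \<in> space M. Z \<omega> = z} * F z)"
    using Z by (intro sum.cong) auto
  finally show "(\<integral>\<omega>. F (Z \<omega>) \<partial>M) = (\<Sum>z\<in>S. prob {\<omega> \<in> space M. Z \<omega> = z} * F z)" .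
qed

text \<open>Chebyshev's inequality for the number of events that occur. There are \<open>N\<^sup>4\<close> pairs of events, of which at
most \<open>2 * N\<^sup>3\<close> share a row or a column and \<open>N\<^sup>2\<close> are equal.\<close>

lemma (in prob_space) second_moment_bound:
  fixes A :: "nat \<Rightarrow> nat \<Rightarrow> 'a set"
  assumes A: "\<And>a b. a < N \<Longrightarrow> b < N \<Longrightarrow> A a b \<in> events" "\<And>a b. a < N \<Longrightarrow> b < N \<Longrightarrow> prob (A a b) = q"
    and row: "\<And>a b b'. a < N \<Longrightarrow> b < N \<Longrightarrow> b' < N \<Longrightarrow> b \<noteq> b' \<Longrightarrow> prob (A a b \<inter> A a b') \<le> q * d"
    and col: "\<And>a a' b. a < N \<Longrightarrow> a' < N \<Longrightarrow> b < N \<Longrightarrow> a \<noteq> a' \<Longrightarrow> prob (A a b \<inter> A a' b) \<le> q * d"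
    and indep: "\<And>a a' b b'. a < N \<Longrightarrow> a' < N \<Longrightarrow> b < N \<Longrightarrow> b' < N \<Longrightarrow> a \<noteq> a' \<Longrightarrow> b \<noteq> b' \<Longrightarrow>
      prob (A a b \<inter> A a' b') \<le> q * q"
    and "q > 0" "N \<ge> 1" "d \<ge> 0"
  shows "prob {\<omega> \<in> space M. \<forall>a<N. \<forall>b<N. \<omega> \<notin> A a b} \<le> 1 / ((real N)\<^sup>2 * q) + 2 * d / (real N * q)"
proof -
  define P where "P = {..<N} \<times> {..<N}"
  define B where "B p = A (fst p) (snd p)" for p
  define W :: "'a \<Rightarrow> real" where "W \<omega> = (\<Sum>p\<in>P. indicator (B p) \<omega>)" for \<omega>
  \<comment> \<open>the expected number of events that occur\<close>
  define c where "c = (real N)\<^sup>2 * q"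
  define E where "E = {\<omega> \<in> space M. \<forall>a<N. \<forall>b<N. \<omega> \<notin> A a b}"
  have qd: "0 \<le> q * q" "0 \<le> q * d" "0 \<le> d * q" "0 \<le> q" using \<open>q > 0\<close> \<open>d \<ge> 0\<close> by auto
  have finP: "finite P" by (simp add: P_def)
  have cardP: "real (card P) = (real N)\<^sup>2" by (simp add: P_def power2_eq_square)
  have B: "B p \<in> events" "prob (B p) = q" if "p \<in> P" for p using that A by (auto simp: P_def B_def)
  have c: "c > 0" using assms by (simp add: c_def)
  have E: "E \<in> events"
  proof -
    have "E = space M - (\<Union>p\<in>P. B p)" by (auto simp: E_def P_def B_def)
    then show ?thesis using B finP by auto
  qed
  have intB: "integrable M (indicator (B p \<inter> B p') :: 'a \<Rightarrow> real)" if "p \<in> P" "p' \<in> P" for p p'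
    using B that by (auto simp: emeasure_eq_measure)
  have W1: "integrable M W" "(\<integral>\<omega>. W \<omega> \<partial>M) = c"
  proof -
    show "integrable M W" unfolding W_def using B by (auto simp: emeasure_eq_measure)
    have "(\<integral>\<omega>. W \<omega> \<partial>M) = (\<Sum>p\<in>P. prob (B p))"
      unfolding W_def using B by (subst Bochner_Integration.integral_sum) (auto simp: emeasure_eq_measure)
    then show "(\<integral>\<omega>. W \<omega> \<partial>M) = c" using B cardP by (simp add: c_def)
  qed
  have Wsq: "(W \<omega>)\<^sup>2 = (\<Sum>p\<in>P. \<Sum>p'\<in>P. indicator (B p \<inter> B p') \<omega>)" for \<omega>
    by (simp add: W_def power2_eq_square sum_product indicator_inter_arith)
  have W2: "integrable M (\<lambda>\<omega>. (W \<omega>)\<^sup>2)" "(\<integral>\<omega>. (W \<omega>)\<^sup>2 \<partial>M) = (\<Sum>p\<in>P. \<Sum>p'\<in>P. prob (B p \<inter> B p'))"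
  proof -
    show "integrable M (\<lambda>\<omega>. (W \<omega>)\<^sup>2)"
      unfolding Wsq by (intro Bochner_Integration.integrable_sum intB)
    have "(\<integral>\<omega>. (W \<omega>)\<^sup>2 \<partial>M) = (\<Sum>p\<in>P. (\<integral>\<omega>. (\<Sum>p'\<in>P. indicator (B p \<inter> B p') \<omega>) \<partial>M))"
      unfolding Wsq by (intro Bochner_Integration.integral_sum Bochner_Integration.integrable_sum intB)
    also have "\<dots> = (\<Sum>p\<in>P. \<Sum>p'\<in>P. (\<integral>\<omega>. indicator (B p \<inter> B p') \<omega> \<partial>M))"
      by (intro sum.cong refl Bochner_Integration.integral_sum intB)
    also have "\<dots> = (\<Sum>p\<in>P. \<Sum>p'\<in>P. prob (B p \<inter> B p'))"
      using B by (intro sum.cong refl) auto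
    finally show "(\<integral>\<omega>. (W \<omega>)\<^sup>2 \<partial>M) = (\<Sum>p\<in>P. \<Sum>p'\<in>P. prob (B p \<inter> B p'))" .
  qed
  have "(\<Sum>p\<in>P. \<Sum>p'\<in>P. prob (B p \<inter> B p')) \<le> (\<Sum>p\<in>P. \<Sum>p'\<in>P. q * q + of_bool (fst p = fst p') * (q * d)
      + of_bool (snd p = snd p') * (q * d) + of_bool (p = p') * q)"
  proof (intro sum_mono)
    fix p p' assume pp: "p \<in> P" "p' \<in> P"
    obtain a b a' b' where e: "p = (a, b)" "p' = (a', b')" by (metis surj_pair)
    have l: "a < N" "b < N" "a' < N" "b' < N" using pp by (auto simp: e P_def)
    consider "a = a'" "b = b'" | "a = a'" "b \<noteq> b'" | "a \<noteq> a'" "b = b'" | "a \<noteq> a'" "b \<noteq> b'" by blast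
    then show "prob (B p \<inter> B p') \<le> q * q + of_bool (fst p = fst p') * (q * d)
      + of_bool (snd p = snd p') * (q * d) + of_bool (p = p') * q"
    proof cases
      case 1
      then show ?thesis using A(2)[of a b] l qd by (simp add: e B_def)
    next
      case 2
      then show ?thesis using row[of a b b'] l qd by (simp add: e B_def add_increasing)
    next
      case 3
      then show ?thesis using col[of a a' b] l qd by (simp add: e B_def add_increasing)
    next
      case 4
      then show ?thesis using indep[of a a' b b'] l by (simp add: e B_def)
    qed
  qed
  also have "\<dots> = (\<Sum>p\<in>P. (real N)\<^sup>2 * (q * q) + real N * (q * d) + real N * (q * d) + q)"
  proof (rule sum.cong[OF refl])
    fix p assume p: "p \<in> P"
    have 1: "(\<Sum>p'\<in>P. of_bool (fst p = fst p') * (q * d)) = real N * (q * d)"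
    proof -
      have "P \<inter> {p'. fst p = fst p'} = {fst p} \<times> {..<N}" using p by (auto simp: P_def)
      then show ?thesis using finP by (simp add: card_cartesian_product)
    qed
    have 2: "(\<Sum>p'\<in>P. of_bool (snd p = snd p') * (q * d)) = real N * (q * d)"
    proof -
      have "P \<inter> {p'. snd p = snd p'} = {..<N} \<times> {snd p}" using p by (auto simp: P_def)
      then show ?thesis using finP by (simp add: card_cartesian_product)
    qed
    have 3: "(\<Sum>p'\<in>P. of_bool (p = p') * q) = q"
    proof -
      have "P \<inter> {p'. p = p'} = {p}" using p by auto
      then show ?thesis using finP by simp
    qed
    show "(\<Sum>p'\<in>P. q * q + of_bool (fst p = fst p') * (q * d)
      + of_bool (snd p = snd p') * (q * d) + of_bool (p = p') * q)
      = (real N)\<^sup>2 * (q * q) + real N * (q * d) + real N * (q * d) + q"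
      unfolding sum.distrib 1 2 3 by (simp add: cardP)
  qed
  also have "\<dots> = c\<^sup>2 + 2 * real N ^ 3 * q * d + c"
    by (simp add: cardP c_def power2_eq_square power3_eq_cube algebra_simps)
  finally have EW2: "(\<integral>\<omega>. (W \<omega>)\<^sup>2 \<partial>M) \<le> c\<^sup>2 + 2 * real N ^ 3 * q * d + c" using W2 by simp
  have sq: "(W \<omega> - c)\<^sup>2 = (W \<omega>)\<^sup>2 - 2 * c * W \<omega> + c\<^sup>2" for \<omega> by (simp add: power2_diff)
  have "c\<^sup>2 * prob E = (\<integral>\<omega>. c\<^sup>2 * indicator E \<omega> \<partial>M)" using E by simp
  also have "\<dots> \<le> (\<integral>\<omega>. (W \<omega> - c)\<^sup>2 \<partial>M)"
  proof (rule integral_mono)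
    show "integrable M (\<lambda>\<omega>. c\<^sup>2 * indicator E \<omega>)" using E by (auto simp: emeasure_eq_measure)
    show "integrable M (\<lambda>\<omega>. (W \<omega> - c)\<^sup>2)" unfolding sq using W1 W2 by auto
    fix \<omega> assume "\<omega> \<in> space M"
    show "c\<^sup>2 * indicator E \<omega> \<le> (W \<omega> - c)\<^sup>2"
    proof (cases "\<omega> \<in> E")
      case True
      then have "W \<omega> = 0" by (auto simp: W_def E_def P_def B_def intro!: sum.neutral)
      then show ?thesis by (simp add: True)
    qed simp
  qed
  also have "\<dots> = (\<integral>\<omega>. (W \<omega>)\<^sup>2 \<partial>M) - 2 * c * c + c\<^sup>2"
    unfolding sq using W1 W2 by (simp add: prob_space)
  also have "\<dots> \<le> 2 * real N ^ 3 * q * d + c" using EW2 by (simp add: power2_eq_square)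
  finally have "prob E \<le> (2 * real N ^ 3 * q * d + c) / c\<^sup>2"
    using c by (simp add: pos_le_divide_eq mult.commute)
  also have "\<dots> = 1 / ((real N)\<^sup>2 * q) + 2 * d / (real N * q)"
    using assms(6,7) by (simp add: c_def field_simps power2_eq_square power3_eq_cube)
  finally show ?thesis by (simp add: E_def)
qed

locale random_words = prob_space M for M :: "'b measure" +
  fixes X Y :: "nat \<Rightarrow> 'b \<Rightarrow> 'a::finite" and \<mu> :: "'a pmf"
  assumes letters_indep: "indep_vars (\<lambda>_. count_space UNIV) (case_sum X Y) ({1..} <+> {1..})"
    and X_law: "\<And>i. i \<ge> 1 \<Longrightarrow> distr M (count_space UNIV) (X i) = measure_pmf \<mu>"
    and Y_law: "\<And>j. j \<ge> 1 \<Longrightarrow> distr M (count_space UNIV) (Y j) = measure_pmf \<mu>"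
begin

abbreviation "letter \<equiv> case_sum X Y"
abbreviation "positions \<equiv> {1::nat..} <+> {1::nat..}"

lemma letter_measurable: "i \<in> positions \<Longrightarrow> letter i \<in> measurable M (count_space UNIV)"
  using letters_indep by (auto simp: indep_vars_def)

lemma letter_prob:
  assumes "i \<in> positions"
  shows "prob (letter i -` {a} \<inter> space M) = pmf \<mu> a"
proof -
  have "measure (distr M (count_space UNIV) (letter i)) {a} = prob (letter i -` {a} \<inter> space M)"
    by (rule measure_distr[OF letter_measurable[OF assms]]) simp
  moreover have "distr M (count_space UNIV) (letter i) = measure_pmf \<mu>"
    using assms X_law Y_law by auto
  ultimately show ?thesis by (simp add: pmf.rep_eq)
qed

text \<open>Words read off at disjoint sets of positions are independent. The positions of the \<open>k\<close>-th word are
given by \<open>pos k\<close>, and injectivity in both arguments expresses disjointness.\<close>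

lemma words_prob:
  fixes w :: "'k \<Rightarrow> 'a list" and pos :: "'k \<Rightarrow> nat \<Rightarrow> nat + nat"
  assumes J: "finite J"
    and inj: "inj_on (\<lambda>(k, t). pos k t) (SIGMA k:J. {..<length (w k)})"
    and pos: "\<And>k t. k \<in> J \<Longrightarrow> t < length (w k) \<Longrightarrow> pos k t \<in> positions"
  shows "{\<omega> \<in> space M. \<forall>k\<in>J. \<forall>t<length (w k). letter (pos k t) \<omega> = w k ! t} \<in> events"
    and "prob {\<omega> \<in> space M. \<forall>k\<in>J. \<forall>t<length (w k). letter (pos k t) \<omega> = w k ! t} = (\<Prod>k\<in>J. weight \<mu> (w k))"
proof -
  let ?E = "{\<omega> \<in> space M. \<forall>k\<in>J. \<forall>t<length (w k). letter (pos k t) \<omega> = w k ! t}"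
  define S where "S = (SIGMA k:J. {..<length (w k)})"
  define p where "p = (\<lambda>(k, t). pos k t)"
  define f where "f i = (case inv_into S p i of (k, t) \<Rightarrow> w k ! t)" for i
  have finS: "finite S" using J by (simp add: S_def)
  have injp: "inj_on p S" using inj by (simp add: p_def S_def)
  have f: "f (pos k t) = w k ! t" if "k \<in> J" "t < length (w k)" for k t
    using inv_into_f_f[OF injp, of "(k, t)"] that by (simp add: f_def S_def p_def)
  have sub: "p ` S \<subseteq> positions" using pos by (auto simp: S_def p_def)
  have "?E = {\<omega> \<in> space M. \<forall>i\<in>p ` S. letter i \<omega> = f i}"
    using f by (auto simp: S_def p_def)
  moreover have "\<dots> = (if S = {} then space M else (\<Inter>i\<in>p ` S. letter i -` {f i} \<inter> space M))"
    by auto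
  ultimately have E: "?E = (if S = {} then space M else (\<Inter>i\<in>p ` S. letter i -` {f i} \<inter> space M))" by simp
  have ev: "letter i -` {f i} \<inter> space M \<in> events" if "i \<in> p ` S" for i
    using measurable_sets[OF letter_measurable, of i "{f i}"] sub that by auto
  show "?E \<in> events"
  proof (cases "S = {}")
    case False
    then have "(\<Inter>i\<in>p ` S. letter i -` {f i} \<inter> space M) \<in> events"
      using finS ev by (intro sets.finite_INT) (simp_all del: image_eqI)
    then show ?thesis unfolding E using False by simp
  qed (simp add: E)
  have "prob ?E = (\<Prod>i\<in>p ` S. pmf \<mu> (f i))"
  proof (cases "S = {}")
    case True
    then show ?thesis unfolding E by (simp add: prob_space)
  next
    case False
    then have "prob ?E = (\<Prod>i\<in>p ` S. prob (letter i -` {f i} \<inter> space M))"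
      unfolding E using indep_varsD[OF letters_indep, of "p ` S" "\<lambda>i. {f i}"] finS sub by simp
    also have "\<dots> = (\<Prod>i\<in>p ` S. pmf \<mu> (f i))"
      using sub by (intro prod.cong refl letter_prob) auto
    finally show ?thesis .
  qed
  also have "\<dots> = (\<Prod>q\<in>S. pmf \<mu> (f (p q)))" by (simp add: prod.reindex[OF injp])
  also have "\<dots> = (\<Prod>(k, t)\<in>S. pmf \<mu> (w k ! t))"
    by (intro prod.cong refl) (auto simp: S_def p_def f)
  also have "\<dots> = (\<Prod>k\<in>J. weight \<mu> (w k))"
    unfolding S_def using J by (subst prod.Sigma[symmetric]) (auto simp: weight_nth)
  finally show "prob ?E = (\<Prod>k\<in>J. weight \<mu> (w k))" .
qed

definition initial_words :: "nat \<Rightarrow> nat \<Rightarrow> 'b \<Rightarrow> 'a list \<times> 'a list" where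
  "initial_words m n \<omega> = (segment (\<lambda>i. X i \<omega>) 1 m, segment (\<lambda>j. Y j \<omega>) 1 n)"

lemma segment_eq_iff:
  "segment x i m = w \<longleftrightarrow> length w = Suc m - i \<and> (\<forall>t<length w. x (i + t) = w ! t)"
  by (auto simp: list_eq_iff_nth_eq segment_def nth_upt simp del: upt_Suc)

lemma initial_words_mem: "initial_words m n \<omega> \<in> words m \<times> words n"
  by (simp add: initial_words_def words_def)

lemma initial_words_prob:
  assumes "p \<in> words m \<times> words n"
  shows "{\<omega> \<in> space M. initial_words m n \<omega> = p} \<in> events"
    and "prob {\<omega> \<in> space M. initial_words m n \<omega> = p} = weight \<mu> (fst p) * weight \<mu> (snd p)"
proof -
  define w where "w k = (if k then fst p else snd p)" for k
  define pos where "pos k t = (if k then Inl (1 + t) else Inr (1 + t) :: nat + nat)" for k t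
  have inj: "inj_on (\<lambda>(k, t). pos k t) (SIGMA k:UNIV. {..<length (w k)})"
    by (auto simp: inj_on_def pos_def split: if_splits)
  have pos: "pos k t \<in> positions" for k t by (cases k) (auto simp: pos_def)
  have eq: "{\<omega> \<in> space M. initial_words m n \<omega> = p}
    = {\<omega> \<in> space M. \<forall>k\<in>UNIV. \<forall>t<length (w k). letter (pos k t) \<omega> = w k ! t}"
    using assms
    by (auto simp: initial_words_def prod_eq_iff segment_eq_iff words_def UNIV_bool w_def pos_def)
  show "{\<omega> \<in> space M. initial_words m n \<omega> = p} \<in> events"
    unfolding eq by (rule words_prob(1)[OF finite inj pos])
  have "prob {\<omega> \<in> space M. initial_words m n \<omega> = p} = (\<Prod>k\<in>UNIV. weight \<mu> (w k))"
    unfolding eq by (rule words_prob(2)[OF finite inj pos])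
  then show "prob {\<omega> \<in> space M. initial_words m n \<omega> = p} = weight \<mu> (fst p) * weight \<mu> (snd p)"
    by (simp add: UNIV_bool w_def mult.commute)
qed

text \<open>Blocks of length \<open>L\<close> of both sequences; \<open>Inl\<close> numbers those of \<open>X\<close> and \<open>Inr\<close> those of \<open>Y\<close>.\<close>

definition block :: "nat \<Rightarrow> nat + nat \<Rightarrow> 'b \<Rightarrow> 'a list" where
  "block L k \<omega> = (case k of Inl a \<Rightarrow> segment (\<lambda>i. X i \<omega>) (Suc (a * L)) (a * L + L)
                  | Inr b \<Rightarrow> segment (\<lambda>j. Y j \<omega>) (Suc (b * L)) (b * L + L))"

lemma block_words: "block L k \<omega> \<in> words L"
  by (auto simp: block_def words_def split: sum.splits)

lemma blocks_prob:
  assumes "finite J" "\<And>k. k \<in> J \<Longrightarrow> w k \<in> words L"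
  shows "{\<omega> \<in> space M. \<forall>k\<in>J. block L k \<omega> = w k} \<in> events"
    and "prob {\<omega> \<in> space M. \<forall>k\<in>J. block L k \<omega> = w k} = (\<Prod>k\<in>J. weight \<mu> (w k))"
proof -
  define pos :: "nat + nat \<Rightarrow> nat \<Rightarrow> nat + nat" where
    "pos k t = map_sum (\<lambda>a. Suc (a * L) + t) (\<lambda>b. Suc (b * L) + t) k" for k t
  have eq: "a = a' \<and> t = t'" if "a * L + t = a' * L + t'" "t < L" "t' < L" for a a' t t' :: nat
  proof -
    have "(a * L + t) div L = a" "(a' * L + t') div L = a'" using that(2,3) by auto
    then have "a = a'" using that(1) by simp
    with that(1) show ?thesis by simp
  qed
  have inj: "inj_on (\<lambda>(k, t). pos k t) (SIGMA k:J. {..<length (w k)})"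
  proof (rule inj_onI)
    fix p p'
    assume p: "p \<in> (SIGMA k:J. {..<length (w k)})" "p' \<in> (SIGMA k:J. {..<length (w k)})"
      "(\<lambda>(k, t). pos k t) p = (\<lambda>(k, t). pos k t) p'"
    obtain k t k' t' where e: "p = (k, t)" "p' = (k', t')" by (metis surj_pair)
    with p have *: "k \<in> J" "t \<in> {..<length (w k)}" "k' \<in> J" "t' \<in> {..<length (w k')}" "pos k t = pos k' t'"
      by auto
    then have t: "t < L" "t' < L" using assms(2)[of k] assms(2)[of k'] by (auto simp: words_def)
    have "k = k' \<and> t = t'"
    proof (cases k)
      case (Inl a)
      with *(5) obtain a' where "k' = Inl a'" "a * L + t = a' * L + t'"
        by (cases k') (auto simp: pos_def)
      with Inl eq[OF this(2) t] show ?thesis by simp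
    next
      case (Inr a)
      with *(5) obtain a' where "k' = Inr a'" "a * L + t = a' * L + t'"
        by (cases k') (auto simp: pos_def)
      with Inr eq[OF this(2) t] show ?thesis by simp
    qed
    then show "p = p'" by (simp add: e)
  qed
  have pos: "pos k t \<in> positions" for k t by (cases k) (auto simp: pos_def)
  have bl: "block L k \<omega> = w k \<longleftrightarrow> (\<forall>t<length (w k). letter (pos k t) \<omega> = w k ! t)" if "k \<in> J" for k \<omega>
    using assms(2)[OF that] by (cases k) (simp_all add: block_def segment_eq_iff words_def pos_def)
  have eq: "{\<omega> \<in> space M. \<forall>k\<in>J. block L k \<omega> = w k}
    = {\<omega> \<in> space M. \<forall>k\<in>J. \<forall>t<length (w k). letter (pos k t) \<omega> = w k ! t}"
    by (intro Collect_cong conj_cong refl ball_cong bl)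
  show "{\<omega> \<in> space M. \<forall>k\<in>J. block L k \<omega> = w k} \<in> events"
    unfolding eq by (rule words_prob(1)[OF assms(1) inj pos])
  show "prob {\<omega> \<in> space M. \<forall>k\<in>J. block L k \<omega> = w k} = (\<Prod>k\<in>J. weight \<mu> (w k))"
    unfolding eq by (rule words_prob(2)[OF assms(1) inj pos])
qed

end

section \<open>From words to the letters\<close>

lemma ennreal_infsum:
  fixes f :: "'c \<Rightarrow> real"
  assumes "f summable_on A" "\<And>x. x \<in> A \<Longrightarrow> 0 \<le> f x"
  shows "infsum (\<lambda>x. ennreal (f x)) A = ennreal (infsum f A)"
proof -
  have "infsum (\<lambda>x. ennreal (f x)) A = (SUP F\<in>{F. finite F \<and> F \<subseteq> A}. sum (\<lambda>x. ennreal (f x)) F)"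
    by (rule nonneg_infsum_complete) simp
  also have "\<dots> = (SUP F\<in>{F. finite F \<and> F \<subseteq> A}. ennreal (sum f F))"
    using assms(2) by (intro SUP_cong refl sum_ennreal) auto
  finally show ?thesis by (simp add: infsum_nonneg_is_SUPREMUM_ennreal[OF assms])
qed

lemma local_score_mono:
  assumes "m \<le> m'" "n \<le> n'"
  shows "local_score K g x y m n \<le> local_score K g x y m' n'"
  unfolding local_score_def using assms
  by (intro SUP_mono) (auto simp: align_score_pair_score)

lemma polynomial_exp_eventually:
  fixes C e b :: real
  assumes "e > 0" "C > 0" "b \<ge> 0"
  shows "eventually (\<lambda>r::nat. C * (real r * b + 2) ^ 8 * exp (- e * real r) \<le> exp (- (e / 2) * real r)) sequentially"
proof (cases "b = 0")
  case True
  then show ?thesis using assms apply simp by real_asymp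
next
  case False
  then have "b > 0" using assms by simp
  then show ?thesis using assms by real_asymp
qed

lemma ln_less_linear_eventually:
  fixes e A B L :: real
  assumes "e > 0" "L > 0" "A > 0" "B > 0"
  shows "eventually (\<lambda>r::nat. B + A * ln ((real r + 1) * L) < e * real r) sequentially"
  using assms by real_asymp

lemma sum_PiE_insert:
  assumes "i \<notin> J"
  shows "sum F (insert i J \<rightarrow>\<^sub>E W) = (\<Sum>x\<in>W. \<Sum>f\<in>J \<rightarrow>\<^sub>E W. F (f(i := x)))"
proof -
  have inj: "inj_on (\<lambda>(y, g). g(i := y)) (W \<times> (J \<rightarrow>\<^sub>E W))"
    by (rule inj_combinator[OF assms])
  show ?thesis
    unfolding PiE_insert_eq sum.reindex[OF inj] by (simp add: sum.cartesian_product case_prod_unfold)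
qed

text \<open>Interpolates between the lengths of a subsequence along which an almost sure bound is known.\<close>

lemma bracketing_index:
  fixes a :: "nat \<Rightarrow> nat"
  assumes "\<And>r. r \<le> a r" "a r0 \<le> n"
  shows "\<exists>r\<ge>r0. a r \<le> n \<and> n < a (Suc r)"
proof -
  define r where "r = Max {r. a r \<le> n}"
  have fin: "finite {r. a r \<le> n}"
    by (rule finite_subset[of _ "{..n}"]) (use assms(1) in \<open>auto intro: order_trans\<close>)
  have "r \<in> {r. a r \<le> n}" unfolding r_def using assms(2) by (intro Max_in fin) auto
  moreover have "r0 \<le> r" unfolding r_def using assms(2) by (intro Max_ge fin) auto
  moreover have "Suc r \<notin> {r. a r \<le> n}" using Max_ge[OF fin, of "Suc r"] unfolding r_def by fastforce
  ultimately show ?thesis by (auto simp: not_le)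
qed

locale random_scoring = random_words M X Y \<mu> + scoring \<mu> K g
  for M :: "'b measure" and X Y :: "nat \<Rightarrow> 'b \<Rightarrow> 'a::finite" and \<mu> :: "'a pmf"
    and K :: "'a \<Rightarrow> 'a \<Rightarrow> real" and g :: "nat \<Rightarrow> real"
begin

abbreviation "xs m \<omega> \<equiv> segment (\<lambda>i. X i \<omega>) 1 m"
abbreviation "ys n \<omega> \<equiv> segment (\<lambda>j. Y j \<omega>) 1 n"
abbreviation "score \<omega> m n \<equiv> local_score K g (\<lambda>i. X i \<omega>) (\<lambda>j. Y j \<omega>) m n"

lemma pair_event:
  "{\<omega> \<in> space M. Q (xs m \<omega>) (ys n \<omega>)} \<in> events"
  "prob {\<omega> \<in> space M. Q (xs m \<omega>) (ys n \<omega>)} = pair_prob m n Q"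
proof -
  let ?Q = "\<lambda>p. Q (fst p) (snd p)"
  note * = finite_range_prob[of "words m \<times> words n" "initial_words m n" ?Q,
      OF _ initial_words_mem initial_words_prob(1)]
  have e: "{\<omega> \<in> space M. Q (xs m \<omega>) (ys n \<omega>)}
    = {\<omega> \<in> space M. ?Q (initial_words m n \<omega>)}"
    by (simp add: initial_words_def)
  show "{\<omega> \<in> space M. Q (xs m \<omega>) (ys n \<omega>)} \<in> events"
    unfolding e by (rule *(1)) auto
  have "prob {\<omega> \<in> space M. ?Q (initial_words m n \<omega>)}
    = (\<Sum>z\<in>words m \<times> words n. prob {\<omega> \<in> space M. initial_words m n \<omega> = z} * of_bool (?Q z))"
    by (rule *(2)) auto
  also have "\<dots> = (\<Sum>z\<in>words m \<times> words n. weight \<mu> (fst z) * weight \<mu> (snd z) * of_bool (?Q z))"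
    by (intro sum.cong refl) (simp add: initial_words_prob(2))
  also have "\<dots> = pair_prob m n Q"
    unfolding pair_prob_def sum.cartesian_product by (simp add: case_prod_unfold)
  finally show "prob {\<omega> \<in> space M. Q (xs m \<omega>) (ys n \<omega>)} = pair_prob m n Q"
    unfolding e .
qed

lemma pair_integral:
  fixes F :: "'a list \<Rightarrow> 'a list \<Rightarrow> real"
  shows "integrable M (\<lambda>\<omega>. F (xs m \<omega>) (ys n \<omega>))"
    and "(\<integral>\<omega>. F (xs m \<omega>) (ys n \<omega>) \<partial>M)
      = (\<Sum>u\<in>words m. \<Sum>v\<in>words n. weight \<mu> u * weight \<mu> v * F u v)"
proof -
  let ?F = "\<lambda>p. F (fst p) (snd p)"
  note * = finite_range_integral[of "words m \<times> words n" "initial_words m n" ?F,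
      OF _ initial_words_mem initial_words_prob(1)]
  have "integrable M (\<lambda>\<omega>. ?F (initial_words m n \<omega>))" by (rule *(1)) auto
  then show "integrable M (\<lambda>\<omega>. F (xs m \<omega>) (ys n \<omega>))"
    by (simp add: initial_words_def)
  have "(\<integral>\<omega>. ?F (initial_words m n \<omega>) \<partial>M)
    = (\<Sum>z\<in>words m \<times> words n. prob {\<omega> \<in> space M. initial_words m n \<omega> = z} * ?F z)"
    by (rule *(2)) auto
  also have "\<dots> = (\<Sum>z\<in>words m \<times> words n. weight \<mu> (fst z) * weight \<mu> (snd z) * ?F z)"
    by (intro sum.cong refl) (simp add: initial_words_prob(2))
  also have "\<dots> = (\<Sum>u\<in>words m. \<Sum>v\<in>words n. weight \<mu> u * weight \<mu> v * F u v)"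
    unfolding sum.cartesian_product by (simp add: case_prod_unfold)
  finally show "(\<integral>\<omega>. F (xs m \<omega>) (ys n \<omega>) \<partial>M)
      = (\<Sum>u\<in>words m. \<Sum>v\<in>words n. weight \<mu> u * weight \<mu> v * F u v)"
    by (simp add: initial_words_def)
qed

lemma mean_score:
  "(\<integral>\<omega>. K (X 1 \<omega>) (Y 1 \<omega>) \<partial>M) = (\<Sum>a\<in>UNIV. \<Sum>b\<in>UNIV. pmf \<mu> a * pmf \<mu> b * K a b)"
proof -
  have "(\<integral>\<omega>. K (X 1 \<omega>) (Y 1 \<omega>) \<partial>M)
    = (\<integral>\<omega>. K (hd (xs 1 \<omega>)) (hd (ys 1 \<omega>)) \<partial>M)"
    by (simp add: segment_def)
  also have "\<dots> = (\<Sum>a\<in>UNIV. \<Sum>b\<in>UNIV. pmf \<mu> a * pmf \<mu> b * K a b)"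
    unfolding pair_integral(2)[of "\<lambda>u v. K (hd u) (hd v)" 1 1] sum_words_1 by (simp add: weight_def)
  finally show ?thesis .
qed

text \<open>Grouping the pairs of words by their lengths turns the sum over words into the sum of expectations.
The sum converges by \<open>h_bound\<close>, so the passage to extended nonnegative reals loses nothing.\<close>

lemma h_kappa_eq_h:
  assumes "\<theta> > 0" "k \<ge> 1"
  shows "h_kappa M X Y K g k \<theta> = ennreal (h k \<theta>)"
proof -
  define A where "A = {k..} \<times> {k..}"
  define B where "B = (\<lambda>(m, n). words m \<times> words n :: ('a list \<times> 'a list) set)"
  define E where "E q = sum (pair_term k \<theta>) (B q)" for q
  have B_fin: "finite (B q)" for q by (auto simp: B_def split: prod.splits)
  have nn: "(\<integral>\<^sup>+\<omega>. ennreal (exp (\<theta> * real_of_ereal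
      (anchored_score K g k (\<lambda>i. X i \<omega>) (\<lambda>j. Y j \<omega>) m n))) \<partial>M) = ennreal (E (m, n))"
    if "(m, n) \<in> A" for m n
  proof -
    have mn: "k \<le> m" "k \<le> n" using that by (auto simp: A_def)
    have "(\<integral>\<^sup>+\<omega>. ennreal (exp (\<theta> * real_of_ereal
      (anchored_score K g k (\<lambda>i. X i \<omega>) (\<lambda>j. Y j \<omega>) m n))) \<partial>M)
      = (\<integral>\<^sup>+\<omega>. ennreal (exp (\<theta> * opt k (xs m \<omega>) (ys n \<omega>))) \<partial>M)"
      by (simp add: anchored_score_eq_best[of g, OF g_0 assms(2) mn])
    also have "\<dots> = ennreal (\<integral>\<omega>. exp (\<theta> * opt k (xs m \<omega>) (ys n \<omega>)) \<partial>M)"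
      by (rule nn_integral_eq_integral[OF pair_integral(1)]) simp
    also have "\<dots> = ennreal (\<Sum>u\<in>words m. \<Sum>v\<in>words n. weight \<mu> u * weight \<mu> v * exp (\<theta> * opt k u v))"
      by (subst pair_integral(2)) (rule refl)
    also have "(\<Sum>u\<in>words m. \<Sum>v\<in>words n. weight \<mu> u * weight \<mu> v * exp (\<theta> * opt k u v)) = E (m, n)"
      unfolding E_def B_def pair_term_def by (simp add: sum.cartesian_product)
    finally show ?thesis .
  qed
  have lp: "long_pairs k = snd ` Sigma A B"
    by (force simp: long_pairs_def A_def B_def words_def)
  have inj: "inj_on snd (Sigma A B)"
    by (auto simp: inj_on_def A_def B_def words_def)
  have sm: "(pair_term k \<theta> \<circ> snd) summable_on Sigma A B"
    using h_bound(1)[OF assms] unfolding lp summable_on_reindex[OF inj] .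
  then have sm': "(\<lambda>(q, p). pair_term k \<theta> p) summable_on Sigma A B"
    by (simp add: o_def case_prod_unfold)
  have "h k \<theta> = infsum (pair_term k \<theta> \<circ> snd) (Sigma A B)"
    unfolding h_def lp infsum_reindex[OF inj] ..
  also have "\<dots> = infsum E A"
    using infsum_Sigma'_banach[OF sm'] by (simp add: E_def[abs_def] B_fin o_def case_prod_unfold)
  finally have h: "h k \<theta> = infsum E A" .
  have E: "E summable_on A"
    using summable_on_Sigma_banach[OF sm'] by (simp add: E_def[abs_def] B_fin)
  have "h_kappa M X Y K g k \<theta> = infsum (\<lambda>q. ennreal (E q)) A"
    unfolding h_kappa_def A_def[symmetric]
    by (rule infsum_cong) (use nn in \<open>auto split: prod.splits\<close>)
  also have "\<dots> = ennreal (infsum E A)"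
    by (rule ennreal_infsum[OF E]) (auto simp: E_def intro: sum_nonneg)
  finally show ?thesis unfolding h .
qed

lemma psi_eq_Psi:
  assumes "\<theta> > 0"
  shows "(\<lambda>\<kappa>. psi_kappa M X Y K g \<kappa> \<theta> / ereal (real \<kappa>)) \<longlonglongrightarrow> ereal (Psi \<theta>)"
    and "psi M X Y K g \<theta> = ereal (Psi \<theta>)"
proof -
  have e: "psi_kappa M X Y K g k \<theta> / ereal (real k) = ereal (ln (h k \<theta>) / real k)" if "k \<ge> 1" for k
    using h_kappa_eq_h[OF assms that] h_pos[OF assms that] that
    by (simp add: psi_kappa_def log_ennreal_def)
  have "(\<lambda>k. ereal (ln (h k \<theta>) / real k)) \<longlonglongrightarrow> ereal (Psi \<theta>)"
    using Psi_LIMSEQ_and_le(1)[OF assms] by simp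
  then show lim: "(\<lambda>\<kappa>. psi_kappa M X Y K g \<kappa> \<theta> / ereal (real \<kappa>)) \<longlonglongrightarrow> ereal (Psi \<theta>)"
    by (rule Lim_transform_eventually)
      (use e in \<open>auto intro!: eventually_sequentiallyI[of 1]\<close>)
  then show "psi M X Y K g \<theta> = ereal (Psi \<theta>)"
    unfolding psi_def by (rule limI)
qed

lemma score_event:
  "{\<omega> \<in> space M. ereal c \<le> score \<omega> m n} \<in> events"
  "prob {\<omega> \<in> space M. ereal c \<le> score \<omega> m n} = pair_prob m n (local_hit K g c)"
  unfolding local_score_ge_iff[of g, OF g_0 g_nonneg] by (rule pair_event)+

section \<open>Logarithmic tail of the local score\<close>

text \<open>About \<open>c / l\<close> blocks of the good size suffice, and they fit because the lengths grow faster than \<open>c\<close>. The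
constant \<open>l\<close> pays for rounding up the number of blocks.\<close>

lemma score_tail_lower:
  assumes "\<theta> > 0" "Psi \<theta> > 0"
    and growth: "filterlim (\<lambda>c. real (min (m c) (n c)) / c) at_top at_top"
  shows "\<exists>l. eventually (\<lambda>c. exp (- \<theta> * (c + l)) \<le> prob {\<omega> \<in> space M. ereal c \<le> score \<omega> (m c) (n c)}) at_top"
proof -
  obtain m0 n0 l where l: "m0 \<ge> 1" "n0 \<ge> 1" "l \<ge> 1" and blocks: "\<And>r. r \<ge> 1 \<Longrightarrow>
    exp (- \<theta> * (real r * real l)) \<le> pair_prob (r * m0) (r * n0) (global_hit K g (real r * real l))"
    using global_hit_blocks[OF assms(1,2)] by blast
  have l0: "real l > 0" using l by simp
  have "eventually (\<lambda>c. 2 * real (m0 + n0) \<le> real (min (m c) (n c)) / c) at_top"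
    using growth by (simp add: filterlim_at_top)
  moreover have "eventually (\<lambda>c. real l \<le> c) at_top" by (rule eventually_ge_at_top)
  ultimately have "eventually (\<lambda>c. exp (- \<theta> * (c + real l)) \<le> prob {\<omega> \<in> space M. ereal c \<le> score \<omega> (m c) (n c)}) at_top"
  proof eventually_elim
    case (elim c)
    then have c: "c > 0" "c \<ge> 1" using l by auto
    define r where "r = nat \<lceil>c / real l\<rceil>"
    have "c / real l \<ge> 1" using elim l0 by simp
    then have r: "r \<ge> 1" "c / real l \<le> real r" "real r \<le> c / real l + 1"
      unfolding r_def by linarith+
    have rl: "c \<le> real r * real l" "real r * real l \<le> c + real l"
      using r l0 by (auto simp: field_simps)
    have "c / real l \<le> c" using l c by (simp add: divide_le_eq)
    then have "real r \<le> 2 * c" using r c by linarith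
    then have "real r * real (m0 + n0) \<le> 2 * c * real (m0 + n0)" by (intro mult_right_mono) auto
    also have "\<dots> \<le> real (min (m c) (n c))"
      using elim(1) c by (simp add: field_simps)
    finally have "r * (m0 + n0) \<le> min (m c) (n c)"
      unfolding of_nat_mult[symmetric] of_nat_le_iff .
    then have mn: "r * m0 \<le> m c" "r * n0 \<le> n c" by (auto simp: algebra_simps)
    have "exp (- \<theta> * (c + real l)) \<le> exp (- \<theta> * (real r * real l))"
      using rl assms(1) by simp
    also have "\<dots> \<le> pair_prob (r * m0) (r * n0) (global_hit K g (real r * real l))" by (rule blocks[OF r(1)])
    also have "\<dots> \<le> pair_prob (r * m0) (r * n0) (global_hit K g c)"
      using rl by (intro pair_prob_mono) (auto simp: global_hit_def intro: order_trans)
    also have "\<dots> \<le> pair_prob (m c) (n c) (local_hit K g c)"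
      by (rule local_hit_ge_global_hit[OF mn])
    finally show ?case unfolding score_event(2) .
  qed
  then show ?thesis by blast
qed

lemma score_tail:
  assumes root: "\<exists>!\<theta>. \<theta> > 0 \<and> Psi \<theta> = 0" "\<theta>' > 0" "Psi \<theta>' = 0"
    and mn: "\<forall>c>0. m c > 0 \<and> n c > 0"
    and growth: "filterlim (\<lambda>c. real (min (m c) (n c)) / c) at_top at_top"
    and small: "(\<lambda>c. ln (real (m c) * real (n c))) \<in> o[at_top](\<lambda>c. c)"
  shows "((\<lambda>c. - (1 / c) * ln (prob {\<omega> \<in> space M. ereal c \<le> score \<omega> (m c) (n c)})) \<longlongrightarrow> \<theta>') at_top"
proof -
  define P where "P c = prob {\<omega> \<in> space M. ereal c \<le> score \<omega> (m c) (n c)}" for c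
  note sign = Psi_sign[OF root]
  have lower: "\<exists>l. eventually (\<lambda>c. exp (- \<theta> * (c + l)) \<le> P c) at_top" if "\<theta> > \<theta>'" for \<theta>
    unfolding P_def using that root(2) sign(2) growth by (intro score_tail_lower) auto
  have pos: "eventually (\<lambda>c. P c > 0) at_top"
  proof -
    obtain l where "eventually (\<lambda>c. exp (- (\<theta>' + 1) * (c + l)) \<le> P c) at_top"
      using lower[of "\<theta>' + 1"] by auto
    then show ?thesis by eventually_elim (meson exp_gt_zero less_le_trans)
  qed
  have "((\<lambda>c. - (1 / c) * ln (P c)) \<longlongrightarrow> \<theta>') at_top"
  proof (rule order_tendstoI)
    fix y assume y: "y < \<theta>'"
    define \<theta> where "\<theta> = (max y 0 + \<theta>') / 2"
    have \<theta>: "\<theta> > 0" "\<theta> < \<theta>'" "y < \<theta>" using y root(2) by (auto simp: \<theta>_def max_def field_simps)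
    obtain C where C: "C > 0" "\<And>m n c. pair_prob m n (local_hit K g c) \<le> C * real m * real n * exp (- \<theta> * c)"
      using local_hit_upper[OF \<theta>(1) sign(1)[OF \<theta>(1,2)]] by blast
    define d where "d = (\<theta> - y) / 2"
    have d: "d > 0" using \<theta> by (simp add: d_def)
    have "eventually (\<lambda>c. \<bar>ln (real (m c) * real (n c))\<bar> \<le> d / 2 * \<bar>c\<bar>) at_top"
      using landau_o.smallD[OF small, of "d / 2"] d by simp
    moreover have "eventually (\<lambda>c::real. c > 2 * \<bar>ln C\<bar> / d) at_top" by (rule eventually_gt_at_top)
    moreover have "eventually (\<lambda>c::real. c > 0) at_top" by (rule eventually_gt_at_top)
    ultimately show "eventually (\<lambda>c. y < - (1 / c) * ln (P c)) at_top"
      using pos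
    proof eventually_elim
      case (elim c)
      have mc: "real (m c) > 0" "real (n c) > 0" using mn elim by auto
      have "P c \<le> C * (real (m c) * real (n c)) * exp (- \<theta> * c)"
        using C(2)[of "m c" "n c" c] by (simp add: P_def score_event(2) mult.assoc)
      then have "ln (P c) \<le> ln (C * (real (m c) * real (n c)) * exp (- \<theta> * c))"
        using elim C mc by (subst ln_le_cancel_iff) auto
      also have "\<dots> = ln (C * (real (m c) * real (n c))) - \<theta> * c"
        using C mc by (subst ln_mult) auto
      also have "ln (C * (real (m c) * real (n c))) = ln C + ln (real (m c) * real (n c))"
        using C mc by (subst ln_mult) auto
      also have "ln C < d / 2 * c"
        using elim(2) d by (simp add: field_simps)
      also have "ln (real (m c) * real (n c)) \<le> d / 2 * c" using elim by simp
      finally have "ln (P c) < d * c - \<theta> * c" by (simp add: mult.commute)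
      then have "(\<theta> - d) * c < - ln (P c)" by (simp add: algebra_simps)
      moreover have "y * c < (\<theta> - d) * c"
        using \<theta> elim by (intro mult_strict_right_mono) (auto simp: d_def field_simps)
      ultimately have "y * c < - ln (P c)" by linarith
      then show ?case using elim by (simp add: field_simps)
    qed
  next
    fix y assume y: "\<theta>' < y"
    define \<theta> where "\<theta> = (y + \<theta>') / 2"
    have \<theta>: "\<theta> > 0" "\<theta>' < \<theta>" "\<theta> < y" using y root(2) by (auto simp: \<theta>_def field_simps)
    obtain l where "eventually (\<lambda>c. exp (- \<theta> * (c + l)) \<le> P c) at_top"
      using lower[OF \<theta>(2)] by blast
    moreover have "eventually (\<lambda>c::real. c > \<theta> * l / (y - \<theta>)) at_top" by (rule eventually_gt_at_top)
    moreover have "eventually (\<lambda>c::real. c > 0) at_top" by (rule eventually_gt_at_top)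
    ultimately show "eventually (\<lambda>c. - (1 / c) * ln (P c) < y) at_top"
      using pos
    proof eventually_elim
      case (elim c)
      have "- \<theta> * (c + l) \<le> ln (P c)" using elim(1,4) by (simp add: ln_ge_iff)
      then have "- ln (P c) \<le> \<theta> * c + \<theta> * l" by (simp add: algebra_simps)
      also have "\<theta> * l < (y - \<theta>) * c" using elim(2) \<theta> by (simp add: field_simps)
      finally have "- ln (P c) < y * c" by (simp add: algebra_simps)
      then show ?case using elim by (simp add: field_simps)
    qed
  qed
  then show ?thesis by (simp add: P_def)
qed

section \<open>Almost sure growth\<close>

text \<open>Along lengths \<open>2 ^ j\<close> the probabilities of exceeding \<open>\<beta> * j * ln 2\<close> are geometric with ratio
\<open>2 powr (2 - \<beta> * \<theta>)\<close>; the room between \<open>\<beta>\<close> and \<open>\<alpha>\<close> covers the step from \<open>j\<close> to \<open>j + 1\<close>.\<close>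

lemma score_growth_upper:
  assumes "\<theta> > 0" "Psi \<theta> < 0" "\<alpha> * \<theta> > 2"
  shows "AE \<omega> in M. eventually (\<lambda>n. score \<omega> n n < ereal (\<alpha> * ln (real n))) sequentially"
proof -
  obtain C where C: "C > 0" "\<And>m n c. pair_prob m n (local_hit K g c) \<le> C * real m * real n * exp (- \<theta> * c)"
    using local_hit_upper[OF assms(1,2)] by blast
  define \<beta> where "\<beta> = (\<alpha> + 2 / \<theta>) / 2"
  have \<beta>: "\<beta> < \<alpha>" "2 < \<beta> * \<theta>" "\<beta> > 0"
  proof -
    have "2 / \<theta> < \<alpha>" using assms by (simp add: field_simps)
    then show "\<beta> < \<alpha>" by (simp add: \<beta>_def)
    have "2 / \<theta> < \<beta>" using \<open>2 / \<theta> < \<alpha>\<close> by (simp add: \<beta>_def)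
    then show "2 < \<beta> * \<theta>" using assms(1) by (simp add: field_simps)
    then show "\<beta> > 0" using assms(1) by (metis less_trans zero_less_mult_pos2 zero_less_numeral)
  qed
  define A where "A j = {\<omega> \<in> space M. ereal (\<beta> * (real j * ln 2)) \<le> score \<omega> (2 ^ j) (2 ^ j)}" for j
  define q where "q = exp ((2 - \<beta> * \<theta>) * ln 2)"
  have q: "0 < q" "q < 1" using \<beta> by (auto simp: q_def mult_neg_pos)
  have A: "prob (A j) \<le> C * q ^ j" for j
  proof -
    have e: "(2::real) ^ j = exp (real j * ln 2)" by (simp add: exp_of_nat_mult)
    have "prob (A j) \<le> C * 2 ^ j * 2 ^ j * exp (- \<theta> * (\<beta> * (real j * ln 2)))"
      unfolding A_def score_event(2) using C(2)[of "2 ^ j" "2 ^ j" "\<beta> * (real j * ln 2)"] by simp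
    also have "\<dots> = C * exp (real j * ((2 - \<beta> * \<theta>) * ln 2))"
      unfolding e by (simp add: exp_add[symmetric] algebra_simps)
    also have "\<dots> = C * q ^ j" by (simp add: q_def exp_of_nat_mult)
    finally show ?thesis .
  qed
  have "AE \<omega> in M. eventually (\<lambda>j. \<omega> \<in> space M - A j) sequentially"
  proof (rule borel_cantelli_AE1)
    show "A j \<in> events" for j unfolding A_def by (rule score_event)
    show "summable (\<lambda>j. prob (A j))"
      by (rule summable_comparison_test'[of "\<lambda>j. C * q ^ j" 0])
        (use A q in \<open>auto intro: summable_mult summable_geometric\<close>)
  qed (simp add: emeasure_eq_measure)
  then show ?thesis
  proof eventually_elim
    case (elim \<omega>)
    then obtain j0 where j0: "\<And>j. j \<ge> j0 \<Longrightarrow> score \<omega> (2 ^ j) (2 ^ j) < ereal (\<beta> * (real j * ln 2))"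
      by (auto simp: eventually_sequentially A_def not_le)
    define J where "J = max j0 (nat \<lceil>\<beta> / (\<alpha> - \<beta>)\<rceil>)"
    show ?case
    proof (rule eventually_sequentiallyI[of "2 ^ J"])
      fix n :: nat assume n: "2 ^ J \<le> n"
      have "(0::nat) < 2 ^ J" by simp
      with n have n0: "n > 0" by linarith
      obtain j where j: "J \<le> j" "2 ^ j \<le> n" "n < 2 ^ Suc j"
        using bracketing_index[of "\<lambda>j. 2 ^ j" J n] n by (auto simp: less_imp_le)
      have jj: "j0 \<le> Suc j" "\<beta> / (\<alpha> - \<beta>) \<le> real j" using j(1) unfolding J_def by linarith+
      have "score \<omega> n n \<le> score \<omega> (2 ^ Suc j) (2 ^ Suc j)"
        using j by (intro local_score_mono) auto
      also have "\<dots> < ereal (\<beta> * (real (Suc j) * ln 2))" by (rule j0[OF jj(1)])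
      also have "\<dots> \<le> ereal (\<alpha> * ln (real n))"
      proof -
        have "\<beta> * real (Suc j) \<le> \<alpha> * real j" using jj(2) \<beta> by (simp add: field_simps)
        then have "\<beta> * real (Suc j) * ln 2 \<le> \<alpha> * real j * ln 2" by (intro mult_right_mono) auto
        also have "real j * ln 2 \<le> ln (real n)"
        proof -
          have "(2::real) ^ j \<le> real n" using of_nat_mono[OF j(2), where 'a = real] by simp
          then have "ln ((2::real) ^ j) \<le> ln (real n)"
            using n0 by (subst ln_le_cancel_iff) auto
          then show ?thesis by (simp add: ln_realpow)
        qed
        then have "\<alpha> * real j * ln 2 \<le> \<alpha> * ln (real n)"
          using \<beta> by (simp add: mult.assoc)
        finally show ?thesis by (simp add: mult.assoc)
      qed
      finally show "score \<omega> n n < ereal (\<alpha> * ln (real n))" .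
    qed
  qed
qed

lemma block_law:
  assumes "finite J"
  shows "{\<omega> \<in> space M. Q (\<lambda>k\<in>J. block L k \<omega>)} \<in> events"
    and "prob {\<omega> \<in> space M. Q (\<lambda>k\<in>J. block L k \<omega>)}
      = (\<Sum>f\<in>J \<rightarrow>\<^sub>E words L. (\<Prod>k\<in>J. weight \<mu> (f k)) * of_bool (Q f))"
proof -
  have e: "{\<omega> \<in> space M. (\<lambda>k\<in>J. block L k \<omega>) = f} = {\<omega> \<in> space M. \<forall>k\<in>J. block L k \<omega> = f k}"
    if "f \<in> J \<rightarrow>\<^sub>E words L" for f
  proof -
    have "(\<lambda>k\<in>J. block L k \<omega>) = f \<longleftrightarrow> (\<forall>k\<in>J. block L k \<omega> = f k)" for \<omega>
      using that by (auto simp: fun_eq_iff restrict_def PiE_iff extensional_def)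
    then show ?thesis by simp
  qed
  have f: "f k \<in> words L" if "f \<in> J \<rightarrow>\<^sub>E words L" "k \<in> J" for f k using that by auto
  have S: "finite (J \<rightarrow>\<^sub>E (words L :: 'a list set))" using assms by (intro finite_PiE) auto
  have Z: "(\<lambda>k\<in>J. block L k \<omega>) \<in> J \<rightarrow>\<^sub>E words L" for \<omega> by (auto simp: block_words)
  have ev: "{\<omega> \<in> space M. (\<lambda>k\<in>J. block L k \<omega>) = f} \<in> events" if "f \<in> J \<rightarrow>\<^sub>E words L" for f
    unfolding e[OF that] by (rule blocks_prob(1)[OF assms f[OF that]])
  show "{\<omega> \<in> space M. Q (\<lambda>k\<in>J. block L k \<omega>)} \<in> events"
    by (rule finite_range_prob(1)[OF S Z ev])
  have "prob {\<omega> \<in> space M. Q (\<lambda>k\<in>J. block L k \<omega>)}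
    = (\<Sum>f\<in>J \<rightarrow>\<^sub>E words L. prob {\<omega> \<in> space M. (\<lambda>k\<in>J. block L k \<omega>) = f} * of_bool (Q f))"
    by (rule finite_range_prob(2)[OF S Z ev])
  also have "\<dots> = (\<Sum>f\<in>J \<rightarrow>\<^sub>E words L. (\<Prod>k\<in>J. weight \<mu> (f k)) * of_bool (Q f))"
  proof (rule sum.cong[OF refl])
    fix f' :: "nat + nat \<Rightarrow> 'a list" assume f': "f' \<in> J \<rightarrow>\<^sub>E words L"
    have "prob {\<omega> \<in> space M. \<forall>k\<in>J. block L k \<omega> = f' k} = (\<Prod>k\<in>J. weight \<mu> (f' k))"
      by (rule blocks_prob(2)[OF assms f[OF f']])
    then show "prob {\<omega> \<in> space M. (\<lambda>k\<in>J. block L k \<omega>) = f'} * of_bool (Q f') = (\<Prod>k\<in>J. weight \<mu> (f' k)) * of_bool (Q f')"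
      by (simp only: e[OF f'])
  qed
  finally show "prob {\<omega> \<in> space M. Q (\<lambda>k\<in>J. block L k \<omega>)}
      = (\<Sum>f\<in>J \<rightarrow>\<^sub>E words L. (\<Prod>k\<in>J. weight \<mu> (f k)) * of_bool (Q f))" .
qed

text \<open>Two pairs of blocks with a common block are both related with probability at most the probability of
one relation times the maximal degree, which is what the second moment needs.\<close>

lemma no_related_blocks:
  assumes bal: "balanced L R \<pi> d" and N: "N \<ge> 1"
  shows "prob {\<omega> \<in> space M. \<forall>a<N. \<forall>b<N. \<not> R (block L (Inl a) \<omega>) (block L (Inr b) \<omega>)}
     \<le> 1 / ((real N)\<^sup>2 * \<pi>\<^sup>2) + 2 * d / (real N * \<pi>\<^sup>2)"
proof -
  define q where "q = \<pi>\<^sup>2"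
  have q: "pair_prob L L R = q" "q > 0"
    and deg: "\<And>x. x \<in> words L \<Longrightarrow> (\<Sum>y\<in>words L. weight \<mu> y * of_bool (R x y)) \<le> d"
      "\<And>y. y \<in> words L \<Longrightarrow> (\<Sum>x\<in>words L. weight \<mu> x * of_bool (R x y)) \<le> d"
    using bal unfolding balanced_def q_def by simp_all
  define A where "A a b = {\<omega> \<in> space M. R (block L (Inl a) \<omega>) (block L (Inr b) \<omega>)}" for a b
  let ?W = "words L :: 'a list set"
  let ?w = "weight \<mu>"
  let ?r = "\<lambda>x y. of_bool (R x y) :: real"
  have d: "d \<ge> 0"
  proof -
    have "(0::real) \<le> (\<Sum>y\<in>?W. ?w y * ?r (replicate L undefined) y)"
      by (intro sum_nonneg) auto
    also have "\<dots> \<le> d" by (rule deg(1)) (simp add: words_def)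
    finally show ?thesis .
  qed
  have qs: "(\<Sum>x\<in>?W. \<Sum>y\<in>?W. ?w x * ?w y * ?r x y) = q"
    using q(1) by (simp add: pair_prob_def del: sum_mult_of_bool_eq sum_of_bool_mult_eq)
  have A: "A a b \<in> events" "prob (A a b) = q" for a b
  proof -
    let ?J = "{Inl a, Inr b}"
    have e: "A a b = {\<omega> \<in> space M. (\<lambda>f. R (f (Inl a)) (f (Inr b))) (\<lambda>k\<in>?J. block L k \<omega>)}"
      by (simp add: A_def)
    show "A a b \<in> events" unfolding e by (rule block_law) simp
    have "prob (A a b) = (\<Sum>f\<in>?J \<rightarrow>\<^sub>E ?W. (\<Prod>k\<in>?J. ?w (f k)) * ?r (f (Inl a)) (f (Inr b)))"
      unfolding e by (rule block_law) simp
    also have "\<dots> = (\<Sum>x\<in>?W. \<Sum>y\<in>?W. ?w x * ?w y * ?r x y)"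
      by (simp add: sum_PiE_insert mult.assoc del: sum_mult_of_bool_eq sum_of_bool_mult_eq)
    finally show "prob (A a b) = q" using qs by simp
  qed
  have row: "prob (A a b \<inter> A a b') \<le> q * d" if "b \<noteq> b'" for a b b'
  proof -
    let ?J = "{Inl a, Inr b, Inr b'}"
    have e: "A a b \<inter> A a b' = {\<omega> \<in> space M. (\<lambda>f. R (f (Inl a)) (f (Inr b)) \<and> R (f (Inl a)) (f (Inr b')))
        (\<lambda>k\<in>?J. block L k \<omega>)}"
      by (auto simp: A_def)
    have "prob (A a b \<inter> A a b') = (\<Sum>f\<in>?J \<rightarrow>\<^sub>E ?W. (\<Prod>k\<in>?J. ?w (f k)) *
        of_bool (R (f (Inl a)) (f (Inr b)) \<and> R (f (Inl a)) (f (Inr b'))))"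
      unfolding e by (rule block_law) simp
    also have "\<dots> = (\<Sum>x\<in>?W. \<Sum>y\<in>?W. (?w x * ?w y * ?r x y) * (\<Sum>y'\<in>?W. ?w y' * ?r x y'))"
      using that by (simp add: sum_PiE_insert sum_distrib_left mult_ac of_bool_conj
          del: sum_mult_of_bool_eq sum_of_bool_mult_eq)
    also have "\<dots> \<le> (\<Sum>x\<in>?W. \<Sum>y\<in>?W. (?w x * ?w y * ?r x y) * d)"
      by (intro sum_mono mult_left_mono deg) auto
    also have "\<dots> = q * d" unfolding qs[symmetric] sum_distrib_right ..
    finally show ?thesis .
  qed
  have col: "prob (A a b \<inter> A a' b) \<le> q * d" if "a \<noteq> a'" for a a' b
  proof -
    let ?J = "{Inl a, Inr b, Inl a'}"
    have e: "A a b \<inter> A a' b = {\<omega> \<in> space M. (\<lambda>f. R (f (Inl a)) (f (Inr b)) \<and> R (f (Inl a')) (f (Inr b)))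
        (\<lambda>k\<in>?J. block L k \<omega>)}"
      by (auto simp: A_def)
    have "prob (A a b \<inter> A a' b) = (\<Sum>f\<in>?J \<rightarrow>\<^sub>E ?W. (\<Prod>k\<in>?J. ?w (f k)) *
        of_bool (R (f (Inl a)) (f (Inr b)) \<and> R (f (Inl a')) (f (Inr b))))"
      unfolding e by (rule block_law) simp
    also have "\<dots> = (\<Sum>x\<in>?W. \<Sum>y\<in>?W. (?w x * ?w y * ?r x y) * (\<Sum>x'\<in>?W. ?w x' * ?r x' y))"
      using that by (simp add: sum_PiE_insert sum_distrib_left mult_ac of_bool_conj
          del: sum_mult_of_bool_eq sum_of_bool_mult_eq)
    also have "\<dots> \<le> (\<Sum>x\<in>?W. \<Sum>y\<in>?W. (?w x * ?w y * ?r x y) * d)"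
      by (intro sum_mono mult_left_mono deg) auto
    also have "\<dots> = q * d" unfolding qs[symmetric] sum_distrib_right ..
    finally show ?thesis .
  qed
  have ind: "prob (A a b \<inter> A a' b') \<le> q * q" if "a \<noteq> a'" "b \<noteq> b'" for a a' b b'
  proof -
    let ?J = "{Inl a, Inr b, Inl a', Inr b'}"
    have e: "A a b \<inter> A a' b' = {\<omega> \<in> space M. (\<lambda>f. R (f (Inl a)) (f (Inr b)) \<and> R (f (Inl a')) (f (Inr b')))
        (\<lambda>k\<in>?J. block L k \<omega>)}"
      by (auto simp: A_def)
    have "prob (A a b \<inter> A a' b') = (\<Sum>f\<in>?J \<rightarrow>\<^sub>E ?W. (\<Prod>k\<in>?J. ?w (f k)) *
        of_bool (R (f (Inl a)) (f (Inr b)) \<and> R (f (Inl a')) (f (Inr b'))))"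
      unfolding e by (rule block_law) simp
    also have "\<dots> = (\<Sum>x\<in>?W. \<Sum>y\<in>?W. (?w x * ?w y * ?r x y) * (\<Sum>x'\<in>?W. \<Sum>y'\<in>?W. ?w x' * ?w y' * ?r x' y'))"
      using that by (simp add: sum_PiE_insert sum_distrib_left mult_ac of_bool_conj
          del: sum_mult_of_bool_eq sum_of_bool_mult_eq)
    also have "\<dots> = q * q" unfolding qs sum_distrib_right[symmetric] ..
    finally show ?thesis by simp
  qed
  have "{\<omega> \<in> space M. \<forall>a<N. \<forall>b<N. \<not> R (block L (Inl a) \<omega>) (block L (Inr b) \<omega>)}
    = {\<omega> \<in> space M. \<forall>a<N. \<forall>b<N. \<omega> \<notin> A a b}"
    by (auto simp: A_def)
  then show ?thesis
    using second_moment_bound[of N A q d, OF A row col ind q(2) N d] by (simp add: q_def)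
qed

lemma no_score:
  assumes R: "\<And>x y. R x y \<Longrightarrow> global_hit K g c x y"
    and bal: "balanced L R \<pi> d" and N: "N \<ge> 1"
  shows "prob {\<omega> \<in> space M. \<not> ereal c \<le> score \<omega> (N * L) (N * L)} \<le> 1 / ((real N)\<^sup>2 * \<pi>\<^sup>2) + 2 * d / (real N * \<pi>\<^sup>2)"
proof -
  let ?B = "{\<omega> \<in> space M. \<forall>a<N. \<forall>b<N. \<not> R (block L (Inl a) \<omega>) (block L (Inr b) \<omega>)}"
  have "{\<omega> \<in> space M. \<not> ereal c \<le> score \<omega> (N * L) (N * L)} \<subseteq> ?B"
  proof (intro subsetI CollectI conjI allI impI notI; (elim CollectE conjE)?)
    fix \<omega> a b
    assume \<omega>: "\<not> ereal c \<le> score \<omega> (N * L) (N * L)" and ab: "a < N" "b < N"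
      and r: "R (block L (Inl a) \<omega>) (block L (Inr b) \<omega>)"
    have le: "a * L + L \<le> N * L" "b * L + L \<le> N * L"
      using mult_le_mono1[of "Suc a" N L] mult_le_mono1[of "Suc b" N L] ab by (auto simp: Suc_le_eq)
    have "global_hit K g c (take L (drop (a * L) (xs (N * L) \<omega>)))
        (take L (drop (b * L) (ys (N * L) \<omega>)))"
      using R[OF r] unfolding take_drop_segment[OF le(1)] take_drop_segment[OF le(2)]
      by (simp add: block_def)
    then have "local_hit K g c (xs (N * L) \<omega>) (ys (N * L) \<omega>)"
      by (rule local_hit_if_global_hit) (use le in auto)
    with \<omega> show False by (simp add: local_score_ge_iff[of g, OF g_0 g_nonneg])
  qed auto
  moreover have "?B \<in> events"
  proof -
    have "{\<omega> \<in> space M. \<not> R (block L (Inl a) \<omega>) (block L (Inr b) \<omega>)} \<in> events" for a b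
      using block_law(1)[of "{Inl a, Inr b}" "\<lambda>f. \<not> R (f (Inl a)) (f (Inr b))" L] by simp
    then show ?thesis by (intro sets.sets_Collect_countable_All sets.sets_Collect_imp) auto
  qed
  ultimately have "prob {\<omega> \<in> space M. \<not> ereal c \<le> score \<omega> (N * L) (N * L)} \<le> prob ?B"
    by (intro finite_measure_mono)
  also have "\<dots> \<le> 1 / ((real N)\<^sup>2 * \<pi>\<^sup>2) + 2 * d / (real N * \<pi>\<^sup>2)"
    by (rule no_related_blocks[OF bal N])
  finally show ?thesis .
qed

text \<open>With \<open>N r\<close> blocks of length \<open>r * L\<close>, where \<open>N r\<close> is about \<open>exp (\<rho> * r)\<close>, all pairs of blocks fail to match with
probability of order \<open>exp (- (\<rho> - \<theta> * l) * r)\<close> up to a polynomial, while the score \<open>2 * r * l\<close> is compared with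
the logarithm of the length, about \<open>\<rho> * r\<close>. So \<open>\<rho>\<close> has to lie between \<open>\<theta> * l\<close> and \<open>2 * l / \<alpha>\<close>.\<close>

lemma score_growth_lower:
  assumes "\<theta> > 0" "Psi \<theta> > 0" "\<alpha> > 0" "\<alpha> * \<theta> < 2"
  shows "AE \<omega> in M. eventually (\<lambda>n. ereal (\<alpha> * ln (real n)) < score \<omega> n n) sequentially"
proof -
  obtain L l N0 where L: "L \<ge> 1" "l \<ge> 1" and blocks: "\<forall>r\<ge>1. \<exists>R \<pi> d.
    (\<forall>x y. R x y \<longrightarrow> global_hit K g (2 * real r * real l) x y) \<and> balanced (r * L) R \<pi> d \<and>
    exp (- \<theta> * (real r * real l)) \<le> 16 * (real r * real N0 + 2) ^ 4 * \<pi> \<and>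
    d \<le> 16 * (real r * real N0 + 2) ^ 4 * \<pi>"
    using symmetric_regular_blocks[OF assms(1,2)] by blast
  \<comment> \<open>midpoint of the admissible range for the exponential growth rate of the number of blocks\<close>
  define \<rho> where "\<rho> = (\<theta> * real l + 2 * real l / \<alpha>) / 2"
  define e where "e = \<rho> - \<theta> * real l"
  have l0: "real l > 0" using L by simp
  have "\<theta> * real l < 2 * real l / \<alpha>" using assms l0 by (simp add: field_simps)
  then have \<rho>: "e > 0" "\<alpha> * \<rho> < 2 * real l" "\<rho> > 0"
    using assms l0 by (auto simp: \<rho>_def e_def field_simps add_pos_pos)
  define N where "N r = nat \<lceil>exp (\<rho> * real r)\<rceil>" for r
  have N: "N r \<ge> 1" "exp (\<rho> * real r) \<le> real (N r)" "real (N r) \<le> 2 * exp (\<rho> * real r)" for r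
  proof -
    have 1: "exp (\<rho> * real r) \<ge> 1" using \<rho> by simp
    then show "N r \<ge> 1" "exp (\<rho> * real r) \<le> real (N r)" "real (N r) \<le> 2 * exp (\<rho> * real r)"
      unfolding N_def by linarith+
  qed
  define n where "n r = N r * (r * L)" for r
  have rn: "r \<le> n r" for r
    unfolding n_def using mult_le_mono[OF N(1)[of r] mult_le_mono2[OF L(1), of r]] by simp
  define A where "A r = {\<omega> \<in> space M. \<not> ereal (2 * real r * real l) \<le> score \<omega> (n r) (n r)}" for r
  have Aev: "A r \<in> events" for r
  proof -
    have "A r = space M - {\<omega> \<in> space M. ereal (2 * real r * real l) \<le> score \<omega> (n r) (n r)}"
      by (auto simp: A_def)
    then show ?thesis using score_event(1) by auto
  qed
  have Ap: "prob (A r) \<le> 768 * (real r * real N0 + 2) ^ 8 * exp (- e * real r)" if r: "r \<ge> 1" for r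
  proof -
    define Q where "Q = 16 * (real r * real N0 + 2) ^ 4"
    obtain R \<pi> d where R: "\<forall>x y. R x y \<longrightarrow> global_hit K g (2 * real r * real l) x y"
      "balanced (r * L) R \<pi> d" "exp (- \<theta> * (real r * real l)) \<le> Q * \<pi>" "d \<le> Q * \<pi>"
      unfolding Q_def using blocks r by blast
    have Q: "Q \<ge> 1"
    proof -
      have "(1::real) \<le> (real r * real N0 + 2) ^ 4" by (rule one_le_power) simp
      then show ?thesis unfolding Q_def by linarith
    qed
    have N0: "real (N r) > 0" using N(1)[of r] by simp
    have \<pi>0: "\<pi> > 0" using R(2) by (simp add: balanced_def)
    have "prob (A r) \<le> 1 / ((real (N r))\<^sup>2 * \<pi>\<^sup>2) + 2 * d / (real (N r) * \<pi>\<^sup>2)"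
      unfolding A_def n_def
      by (rule no_score[OF R(1)[rule_format] R(2) N(1)])
    also have "\<dots> \<le> (1 / (real (N r) * \<pi>))\<^sup>2 + 2 * Q * (1 / (real (N r) * \<pi>))"
    proof (rule add_mono)
      have "2 * d / (real (N r) * \<pi>\<^sup>2) \<le> 2 * (Q * \<pi>) / (real (N r) * \<pi>\<^sup>2)"
        using R(4) N0 by (intro divide_right_mono) auto
      also have "\<dots> = 2 * Q * (1 / (real (N r) * \<pi>))" using \<pi>0 N0 by (simp add: power2_eq_square)
      finally show "2 * d / (real (N r) * \<pi>\<^sup>2) \<le> 2 * Q * (1 / (real (N r) * \<pi>))" .
    qed (simp add: power_divide power_mult_distrib)
    finally have A1: "prob (A r) \<le> (1 / (real (N r) * \<pi>))\<^sup>2 + 2 * Q * (1 / (real (N r) * \<pi>))" .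
    define z where "z = Q * exp (- e * real r)"
    have "1 / (real (N r) * \<pi>) \<le> z"
    proof -
      have "exp (\<rho> * real r) * exp (- \<theta> * (real r * real l)) \<le> real (N r) * (Q * \<pi>)"
        using N(2)[of r] R(3) by (intro mult_mono) auto
      then have "exp (e * real r) \<le> Q * (real (N r) * \<pi>)"
        by (simp add: e_def exp_add[symmetric] algebra_simps)
      then have "1 \<le> z * (real (N r) * \<pi>)"
        by (simp add: z_def exp_minus field_simps)
      then show ?thesis using N0 \<pi>0 by (simp add: field_simps)
    qed
    moreover have z1: "0 < 1 / (real (N r) * \<pi>)" using N0 \<pi>0 by simp
    \<comment> \<open>for \<open>z > 1\<close> the bound is trivial, and otherwise the square is dominated by the linear term\<close>
    show ?thesis
    proof (cases "z \<le> 1")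
      case True
      have zz: "1 / (real (N r) * \<pi>) \<le> z" by fact
      have "(1 / (real (N r) * \<pi>))\<^sup>2 \<le> 1 * z"
        unfolding power2_eq_square using zz z1 True by (intro mult_mono) linarith+
      moreover have "2 * Q * (1 / (real (N r) * \<pi>)) \<le> 2 * Q * z"
        using zz Q by (intro mult_left_mono) auto
      moreover have "z \<le> Q * z" using mult_right_mono[OF Q, of z] less_le_trans[OF z1 zz] by linarith
      ultimately have "prob (A r) \<le> 3 * (Q * z)" using A1 by linarith
      also have "\<dots> = 768 * (real r * real N0 + 2) ^ 8 * exp (- e * real r)"
        by (simp add: z_def Q_def power_mult_distrib power_add[symmetric])
      finally show ?thesis .
    next
      case False
      have "1 \<le> Q * z" using Q False mult_mono[of 1 Q 1 z] by simp
      then have "prob (A r) \<le> 3 * (Q * z)" using prob_le_1[of "A r"] by linarith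
      also have "\<dots> = 768 * (real r * real N0 + 2) ^ 8 * exp (- e * real r)"
        by (simp add: z_def Q_def power_mult_distrib power_add[symmetric])
      finally show ?thesis .
    qed
  qed
  have "AE \<omega> in M. eventually (\<lambda>r. \<omega> \<in> space M - A r) sequentially"
  proof (rule borel_cantelli_AE1)
    have ev: "eventually (\<lambda>r::nat. 768 * (real r * real N0 + 2) ^ 8 * exp (- e * real r) \<le> exp (- (e / 2) * real r)) sequentially"
      by (rule polynomial_exp_eventually) (use \<rho>(1) in auto)
    show "summable (\<lambda>r. prob (A r))"
    proof (rule summable_comparison_test_ev)
      show "eventually (\<lambda>r. norm (prob (A r)) \<le> exp (- (e / 2)) ^ r) sequentially"
        using ev eventually_ge_at_top[of 1]
      proof eventually_elim
        case (elim r)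
        have "prob (A r) \<le> exp (- (e / 2) * real r)" using Ap[of r] elim by linarith
        then show ?case by (simp add: exp_of_nat_mult[symmetric] mult.commute)
      qed
      show "summable (\<lambda>r. exp (- (e / 2)) ^ r)" using \<rho>(1) by (intro summable_geometric) simp
    qed
  qed (simp_all add: Aev emeasure_eq_measure)
  then show ?thesis
  proof eventually_elim
    case (elim \<omega>)
    define e' where "e' = 2 * real l - \<alpha> * \<rho>"
    define B where "B = \<alpha> * \<rho> + \<alpha> * ln 2"
    have "e' > 0" "B > 0" using \<rho> assms(3) by (auto simp: e'_def B_def add_pos_pos)
    then have "eventually (\<lambda>r. B + \<alpha> * ln ((real r + 1) * real L) < e' * real r) sequentially"
      using assms(3) L(1) by (intro ln_less_linear_eventually) auto
    with elim have "eventually (\<lambda>r. \<omega> \<in> space M - A r \<and> B + \<alpha> * ln ((real r + 1) * real L) < e' * real r) sequentially"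
      by (rule eventually_conj)
    then obtain r0 where r0: "\<And>r. r \<ge> r0 \<Longrightarrow> \<omega> \<in> space M - A r \<and> B + \<alpha> * ln ((real r + 1) * real L) < e' * real r"
      by (auto simp: eventually_sequentially)
    show ?case
    proof (rule eventually_sequentiallyI[of "max 1 (n r0)"])
      fix k assume k: "max 1 (n r0) \<le> k"
      obtain r where r: "r \<ge> r0" "n r \<le> k" "k < n (Suc r)"
        using bracketing_index[of n r0 k] rn k by auto
      have "ln (real k) \<le> ln (real (n (Suc r)))"
        using k r(3) by (subst ln_le_cancel_iff) auto
      also have "\<dots> \<le> ln (2 * exp (\<rho> * real (Suc r)) * ((real r + 1) * real L))"
      proof -
        have "real (n (Suc r)) = real (N (Suc r)) * ((real r + 1) * real L)" by (simp add: n_def distrib_right)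
        also have "\<dots> \<le> 2 * exp (\<rho> * real (Suc r)) * ((real r + 1) * real L)"
          using N(3)[of "Suc r"] by (intro mult_right_mono) auto
        finally show ?thesis using r(3) L(1) by (subst ln_le_cancel_iff) auto
      qed
      also have "\<dots> = ln 2 + \<rho> * real (Suc r) + ln ((real r + 1) * real L)"
        using L(1) by (simp add: ln_mult add_pos_pos)
      finally have "\<alpha> * ln (real k) \<le> \<alpha> * (ln 2 + \<rho> * real (Suc r) + ln ((real r + 1) * real L))"
        using assms(3) by (intro mult_left_mono) auto
      also have "\<dots> = B + \<alpha> * ln ((real r + 1) * real L) + \<alpha> * \<rho> * real r"
        by (simp add: B_def algebra_simps)
      also have "\<dots> < 2 * real r * real l"
        using r0[OF r(1)] by (simp add: e'_def algebra_simps)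
      finally have "ereal (\<alpha> * ln (real k)) < ereal (2 * real r * real l)" by simp
      also have "\<dots> \<le> score \<omega> (n r) (n r)" using r0[OF r(1)] by (auto simp: A_def)
      also have "\<dots> \<le> score \<omega> k k" by (rule local_score_mono[OF r(2) r(2)])
      finally show "ereal (\<alpha> * ln (real k)) < score \<omega> k k" .
    qed
  qed
qed

lemma score_growth:
  assumes root: "\<exists>!\<theta>. \<theta> > 0 \<and> Psi \<theta> = 0" "\<theta>' > 0" "Psi \<theta>' = 0"
  shows "AE \<omega> in M. (\<lambda>n. score \<omega> n n / ereal (ln (real n))) \<longlonglongrightarrow> ereal (2 / \<theta>')"
proof -
  note sign = Psi_sign[OF root]
  define a b where "a k = 2 / \<theta>' + 1 / real (Suc k)" and "b k = 2 / \<theta>' - 1 / real (Suc k)" for k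
  have upper: "AE \<omega> in M. \<forall>k. eventually (\<lambda>n. score \<omega> n n < ereal (a k * ln (real n))) sequentially"
    unfolding AE_all_countable
  proof
    fix k
    define \<theta> where "\<theta> = (2 / a k + \<theta>') / 2"
    have a: "a k > 0" "2 / \<theta>' < a k" using root(2) by (auto simp: a_def add_pos_pos)
    then have "2 / a k < \<theta>'" using root(2) by (simp add: field_simps)
    then have \<theta>: "\<theta> < \<theta>'" "2 / a k < \<theta>" by (auto simp: \<theta>_def)
    have "0 < 2 / a k" using a by simp
    then have \<theta>0: "0 < \<theta>" using \<theta>(2) by (rule less_trans)
    show "AE \<omega> in M. eventually (\<lambda>n. score \<omega> n n < ereal (a k * ln (real n))) sequentially"
      using \<theta> \<theta>0 a by (intro score_growth_upper[of \<theta>] sign(1)) (auto simp: field_simps)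
  qed
  have lower: "AE \<omega> in M. \<forall>k. b k > 0 \<longrightarrow> eventually (\<lambda>n. ereal (b k * ln (real n)) < score \<omega> n n) sequentially"
    unfolding AE_all_countable
  proof
    fix k
    show "AE \<omega> in M. b k > 0 \<longrightarrow> eventually (\<lambda>n. ereal (b k * ln (real n)) < score \<omega> n n) sequentially"
    proof (cases "b k > 0")
      case True
      define \<theta> where "\<theta> = (2 / b k + \<theta>') / 2"
      have "b k < 2 / \<theta>'" by (simp add: b_def)
      then have "\<theta>' < 2 / b k" using root(2) True by (simp add: field_simps)
      then have \<theta>: "\<theta>' < \<theta>" "\<theta> < 2 / b k" by (auto simp: \<theta>_def)
      have "AE \<omega> in M. eventually (\<lambda>n. ereal (b k * ln (real n)) < score \<omega> n n) sequentially"
        using \<theta> True root(2) by (intro score_growth_lower[of \<theta>] sign(2)) (auto simp: field_simps)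
      then show ?thesis by eventually_elim simp
    qed simp
  qed
  have div: "ereal q < x / ereal d" if "ereal (q * d) < x" "d > 0" for q d x
    using that by (cases x) (auto simp: field_simps)
  have div': "x / ereal d < ereal q" if "x < ereal (q * d)" "d > 0" for q d x
    using that by (cases x) (auto simp: field_simps)
  have ln_pos: "eventually (\<lambda>n. ln (real n) > 0) sequentially"
    by (rule eventually_sequentiallyI[of 2]) simp
  have lim_a: "a \<longlonglongrightarrow> 2 / \<theta>'" and lim_b: "b \<longlonglongrightarrow> 2 / \<theta>'"
    using tendsto_add[OF tendsto_const[of "2 / \<theta>'"] LIMSEQ_inverse_real_of_nat]
      tendsto_diff[OF tendsto_const[of "2 / \<theta>'"] LIMSEQ_inverse_real_of_nat]
    by (simp_all add: a_def[abs_def] b_def[abs_def] inverse_eq_divide)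
  from upper lower show ?thesis
  proof eventually_elim
    case (elim \<omega>)
    show ?case
    proof (rule order_tendstoI)
      fix y assume "y < ereal (2 / \<theta>')"
      then obtain q where q: "y < ereal q" "q < 2 / \<theta>'" using ereal_dense2 by fastforce
      have "eventually (\<lambda>k. max q 0 < b k) sequentially"
        using q root(2) by (intro order_tendstoD(1)[OF lim_b]) auto
      then obtain k where k: "max q 0 < b k" by (auto simp: eventually_sequentially)
      then have "eventually (\<lambda>n. ereal (b k * ln (real n)) < score \<omega> n n) sequentially" using elim by auto
      then show "eventually (\<lambda>n. y < score \<omega> n n / ereal (ln (real n))) sequentially"
        using ln_pos
      proof eventually_elim
        case (elim n)
        have "y < ereal (b k)" using q k by (metis less_ereal.simps(1) less_trans max_less_iff_conj)
        then show ?case using div[OF elim] by (rule less_trans)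
      qed
    next
      fix y assume "ereal (2 / \<theta>') < y"
      then obtain q where q: "ereal q < y" "2 / \<theta>' < q" using ereal_dense2 by fastforce
      have "eventually (\<lambda>k. a k < q) sequentially"
        using q by (intro order_tendstoD(2)[OF lim_a]) auto
      then obtain k where k: "a k < q" by (auto simp: eventually_sequentially)
      have "eventually (\<lambda>n. score \<omega> n n < ereal (a k * ln (real n))) sequentially" using elim by auto
      then show "eventually (\<lambda>n. score \<omega> n n / ereal (ln (real n)) < y) sequentially"
        using ln_pos
      proof eventually_elim
        case (elim n)
        have "ereal (a k) < y" using q k by (metis less_ereal.simps(1) less_trans)
        then show ?case using div'[OF elim] by (metis less_trans)
      qed
    qed
  qed
qed

end

section \<open>Varying the intercept of the gap penalty\<close>

text \<open>The intercept enters concavity only at the first increment, and raising it makes that one larger.\<close>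

lemma admissible_gap_mono_intercept:
  assumes "admissible_gap (gap \<Delta> \<gamma>)" "\<Delta> \<le> \<Delta>'" "\<gamma> 1 = 0"
  shows "admissible_gap (gap \<Delta>' \<gamma>)"
proof -
  have g: "0 \<le> gap \<Delta> \<gamma> k" "mono (gap \<Delta> \<gamma>)"
    and conc: "k \<ge> 1 \<Longrightarrow> gap \<Delta> \<gamma> (k + 1) - gap \<Delta> \<gamma> k \<le> gap \<Delta> \<gamma> k - gap \<Delta> \<gamma> (k - 1)" for k
    using assms(1) unfolding admissible_gap_def by blast+
  have nn: "0 \<le> \<Delta> + \<gamma> k" if "k \<ge> 1" for k
    using g(1)[of k] that by (simp add: gap_def)
  have mono: "\<Delta> + \<gamma> k \<le> \<Delta> + \<gamma> j" if "1 \<le> k" "k \<le> j" for k j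
    using monoD[OF g(2) that(2)] that by (simp add: gap_def)
  show ?thesis
    unfolding admissible_gap_def
  proof (intro conjI allI impI)
    show "gap \<Delta>' \<gamma> 0 = 0" by (simp add: gap_def)
    show "0 \<le> gap \<Delta>' \<gamma> k" for k
      using nn[of k] assms(2) by (cases "k = 0") (auto simp: gap_def)
    show "mono (gap \<Delta>' \<gamma>)"
    proof (rule monoI)
      fix k j :: nat assume "k \<le> j"
      then show "gap \<Delta>' \<gamma> k \<le> gap \<Delta>' \<gamma> j"
        using nn[of j] mono[of k j] assms(2) by (auto simp: gap_def)
    qed
    fix k :: nat assume "1 \<le> k"
    then show "gap \<Delta>' \<gamma> (k + 1) - gap \<Delta>' \<gamma> k \<le> gap \<Delta>' \<gamma> k - gap \<Delta>' \<gamma> (k - 1)"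
      using conc[of k] assms(2,3) by (cases "k = 1") (auto simp: gap_def)
  qed
qed

lemma gap_growth:
  assumes "filterlim (\<lambda>k. \<gamma> k / ln (real k)) at_top sequentially" "\<Delta> \<ge> 0"
  shows "filterlim (\<lambda>k. gap \<Delta> \<gamma> k / ln (real k)) at_top sequentially"
proof (rule filterlim_at_top_mono[OF assms(1)])
  show "eventually (\<lambda>k. \<gamma> k / ln (real k) \<le> gap \<Delta> \<gamma> k / ln (real k)) sequentially"
    by (rule eventually_sequentiallyI[of 2])
      (use assms(2) in \<open>auto simp: gap_def intro!: divide_right_mono\<close>)
qed

text \<open>Only the gap of length 0 survives in the limit of a large intercept.\<close>

lemma gap_sum_large_intercept:
  assumes "summable (\<lambda>k. exp (- \<theta> * \<gamma> (Suc k)))" "\<theta> > 0" "0 \<le> A" "A < 1"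
  shows "eventually (\<lambda>\<Delta>. A * (\<Sum>k. exp (- \<theta> * gap \<Delta> \<gamma> k))\<^sup>2 < 1) at_top"
proof -
  define G where "G = (\<Sum>k. exp (- \<theta> * \<gamma> (Suc k)))"
  have e: "(\<Sum>k. exp (- \<theta> * gap \<Delta> \<gamma> k)) = 1 + exp (- \<theta> * \<Delta>) * G" for \<Delta>
  proof -
    have t: "exp (- \<theta> * gap \<Delta> \<gamma> (Suc k)) = exp (- \<theta> * \<Delta>) * exp (- \<theta> * \<gamma> (Suc k))" for k
      by (simp add: gap_def exp_add[symmetric] algebra_simps)
    have "summable (\<lambda>k. exp (- \<theta> * gap \<Delta> \<gamma> (Suc k)))"
      unfolding t using assms(1) by (rule summable_mult)
    then have "summable (\<lambda>k. exp (- \<theta> * gap \<Delta> \<gamma> k))" by (subst (asm) summable_Suc_iff)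
    from suminf_split_head[OF this] show ?thesis
      unfolding t suminf_mult[OF assms(1)] G_def by (simp add: gap_def)
  qed
  have x: "((\<lambda>\<Delta>. exp (- \<theta> * \<Delta>)) \<longlongrightarrow> 0) at_top" using assms(2) by real_asymp
  have "((\<lambda>\<Delta>. A * (1 + exp (- \<theta> * \<Delta>) * G)\<^sup>2) \<longlongrightarrow> A * (1 + 0 * G)\<^sup>2) at_top"
    by (intro tendsto_intros x)
  then show ?thesis unfolding e using assms(4) by (intro order_tendstoD(2)) auto
qed

theorem theorem2:
  fixes M :: "'b measure"
    and X Y :: "nat \<Rightarrow> 'b \<Rightarrow> 'a :: finite"
    and \<mu> :: "'a pmf"
    and K :: "'a \<Rightarrow> 'a \<Rightarrow> real"
    and \<gamma> :: "nat \<Rightarrow> real" and \<Delta> :: real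
  assumes "prob_space M"
    and letters_indep: "prob_space.indep_vars M (\<lambda>_. count_space UNIV) (case_sum X Y) ({1..} <+> {1..})"
    and X_law: "\<And>i. i \<ge> 1 \<Longrightarrow> distr M (count_space UNIV) (X i) = measure_pmf \<mu>"
    and Y_law: "\<And>j. j \<ge> 1 \<Longrightarrow> distr M (count_space UNIV) (Y j) = measure_pmf \<mu>"
    and \<mu>_pos: "\<And>a. pmf \<mu> a > 0"
    and K_sym: "\<And>a b. K a b = K b a"
    and K_mean: "(\<integral>\<omega>. K (X 1 \<omega>) (Y 1 \<omega>) \<partial>M) < 0"
    and K_max: "Max {K a b | a b. True} > 0"
    and admissible: "admissible_gap (gap \<Delta> \<gamma>)"
    and \<gamma>_1: "\<gamma> 1 = 0"
    and \<gamma>_growth: "filterlim (\<lambda>k. \<gamma> k / ln (real k)) at_top sequentially"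
  shows
    "(\<forall>\<theta>>0. convergent (\<lambda>\<kappa>. psi_kappa M X Y K (gap \<Delta> \<gamma>) \<kappa> \<theta> / ereal (real \<kappa>))
            \<and> \<bar>psi M X Y K (gap \<Delta> \<gamma>) \<theta>\<bar> \<noteq> \<infinity>)
     \<and> convex_on {0<..} (\<lambda>\<theta>. real_of_ereal (psi M X Y K (gap \<Delta> \<gamma>) \<theta>))
     \<and> (\<exists>\<Delta>\<^sub>0. \<forall>\<Delta>'\<ge>\<Delta>\<^sub>0. \<exists>!\<theta>. \<theta> > 0 \<and> psi M X Y K (gap \<Delta>' \<gamma>) \<theta> = 0)
     \<and> (\<forall>\<theta>'. (\<exists>!\<theta>. \<theta> > 0 \<and> psi M X Y K (gap \<Delta> \<gamma>) \<theta> = 0)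
              \<and> \<theta>' > 0 \<and> psi M X Y K (gap \<Delta> \<gamma>) \<theta>' = 0 \<longrightarrow>
          (\<forall>m n :: real \<Rightarrow> nat.
             (\<forall>c>0. m c > 0 \<and> n c > 0)
             \<and> filterlim (\<lambda>c. real (min (m c) (n c)) / c) at_top at_top
             \<and> (\<lambda>c. ln (real (m c) * real (n c))) \<in> o[at_top](\<lambda>c. c) \<longrightarrow>
             ((\<lambda>c. - (1 / c) * ln (measure M {\<omega> \<in> space M.
                 ereal c \<le> local_score K (gap \<Delta> \<gamma>) (\<lambda>i. X i \<omega>) (\<lambda>j. Y j \<omega>) (m c) (n c)}))
              \<longlongrightarrow> \<theta>') at_top)
          \<and> (AE \<omega> in M.
             (\<lambda>n. local_score K (gap \<Delta> \<gamma>) (\<lambda>i. X i \<omega>) (\<lambda>j. Y j \<omega>) n n / ereal (ln (real n)))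
               \<longlonglongrightarrow> ereal (2 / \<theta>')))"
proof -
  interpret prob_space M by fact
  let ?g = "gap \<Delta> \<gamma>"
  have \<Delta>0: "\<Delta> \<ge> 0"
  proof -
    have "0 \<le> gap \<Delta> \<gamma> 1" using admissible unfolding admissible_gap_def by blast
    then show ?thesis by (simp add: gap_def \<gamma>_1[unfolded One_nat_def])
  qed
  have Kpos: "\<exists>a b. K a b > 0"
  proof -
    have fin: "finite {K a b | a b. True}"
      by (rule finite_subset[of _ "range (\<lambda>(a, b). K a b)"]) auto
    have "Max {K a b | a b. True} \<in> {K a b | a b. True}" by (rule Max_in[OF fin]) auto
    then obtain a b where "Max {K a b | a b. True} = K a b" by blast
    with K_max have "K a b > 0" by argo
    then show ?thesis by blast
  qed
  have rs: "random_scoring M X Y \<mu> K (gap \<Delta>' \<gamma>)" if "\<Delta>' \<ge> \<Delta>" for \<Delta>'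
  proof (intro_locales)
    show "random_words_axioms M X Y \<mu>"
      by unfold_locales (use letters_indep X_law Y_law in auto)
    show "scoring \<mu> K (gap \<Delta>' \<gamma>)"
    proof
      show "admissible_gap (gap \<Delta>' \<gamma>)"
        by (rule admissible_gap_mono_intercept[OF admissible that \<gamma>_1])
      show "filterlim (\<lambda>k. gap \<Delta>' \<gamma> k / ln (real k)) at_top sequentially"
        using that \<Delta>0 by (intro gap_growth[OF \<gamma>_growth]) auto
    qed (use \<mu>_pos K_sym Kpos in auto)
  qed
  interpret S: random_scoring M X Y \<mu> K ?g by (rule rs) simp
  have "\<forall>\<theta>>0. convergent (\<lambda>\<kappa>. psi_kappa M X Y K ?g \<kappa> \<theta> / ereal (real \<kappa>))
            \<and> \<bar>psi M X Y K ?g \<theta>\<bar> \<noteq> \<infinity>"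
    using S.psi_eq_Psi by (auto simp: convergent_def)
  moreover have "convex_on {0<..} (\<lambda>\<theta>. real_of_ereal (psi M X Y K ?g \<theta>))"
  proof (rule convex_onI)
    fix t x y :: real
    assume t: "0 < t" "t < 1" and xy: "x \<in> {0<..}" "y \<in> {0<..}"
    then have "(1 - t) *\<^sub>R x + t *\<^sub>R y > 0" by (auto intro: add_pos_pos)
    with xy convex_onD[OF S.Psi_convex, of t x y] t
    show "real_of_ereal (psi M X Y K ?g ((1 - t) *\<^sub>R x + t *\<^sub>R y))
      \<le> (1 - t) * real_of_ereal (psi M X Y K ?g x) + t * real_of_ereal (psi M X Y K ?g y)"
      by (simp add: S.psi_eq_Psi(2))
  qed simp
  moreover have "\<exists>\<Delta>\<^sub>0. \<forall>\<Delta>'\<ge>\<Delta>\<^sub>0. \<exists>!\<theta>. \<theta> > 0 \<and> psi M X Y K (gap \<Delta>' \<gamma>) \<theta> = 0"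
  proof -
    obtain \<theta> where \<theta>: "\<theta> > 0" "S.letter_mgf \<theta> < 1"
      using S.letter_mgf_less_1 K_mean unfolding S.mean_score by blast
    have "summable (\<lambda>k. exp (- \<theta> * ?g (Suc k)))"
      using S.summable_exp_gap[OF \<theta>(1)] by (subst summable_Suc_iff)
    then have "summable (\<lambda>k. exp (\<theta> * \<Delta>) * exp (- \<theta> * ?g (Suc k)))" by (rule summable_mult)
    also have "(\<lambda>k. exp (\<theta> * \<Delta>) * exp (- \<theta> * ?g (Suc k))) = (\<lambda>k. exp (- \<theta> * \<gamma> (Suc k)))"
      by (simp add: gap_def exp_add[symmetric] algebra_simps)
    finally have sm: "summable (\<lambda>k. exp (- \<theta> * \<gamma> (Suc k)))" .
    have m0: "0 \<le> S.letter_mgf \<theta>" unfolding S.letter_mgf_def by (intro sum_nonneg) auto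
    obtain \<Delta>1 where \<Delta>1: "\<And>\<Delta>'. \<Delta>' \<ge> \<Delta>1 \<Longrightarrow>
      S.letter_mgf \<theta> * (\<Sum>k. exp (- \<theta> * gap \<Delta>' \<gamma> k))\<^sup>2 < 1"
      using gap_sum_large_intercept[OF sm \<theta>(1) m0 \<theta>(2)] by (auto simp: eventually_at_top_linorder)
    have "\<exists>!\<theta>. \<theta> > 0 \<and> psi M X Y K (gap \<Delta>' \<gamma>) \<theta> = 0" if "\<Delta>' \<ge> max \<Delta> \<Delta>1" for \<Delta>'
    proof -
      interpret S': random_scoring M X Y \<mu> K "gap \<Delta>' \<gamma>" using that by (intro rs) auto
      have "S'.Psi \<theta> < 0"
        using \<Delta>1[of \<Delta>'] that \<theta> by (intro S'.Psi_neg_if_h_1) (auto simp: S'.gap_sum_def)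
      from S'.Psi_unique_root[OF \<theta>(1) this]
      show ?thesis by (metis S'.psi_eq_Psi(2) ereal_eq_0(1))
    qed
    then show ?thesis by blast
  qed
  moreover have "\<forall>\<theta>'. (\<exists>!\<theta>. \<theta> > 0 \<and> psi M X Y K ?g \<theta> = 0)
              \<and> \<theta>' > 0 \<and> psi M X Y K ?g \<theta>' = 0 \<longrightarrow>
          (\<forall>m n :: real \<Rightarrow> nat.
             (\<forall>c>0. m c > 0 \<and> n c > 0)
             \<and> filterlim (\<lambda>c. real (min (m c) (n c)) / c) at_top at_top
             \<and> (\<lambda>c. ln (real (m c) * real (n c))) \<in> o[at_top](\<lambda>c. c) \<longrightarrow>
             ((\<lambda>c. - (1 / c) * ln (measure M {\<omega> \<in> space M.
                 ereal c \<le> local_score K ?g (\<lambda>i. X i \<omega>) (\<lambda>j. Y j \<omega>) (m c) (n c)}))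
              \<longlongrightarrow> \<theta>') at_top)
          \<and> (AE \<omega> in M.
             (\<lambda>n. local_score K ?g (\<lambda>i. X i \<omega>) (\<lambda>j. Y j \<omega>) n n / ereal (ln (real n)))
               \<longlonglongrightarrow> ereal (2 / \<theta>'))"
    (is "\<forall>\<theta>'. _ \<longrightarrow> ?C \<theta>'")
  proof (intro allI impI, elim conjE)
    fix \<theta>' assume "\<exists>!\<theta>. \<theta> > 0 \<and> psi M X Y K ?g \<theta> = 0" "\<theta>' > 0" "psi M X Y K ?g \<theta>' = 0"
    then have root: "\<exists>!\<theta>. \<theta> > 0 \<and> S.Psi \<theta> = 0" "\<theta>' > 0" "S.Psi \<theta>' = 0"
      by (metis S.psi_eq_Psi(2) ereal_eq_0(1))+
    show "?C \<theta>'"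
      using S.score_tail[OF root] S.score_growth[OF root] by blast
  qed
  ultimately show ?thesis by (intro conjI)
qed

end
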